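(* Let $d\ge1$, $1<p,q<\infty$, let $\mathbb X=\mathfrak f_{p,q}(\mathscr R_d)$ and let $\mathcal D$ be its canonical basis. Define $$h(p,q;d)=(d-1)\Big(\frac1p-\frac1q\Big)_+,\qquad \alpha(p,q)=\begin{cases}1&\text{if }p\le q,\\ q'/p'&\text{if }q\le p.\end{cases}$$ Let $\tau\in(0,1]$. Then there exist $c=c(p,q,d,\tau)>0$ and a constant $C>0$ such that the Weak Chebyshev Greedy Algorithm with weakness parameter $\tau$ satisfies, with $$\phi(N)=\big\lfloor c\,(1+\log N)^{p'h(p,q;d)}\,N^{\alpha(p,q)}\big\rfloor,$$ $$\|\mathbf x-\mathscr G_{\phi(N)}(\mathbf x)\|\le C\,\sigma_N(\mathbf x)\qquad\text{for all }N\ge1,\ \mathbf x\in\mathbb X.$$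
   Context: Scalars are $\mathbb K=\mathbb R$ or $\mathbb C$; $p'=p/(p-1)$, $q'=q/(q-1)$, $a_+=\max\{a,0\}$. $\mathscr R_d$ is the set of all dyadic rectangles $I=I_1\times\dots\times I_d\subset[0,1]^d$ with $I_i=2^{-j_i}(k_i+[0,1))$, $j_i,k_i\in\{0,1,2,\dots\}$, $0\le k_i<2^{j_i}$. $\mathbf 1_{I,p}=|I|^{-1/p}\mathbf 1_I$. The space $\mathfrak f_{p,q}(\mathscr R_d)$ consists of all scalar sequences $\mathbf x=(x_I)_{I\in\mathscr R_d}$ with finite norm $$\|\mathbf x\|=\Big\|\Big(\sum_{I\in\mathscr R_d}|x_I\mathbf 1_{I,p}|^q\Big)^{1/q}\Big\|_{L^p([0,1]^d)},$$ and $\{\mathbf e_I\}_{I\in\mathscr R_d}$ is its canonical basis. For a dictionary $\mathcal D$ (unit vectors with dense span), $\Sigma_N$ is the set of linear combinations of at most $N$ elements of $\mathcal D$, $\sigma_N(f)=\inf_{a\in\Sigma_N}\|f-a\|$. For $f\neq0$, $F_f\in\mathbb X^*$ is the norming functional: $\|F_f\|_{\mathbb X^*}=1$, $F_f(f)=\|f\|$. Square brackets denote linear span. Weak Chebyshev Greedy Algorithm (WCGA) with parameter $\tau\in(0,1]$: given $f\neq0$ put $f_0=f$. At step $n+1$ choose any $\varphi_{i_{n+1}}\in\mathcal D$ with $|F_{f_n}(\varphi_{i_{n+1}})|\ge\tau\sup_{\varphi\in\mathcal D}|F_{f_n}(\varphi)|$; let $\mathscr G_{n+1}(f)$ be any element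 of $[\varphi_{i_1},\dots,\varphi_{i_{n+1}}]$ with $\|f-\mathscr G_{n+1}(f)\|=\mathrm{dist}(f,[\varphi_{i_1},\dots,\varphi_{i_{n+1}}])$; put $f_{n+1}=f-\mathscr G_{n+1}(f)$. Iterate indefinitely, or until the remainder is $0$ (in which case the later remainders are also taken to be $0$). Also $\mathscr G_0(f)=0$. A bound for $\|f-\mathscr G_n(f)\|$ is understood to hold for every admissible run of the algorithm. *)

theory Defs
  imports "HOL-Analysis.Analysis" "HOL-Library.Function_Algebras"
begin

section \<open>Greedy approximation in sequence spaces\<close>

text \<open>
  A normed space of scalar sequences over an index type is given by its carrier
  \<open>X\<close>, a set of functions, and its norm \<open>nrm\<close>, of which only the values on \<open>X\<close> matter.
  The vector operations are the pointwise ones.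
\<close>

definition seq_scale :: "'k::real_normed_field \<Rightarrow> ('i \<Rightarrow> 'k) \<Rightarrow> ('i \<Rightarrow> 'k)" where
  "seq_scale c x = (\<lambda>i. c * x i)"

lemma vector_space_seq_scale: "vector_space seq_scale"
  by unfold_locales (auto simp: seq_scale_def fun_eq_iff algebra_simps)

abbreviation seq_span :: "('i \<Rightarrow> 'k::real_normed_field) set \<Rightarrow> ('i \<Rightarrow> 'k) set" where
  "seq_span \<equiv> module.span seq_scale"

definition Sigma_N :: "('i \<Rightarrow> 'k::real_normed_field) set \<Rightarrow> nat \<Rightarrow> ('i \<Rightarrow> 'k) set" where
  "Sigma_N D N = (\<Union>S \<in> {S. S \<subseteq> D \<and> finite S \<and> card S \<le> N}. seq_span S)"

definition dist_to :: "(('i \<Rightarrow> 'k::real_normed_field) \<Rightarrow> real) \<Rightarrow> ('i \<Rightarrow> 'k) \<Rightarrow> ('i \<Rightarrow> 'k) set \<Rightarrow> real" where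
  "dist_to nrm f A = (INF a\<in>A. nrm (f - a))"

definition sigma_N ::
  "(('i \<Rightarrow> 'k::real_normed_field) \<Rightarrow> real) \<Rightarrow> ('i \<Rightarrow> 'k) set \<Rightarrow> nat \<Rightarrow> ('i \<Rightarrow> 'k) \<Rightarrow> real" where
  "sigma_N nrm D N f = dist_to nrm f (Sigma_N D N)"

definition bounded_functional ::
  "('i \<Rightarrow> 'k::real_normed_field) set \<Rightarrow> (('i \<Rightarrow> 'k) \<Rightarrow> real) \<Rightarrow> (('i \<Rightarrow> 'k) \<Rightarrow> 'k) \<Rightarrow> bool" where
  "bounded_functional X nrm F \<longleftrightarrow>
     (\<forall>x\<in>X. \<forall>y\<in>X. F (x + y) = F x + F y) \<and>
     (\<forall>c. \<forall>x\<in>X. F (seq_scale c x) = c * F x) \<and>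
     (\<exists>B. \<forall>x\<in>X. norm (F x) \<le> B * nrm x)"

definition dual_norm ::
  "('i \<Rightarrow> 'k::real_normed_field) set \<Rightarrow> (('i \<Rightarrow> 'k) \<Rightarrow> real) \<Rightarrow> (('i \<Rightarrow> 'k) \<Rightarrow> 'k) \<Rightarrow> real" where
  "dual_norm X nrm F = (SUP x\<in>{x \<in> X. nrm x \<le> 1}. norm (F x))"

definition norming_functional ::
  "('i \<Rightarrow> 'k::real_normed_field) set \<Rightarrow> (('i \<Rightarrow> 'k) \<Rightarrow> real) \<Rightarrow> ('i \<Rightarrow> 'k) \<Rightarrow> (('i \<Rightarrow> 'k) \<Rightarrow> 'k) \<Rightarrow> bool"
  where
  "norming_functional X nrm f F \<longleftrightarrow>
     bounded_functional X nrm F \<and> dual_norm X nrm F = 1 \<and> F f = of_real (nrm f)"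

text \<open>
  \<open>G\<close> is the sequence of approximants of an admissible run of the Weak Chebyshev Greedy
  Algorithm for \<open>f\<close>; \<open>\<phi> n\<close> is the dictionary element selected in step \<open>n + 1\<close>. Once the
  remainder \<open>f - G n\<close> is zero nothing more is selected and the remainder stays zero.
\<close>

definition wcga_run ::
  "('i \<Rightarrow> 'k::real_normed_field) set \<Rightarrow> (('i \<Rightarrow> 'k) \<Rightarrow> real) \<Rightarrow> ('i \<Rightarrow> 'k) set \<Rightarrow> real \<Rightarrow>
   ('i \<Rightarrow> 'k) \<Rightarrow> (nat \<Rightarrow> 'i \<Rightarrow> 'k) \<Rightarrow> bool" where
  "wcga_run X nrm D \<tau> f G \<longleftrightarrow>
     G 0 = 0 \<and>
     (\<exists>\<phi> :: nat \<Rightarrow> 'i \<Rightarrow> 'k. \<forall>n.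
        if f - G n = 0 then G (Suc n) = G n
        else \<phi> n \<in> D \<and>
             (\<exists>F. norming_functional X nrm (f - G n) F \<and>
                  norm (F (\<phi> n)) \<ge> \<tau> * (SUP g\<in>D. norm (F g))) \<and>
             G (Suc n) \<in> seq_span (\<phi> ` {..n}) \<and>
             nrm (f - G (Suc n)) = dist_to nrm f (seq_span (\<phi> ` {..n})))"


section \<open>The spaces \<open>f_{p,q}\<close> on dyadic rectangles\<close>

text \<open>Points of d-dimensional space are extensional functions on \<open>{..<d}\<close>.\<close>

type_synonym point = "nat \<Rightarrow> real"

definition volume :: "nat \<Rightarrow> point measure" where
  "volume d = PiM {..<d} (\<lambda>_. lborel)"

definition unit_cube :: "nat \<Rightarrow> point set" where
  "unit_cube d = PiE {..<d} (\<lambda>_. {0..1})"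

definition dyadic_interval :: "nat \<Rightarrow> nat \<Rightarrow> real set" where
  "dyadic_interval j k = {real k / 2 ^ j ..< (real k + 1) / 2 ^ j}"

definition dyadic_rects :: "nat \<Rightarrow> point set set" where
  "dyadic_rects d =
     {PiE {..<d} (\<lambda>i. dyadic_interval (j i) (k i)) | j k. \<forall>i<d. k i < 2 ^ j i}"

definition normalized_indicator :: "nat \<Rightarrow> real \<Rightarrow> point set \<Rightarrow> point \<Rightarrow> real" where
  "normalized_indicator d p I t = measure (volume d) I powr (-1/p) * indicator I t"

text \<open>Only used with positive exponents \<open>r\<close>, so that infinity is mapped to infinity.\<close>

definition ennreal_pow :: "ennreal \<Rightarrow> real \<Rightarrow> ennreal" where
  "ennreal_pow a r = (if a = top then top else ennreal (enn2real a powr r))"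

definition square_function ::
  "real \<Rightarrow> real \<Rightarrow> nat \<Rightarrow> (point set \<Rightarrow> 'k::real_normed_field) \<Rightarrow> point \<Rightarrow> ennreal" where
  "square_function p q d x t =
     ennreal_pow
       (\<Sum>\<^sub>\<infinity>I\<in>dyadic_rects d. ennreal ((norm (x I) * normalized_indicator d p I t) powr q)) (1/q)"

definition f_ennnorm ::
  "real \<Rightarrow> real \<Rightarrow> nat \<Rightarrow> (point set \<Rightarrow> 'k::real_normed_field) \<Rightarrow> ennreal" where
  "f_ennnorm p q d x =
     ennreal_pow (\<integral>\<^sup>+t\<in>unit_cube d. ennreal_pow (square_function p q d x t) p \<partial>volume d) (1/p)"

text \<open>Sequences indexed by the dyadic rectangles are extended by 0 to all sets of points.\<close>

definition f_space :: "real \<Rightarrow> real \<Rightarrow> nat \<Rightarrow> (point set \<Rightarrow> 'k::real_normed_field) set" where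
  "f_space p q d = {x. (\<forall>I. I \<notin> dyadic_rects d \<longrightarrow> x I = 0) \<and> f_ennnorm p q d x < top}"

definition f_norm :: "real \<Rightarrow> real \<Rightarrow> nat \<Rightarrow> (point set \<Rightarrow> 'k::real_normed_field) \<Rightarrow> real" where
  "f_norm p q d x = enn2real (f_ennnorm p q d x)"

definition unit_seq :: "'i \<Rightarrow> 'i \<Rightarrow> 'k::real_normed_field" where
  "unit_seq I = (\<lambda>J. if J = I then 1 else 0)"

definition canonical_basis :: "nat \<Rightarrow> (point set \<Rightarrow> 'k::real_normed_field) set" where
  "canonical_basis d = unit_seq ` dyadic_rects d"


section \<open>The parameters\<close>

definition conj_exp :: "real \<Rightarrow> real" where
  "conj_exp p = p / (p - 1)"

definition h_exp :: "real \<Rightarrow> real \<Rightarrow> nat \<Rightarrow> real" where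
  "h_exp p q d = (real d - 1) * max (1/p - 1/q) 0"

definition alpha_exp :: "real \<Rightarrow> real \<Rightarrow> real" where
  "alpha_exp p q = (if p \<le> q then 1 else conj_exp q / conj_exp p)"

definition phi_steps :: "real \<Rightarrow> real \<Rightarrow> nat \<Rightarrow> real \<Rightarrow> nat \<Rightarrow> nat" where
  "phi_steps p q d c N =
     nat \<lfloor>c * (1 + ln (real N)) powr (conj_exp p * h_exp p q d) * real N powr alpha_exp p q\<rfloor>"

end

theory Submission
  imports Defs
begin

text \<open>
  Write \<open>\<parallel>x\<parallel>\<^sup>p = \<integral> Z\<^sup>r\<close> with \<open>r = p/q\<close> and \<open>Z = \<Sum> v\<^sub>I\<close>, \<open>v\<^sub>I = |x\<^sub>I 1\<^sub>I\<^sub>,\<^sub>p|\<^sup>q\<close>. The norm is strictly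
  monotone in every coordinate, so the algorithm merely deletes the selected coordinates, and a best
  \<open>N\<close>-term approximation may be taken to be the projection to a set \<open>B\<close> of \<open>N\<close> coordinates.

  As long as the remainder \<open>f\<close> is large compared with \<open>\<sigma>\<^sub>N\<close>, the functional \<open>F\<^sub>f\<close> must be of size at
  least \<open>1/(2\<Lambda>)\<close> at some basis vector from \<open>B\<close>, where \<open>\<Lambda>\<close> is the best constant in
  \<open>\<Sum>\<^sub>B |y\<^sub>I| \<le> \<Lambda> \<parallel>y\<parallel>\<close>. Hence \<open>\<integral> Z\<^sup>r\<^sup>-\<^sup>1 v\<^sub>I\<close> is at least a constant times \<open>\<Lambda>\<^sup>-\<^sup>s \<parallel>f\<parallel>\<^sup>p\<close> for every
  selected \<open>I\<close>, with \<open>s\<close> the conjugate exponent of \<open>min p q\<close>. Over the steps that select coordinates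
  outside \<open>B\<close> these integrals sum up to at most a power of the norm of \<open>x\<close> off \<open>B\<close>, i.e. of
  \<open>\<sigma>\<^sub>N\<close>, so there are at most about \<open>\<Lambda>\<^sup>s\<close> such steps, and at most \<open>N\<close> others.

  Finally \<open>\<Lambda> = N\<^sup>1\<^sup>/\<^sup>p'\<close> for \<open>q \<le> p\<close>. For \<open>p \<le> q\<close>, by duality, \<open>\<Lambda>\<^sup>p'\<close> is at most the integral of
  \<open>(\<Sum>\<^sub>B |I|\<^sup>-\<^sup>1\<^sup>/\<^sup>\<rho> 1\<^sub>I)\<^sup>\<rho>\<close> with \<open>\<rho> = p'/q'\<close>, which is bounded by a constant times
  \<open>N (1 + log N)\<^sup>(\<^sup>d\<^sup>-\<^sup>1\<^sup>)\<^sup>(\<^sup>\<rho>\<^sup>-\<^sup>1\<^sup>)\<close> by induction on the dimension.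
\<close>

section \<open>Inequalities for real powers\<close>

text \<open>On the open half line this is \<open>powr_convex\<close>; if an argument vanishes, it
  reduces to s^r \<le> s for s in [0,1].\<close>

lemma powr_convex_nonneg:
  fixes a b t r :: real
  assumes "a \<ge> 0" "b \<ge> 0" "0 \<le> t" "t \<le> 1" "r \<ge> 1"
  shows "((1 - t) * a + t * b) powr r \<le> (1 - t) * a powr r + t * b powr r"
proof -
  have scale: "(s * c) powr r \<le> s * c powr r" if "0 \<le> s" "s \<le> 1" "c \<ge> 0" for s c :: real
    using that assms powr_mono'[of 1 r s]
    by (cases "s = 0") (auto simp: powr_mult intro!: mult_right_mono)
  show ?thesis
  proof (cases "a = 0 \<or> b = 0")
    case True
    then show ?thesis using scale[of t b] scale[of "1 - t" a] assms by auto
  next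
    case False
    then show ?thesis
      using convex_onD[OF powr_convex[OF \<open>r \<ge> 1\<close>], of t a b] assms by auto
  qed
qed

text \<open>After division by a + b both terms lie in [0,1], where the power r \<le> 1 can only
  increase them, and they sum to 1.\<close>

lemma powr_subadditive:
  fixes a b r :: real
  assumes "a \<ge> 0" "b \<ge> 0" "0 < r" "r \<le> 1"
  shows "(a + b) powr r \<le> a powr r + b powr r"
proof (cases "a + b = 0")
  case False
  then have pos: "a + b > 0" using assms by simp
  have le: "x / (a + b) \<le> (x / (a + b)) powr r" if "0 \<le> x" "x \<le> a + b" for x
    using powr_mono'[of r 1 "x / (a + b)"] that assms pos by (auto simp: divide_simps)
  have "1 \<le> (a / (a + b)) powr r + (b / (a + b)) powr r"
  proof -
    have "a / (a + b) + b / (a + b) = 1" using pos by (simp add: add_divide_distrib[symmetric])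
    then show ?thesis using le[of a] le[of b] assms by linarith
  qed
  also have "\<dots> = (a powr r + b powr r) / (a + b) powr r"
    using assms pos by (simp add: powr_divide add_divide_distrib)
  finally show ?thesis using pos by (simp add: divide_simps)
qed (use assms in auto)

lemma powr_superadditive:
  fixes a b r :: real
  assumes "a \<ge> 0" "b \<ge> 0" "1 \<le> r"
  shows "a powr r + b powr r \<le> (a + b) powr r"
proof -
  have "a powr r = a powr (r - 1) * a" "b powr r = b powr (r - 1) * b"
       "(a + b) powr r = (a + b) powr (r - 1) * (a + b)"
    using assms by (auto simp: powr_mult_base[symmetric] mult.commute powr_diff)
  moreover have "a powr (r - 1) \<le> (a + b) powr (r - 1)" "b powr (r - 1) \<le> (a + b) powr (r - 1)"
    using assms by (auto intro!: powr_mono2)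
  ultimately show ?thesis using assms
    by (simp add: distrib_left add_mono mult_right_mono)
qed

lemma sum_powr_le_powr_sum:
  fixes f :: "'i \<Rightarrow> real"
  assumes "finite A" "\<And>i. i \<in> A \<Longrightarrow> f i \<ge> 0" "1 \<le> r"
  shows "(\<Sum>i\<in>A. f i powr r) \<le> (\<Sum>i\<in>A. f i) powr r"
  using assms
proof (induction A rule: finite_induct)
  case (insert i A)
  then show ?case
    using powr_superadditive[of "f i" "sum f A" r] by (simp add: sum_nonneg)
qed auto

lemma powr_add_le:
  fixes a b r :: real
  assumes "a \<ge> 0" "b \<ge> 0" "r > 0"
  shows "(a + b) powr r \<le> 2 powr r * (a powr r + b powr r)"
proof -
  have "(a + b) powr r \<le> (2 * max a b) powr r" using assms by (intro powr_mono2) auto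
  also have "\<dots> = 2 powr r * max a b powr r" using assms by (simp add: powr_mult)
  also have "max a b powr r \<le> a powr r + b powr r" by (auto simp: max_def)
  finally show ?thesis by (simp add: mult_left_mono)
qed

text \<open>Dividing by z^r leaves a bound for (1 + k u)^r - 1 with u = y/z in [0,1]. For r \<ge> 1
  it follows from the chord of the convex power over [0,1]; for r < 1 the expression is at most k u.
  Adding the two constants serves both cases at once.\<close>

lemma powr_add_scaled_le:
  fixes z y k r :: real
  assumes "0 \<le> y" "y \<le> z" "0 \<le> k" "0 < r"
  shows "(z + k * y) powr r - z powr r \<le> ((1 + k) powr r + k) * (z powr (r - 1) * y)"
proof (cases "z = 0")
  case False
  then have z: "z > 0" using assms by simp
  define u where "u = y / z"
  have u: "0 \<le> u" "u \<le> 1" and y: "y = u * z" using assms z by (auto simp: u_def)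
  have "(1 + k * u) powr r - 1 \<le> ((1 + k) powr r + k) * u"
  proof (cases "r \<ge> 1")
    case True
    have "((1 - u) * 1 + u * (1 + k)) powr r \<le> (1 - u) * 1 powr r + u * (1 + k) powr r"
      using u assms True by (intro powr_convex_nonneg) auto
    moreover have "(1 - u) * 1 + u * (1 + k) = 1 + k * u" by (simp add: algebra_simps)
    moreover have "0 \<le> k * u" using u assms by simp
    ultimately show ?thesis using u by (simp add: algebra_simps)
  next
    case False
    have "(1 + k * u) powr r \<le> (1 + k * u) powr 1"
      using False u assms by (intro powr_mono) auto
    moreover have "0 \<le> (1 + k) powr r * u" "0 \<le> k * u" using u assms by auto
    moreover have "(1 + k * u) powr 1 = 1 + k * u" using u assms by simp
    ultimately show ?thesis unfolding distrib_right by linarith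
  qed
  then have "((1 + k * u) powr r - 1) * z powr r \<le> ((1 + k) powr r + k) * u * z powr r"
    by (intro mult_right_mono) auto
  moreover have "(z + k * y) powr r = (1 + k * u) powr r * z powr r"
    using z u assms by (simp add: powr_mult[symmetric] y algebra_simps)
  moreover have "z powr (r - 1) * y = u * z powr r"
    using z by (simp add: y powr_diff)
  ultimately show ?thesis by (simp add: algebra_simps)
qed (use assms in auto)

text \<open>The tangent of the concave power at \<open>a\<close>, from the weighted
  arithmetic-geometric mean inequality for b/a and 1.\<close>

lemma powr_concave_tangent:
  fixes a b r :: real
  assumes "0 \<le> b" "b \<le> a" "0 < r" "r \<le> 1"
  shows "r * (a powr (r - 1) * (a - b)) \<le> a powr r - b powr r"
proof (cases "b = 0")
  case True
  have "r * a powr r \<le> 1 * a powr r" using assms by (intro mult_right_mono) auto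
  then show ?thesis using True assms by (cases "a = 0") (auto simp: powr_diff)
next
  case False
  then have a: "a > 0" "b > 0" using assms by auto
  have "(b / a) powr r * 1 powr (1 - r) \<le> r * (b / a) + (1 - r) * 1"
    using a assms by (intro Youngs_inequality_0) auto
  then have "((b / a) powr r) * a powr r \<le> (r * (b / a) + (1 - r)) * a powr r"
    by (intro mult_right_mono) auto
  moreover have "((b / a) powr r) * a powr r = b powr r" using a by (simp add: powr_divide)
  moreover have "a powr (r - 1) * (a - b) = a powr r - b / a * a powr r"
    using a by (simp add: powr_diff diff_divide_distrib right_diff_distrib)
  then have "r * (a powr (r - 1) * (a - b)) = r * (a powr r - b / a * a powr r)" by (rule arg_cong)
  ultimately show ?thesis by (simp add: ring_distribs mult.assoc)
qed

text \<open>A tangent inequality without the factor p; it only compares b^(p-1) with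
  a^(p-1).\<close>

lemma powr_tangent_le:
  fixes a b p :: real
  assumes "0 \<le> b" "b \<le> a" "1 \<le> p"
  shows "b powr (p - 1) * (a - b) \<le> a powr p - b powr p"
proof -
  have "b powr p = b powr (p - 1) * b" "a powr p = a powr (p - 1) * a"
    using assms by (auto simp: powr_diff)
  moreover have "b powr (p - 1) * a \<le> a powr (p - 1) * a"
    using assms by (intro mult_right_mono powr_mono2) auto
  ultimately show ?thesis by (simp add: algebra_simps)
qed

section \<open>Hoelder's inequality and power means\<close>

lemma Holder_integral:
  fixes f g :: "'a \<Rightarrow> real" and p q :: real
  assumes pq: "p > 1" "q > 1" "1/p + 1/q = 1"
    and [measurable]: "f \<in> borel_measurable M" "g \<in> borel_measurable M"
    and nn: "\<And>x. f x \<ge> 0" "\<And>x. g x \<ge> 0"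
    and int: "integrable M (\<lambda>x. f x powr p)" "integrable M (\<lambda>x. g x powr q)"
  shows "integrable M (\<lambda>x. f x * g x)"
    and "(\<integral>x. f x * g x \<partial>M) \<le> (\<integral>x. f x powr p \<partial>M) powr (1/p) * (\<integral>x. g x powr q \<partial>M) powr (1/q)"
proof -
  have Y: "f x * g x \<le> f x powr p / p + g x powr q / q" for x
    using Youngs_inequality[OF pq nn(1) nn(2)] .
  show int_fg: "integrable M (\<lambda>x. f x * g x)"
    by (rule Bochner_Integration.integrable_bound[where f = "\<lambda>x. f x powr p / p + g x powr q / q"])
       (use int Y nn pq in \<open>auto intro!: AE_I2 simp: abs_mult\<close>)
  define A where "A = (\<integral>x. f x powr p \<partial>M)"
  define B where "B = (\<integral>x. g x powr q \<partial>M)"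
  have AB: "A \<ge> 0" "B \<ge> 0" by (auto simp: A_def B_def)
  show "(\<integral>x. f x * g x \<partial>M) \<le> A powr (1/p) * B powr (1/q)"
  proof (cases "A = 0 \<or> B = 0")
    case True
    have "AE x in M. f x * g x = 0"
    proof (cases "A = 0")
      case True
      have "AE x in M. f x powr p = 0"
        using integral_nonneg_eq_0_iff_AE[OF int(1)] True by (auto simp: A_def)
      then show ?thesis by eventually_elim (use nn pq in auto)
    next
      case False
      then have "AE x in M. g x powr q = 0"
        using integral_nonneg_eq_0_iff_AE[OF int(2)] True by (auto simp: B_def)
      then show ?thesis by eventually_elim (use nn pq in auto)
    qed
    then have "(\<integral>x. f x * g x \<partial>M) = (\<integral>x. 0 \<partial>M)" by (intro integral_cong_AE) auto
    then show ?thesis by simp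
  next
    case False
    then have pos: "A > 0" "B > 0" using AB by auto
    define a where "a = A powr (1/p)"
    define b where "b = B powr (1/q)"
    have ab: "a > 0" "b > 0" using pos by (auto simp: a_def b_def)
    have apow: "a powr p = A" "b powr q = B" using pos pq by (auto simp: a_def b_def powr_powr)
    have Y': "f x * g x / (a * b) \<le> f x powr p / (p * A) + g x powr q / (q * B)" for x
      using Youngs_inequality[OF pq, of "f x / a" "g x / b"] nn ab
      by (simp add: powr_divide apow field_simps)
    have "(\<integral>x. f x * g x / (a * b) \<partial>M) \<le> (\<integral>x. f x powr p / (p * A) + g x powr q / (q * B) \<partial>M)"
      by (intro integral_mono) (use int int_fg Y' in auto)
    also have "\<dots> = A / (p * A) + B / (q * B)"
      using int by (simp add: A_def B_def)
    also have "\<dots> = 1" using pos pq by simp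
    finally show ?thesis using ab by (simp add: a_def[symmetric] b_def[symmetric] field_simps)
  qed
qed

lemma Holder_sum:
  fixes f g :: "'i \<Rightarrow> real" and p q :: real
  assumes "finite A" "p > 1" "q > 1" "1/p + 1/q = 1" "\<And>i. i \<in> A \<Longrightarrow> f i \<ge> 0" "\<And>i. i \<in> A \<Longrightarrow> g i \<ge> 0"
  shows "(\<Sum>i\<in>A. f i * g i) \<le> (\<Sum>i\<in>A. f i powr p) powr (1/p) * (\<Sum>i\<in>A. g i powr q) powr (1/q)"
proof -
  have "(\<integral>i. \<bar>f i\<bar> * \<bar>g i\<bar> \<partial>count_space A) \<le>
     (\<integral>i. \<bar>f i\<bar> powr p \<partial>count_space A) powr (1/p) * (\<integral>i. \<bar>g i\<bar> powr q \<partial>count_space A) powr (1/q)"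
    using assms by (intro Holder_integral(2)) (auto intro!: integrable_count_space)
  moreover have "(\<Sum>i\<in>A. \<bar>f i\<bar> * \<bar>g i\<bar>) = (\<Sum>i\<in>A. f i * g i)"
     "(\<Sum>i\<in>A. \<bar>f i\<bar> powr p) = (\<Sum>i\<in>A. f i powr p)" "(\<Sum>i\<in>A. \<bar>g i\<bar> powr q) = (\<Sum>i\<in>A. g i powr q)"
    using assms by (auto intro!: sum.cong)
  ultimately show ?thesis
    using assms by (simp add: lebesgue_integral_count_space_finite)
qed

text \<open>Hoelder's inequality against the constant 1, with the conjugate exponents r and r/(r -
  1).\<close>

lemma power_mean:
  fixes f :: "'i \<Rightarrow> real"
  assumes "finite A" "\<And>i. i \<in> A \<Longrightarrow> f i \<ge> 0" "r \<ge> 1"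
  shows "(\<Sum>i\<in>A. f i) powr r \<le> real (card A) powr (r - 1) * (\<Sum>i\<in>A. f i powr r)"
proof (cases "A = {} \<or> r = 1")
  case True
  then show ?thesis using assms by (cases "A = {}") (auto simp: sum_nonneg intro!: sum_mono)
next
  case False
  then have r: "r > 1" using assms by simp
  have q: "r / (r - 1) > 1" "1 / r + 1 / (r / (r - 1)) = 1" using r by (auto simp: field_simps)
  have "(\<Sum>i\<in>A. f i * 1) \<le> (\<Sum>i\<in>A. f i powr r) powr (1/r) * (\<Sum>i\<in>A. 1 powr (r/(r-1))) powr (1/(r/(r-1)))"
    using assms r q by (intro Holder_sum) auto
  then have "(\<Sum>i\<in>A. f i) powr r \<le>
      ((\<Sum>i\<in>A. f i powr r) powr (1/r) * real (card A) powr (1/(r/(r-1)))) powr r"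
    using assms r by (intro powr_mono2) (auto intro: sum_nonneg)
  also have "\<dots> = (\<Sum>i\<in>A. f i powr r) * real (card A) powr (r - 1)"
    using r by (simp add: powr_mult powr_powr sum_nonneg)
  finally show ?thesis by (simp add: mult.commute)
qed

section \<open>Overlap of dyadic rectangles\<close>

definition dyadic :: "nat \<times> nat \<Rightarrow> real set" where
  "dyadic c = dyadic_interval (fst c) (snd c)"

lemma dyadic_measurable [measurable]: "dyadic c \<in> sets borel"
  by (simp add: dyadic_def dyadic_interval_def)

lemma dyadic_unique: "y \<in> dyadic (j, k) \<Longrightarrow> y \<in> dyadic (j, l) \<Longrightarrow> k = l"
proof -
  assume "y \<in> dyadic (j, k)" "y \<in> dyadic (j, l)"
  then have "real k \<le> y * 2 ^ j" "y * 2 ^ j < real k + 1" "real l \<le> y * 2 ^ j" "y * 2 ^ j < real l + 1"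
    by (auto simp: dyadic_def dyadic_interval_def field_simps)
  then have "real k < real (l + 1)" "real l < real (k + 1)" by simp_all
  then have "k < l + 1" "l < k + 1" by (simp_all only: of_nat_less_iff)
  then show ?thesis by simp
qed

text \<open>Allows the dyadic intervals through a fixed point to be counted by their levels.\<close>

lemma inj_on_fst_dyadic: "inj_on fst {c \<in> P. y \<in> dyadic c}"
  by (auto simp: inj_on_def intro: dyadic_unique)

lemma emeasure_dyadic: "emeasure lborel (dyadic c) = ennreal (1 / 2 ^ fst c)"
proof -
  have "real (snd c) / 2 ^ fst c \<le> (real (snd c) + 1) / 2 ^ fst c"
    by (simp add: divide_right_mono)
  then show ?thesis
    by (simp add: dyadic_def dyadic_interval_def add_divide_distrib)
qed

text \<open>
  A dyadic rectangle is coded by \<open>b\<close>, where \<open>b i\<close> consists of the level and the position of its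
  \<open>i\<close>-th side. Then \<open>overlap a d B\<close> is the sum over \<open>I \<in> B\<close> of \<open>|I|\<^sup>-\<^sup>a 1\<^sub>I\<close>.
\<close>

definition overlap :: "real \<Rightarrow> nat \<Rightarrow> (nat \<Rightarrow> nat \<times> nat) set \<Rightarrow> point \<Rightarrow> real" where
  "overlap a d B t = (\<Sum>b\<in>B. \<Prod>i<d. 2 powr (a * real (fst (b i))) * indicator (dyadic (b i)) (t i))"

lemma overlap_nonneg: "overlap a d B t \<ge> 0"
  by (auto simp: overlap_def intro!: sum_nonneg prod_nonneg)

lemma overlap_restrict [simp]: "overlap a d B (restrict t {..<d}) = overlap a d B t"
  by (auto simp: overlap_def intro!: sum.cong prod.cong)

lemma measurable_coordinate [measurable]: "i < d \<Longrightarrow> (\<lambda>t. t i) \<in> borel_measurable (volume d)"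
  unfolding volume_def
  using measurable_component_singleton[of i "{..<d}" "\<lambda>_. lborel :: real measure"] by simp

lemma overlap_measurable [measurable]: "overlap a d B \<in> borel_measurable (volume d)"
  unfolding overlap_def
  by (intro borel_measurable_sum borel_measurable_prod borel_measurable_times borel_measurable_const
      borel_measurable_indicator' measurable_coordinate) auto

text \<open>Tonelli's theorem with the last coordinate split off; \<open>restrict\<close> turns a
  point of dimension n + 1 into one of dimension n.\<close>

lemma nn_integral_volume_Suc:
  assumes [measurable]: "f \<in> borel_measurable (volume n)" "g \<in> borel_measurable lborel"
  shows "(\<integral>\<^sup>+t. f (restrict t {..<n}) * g (t n) \<partial>volume (Suc n)) = (\<integral>\<^sup>+t. f t \<partial>volume n) * (\<integral>\<^sup>+y. g y \<partial>lborel)"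
proof -
  interpret product_sigma_finite "\<lambda>_. lborel :: real measure" by standard
  have r: "(\<lambda>t. restrict t {..<n}) \<in> measurable (volume (Suc n)) (volume n)"
    unfolding volume_def by (intro measurable_restrict_subset) auto
  have "(\<lambda>t. f (restrict t {..<n}) * g (t n)) \<in> borel_measurable (volume (Suc n))"
    using measurable_compose[OF r assms(1)] measurable_compose[OF measurable_coordinate[of n "Suc n"], of g borel]
      assms(2) by (auto intro!: borel_measurable_times_ennreal)
  then have "(\<integral>\<^sup>+t. f (restrict t {..<n}) * g (t n) \<partial>volume (Suc n))
    = (\<integral>\<^sup>+x. (\<integral>\<^sup>+y. f (restrict (x(n := y)) {..<n}) * g ((x(n := y)) n) \<partial>lborel) \<partial>volume n)"
    unfolding volume_def lessThan_Suc by (intro product_nn_integral_insert) auto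
  also have "\<dots> = (\<integral>\<^sup>+x. f x * (\<integral>\<^sup>+y. g y \<partial>lborel) \<partial>volume n)"
  proof (rule nn_integral_cong)
    fix x assume "x \<in> space (volume n)"
    then have "restrict (x(n := y)) {..<n} = x" for y
      by (auto simp: volume_def space_PiM PiE_def extensional_def restrict_def fun_eq_iff)
    then show "(\<integral>\<^sup>+y. f (restrict (x(n := y)) {..<n}) * g ((x(n := y)) n) \<partial>lborel) = f x * (\<integral>\<^sup>+y. g y \<partial>lborel)"
      by (simp add: nn_integral_cmult)
  qed
  also have "\<dots> = (\<integral>\<^sup>+t. f t \<partial>volume n) * (\<integral>\<^sup>+y. g y \<partial>lborel)"
    by (simp add: nn_integral_multc)
  finally show ?thesis .
qed

lemma nn_integral_normalized_dyadic:
  "(\<integral>\<^sup>+y. ennreal (2 powr real (fst c) * indicator (dyadic c) y) \<partial>lborel) = 1"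
proof -
  have "(\<integral>\<^sup>+y. ennreal (2 powr real (fst c) * indicator (dyadic c) y) \<partial>lborel)
      = (\<integral>\<^sup>+y. ennreal (2 powr real (fst c)) * indicator (dyadic c) y \<partial>lborel)"
    by (intro nn_integral_cong) (auto split: split_indicator)
  also have "\<dots> = ennreal (2 powr real (fst c)) * ennreal (1 / 2 ^ fst c)"
    by (simp add: nn_integral_cmult_indicator emeasure_dyadic)
  also have "\<dots> = 1" by (simp add: ennreal_mult[symmetric] powr_realpow)
  finally show ?thesis .
qed

lemma nn_integral_normalized_rect:
  "(\<integral>\<^sup>+t. ennreal (\<Prod>i<d. 2 powr real (fst (b i)) * indicator (dyadic (b i)) (t i)) \<partial>volume d) = 1"
proof -
  interpret product_sigma_finite "\<lambda>_. lborel :: real measure" by standard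
  have "(\<integral>\<^sup>+t. ennreal (\<Prod>i<d. 2 powr real (fst (b i)) * indicator (dyadic (b i)) (t i)) \<partial>volume d)
     = (\<integral>\<^sup>+t. (\<Prod>i<d. ennreal (2 powr real (fst (b i)) * indicator (dyadic (b i)) (t i))) \<partial>volume d)"
    by (intro nn_integral_cong) (simp add: prod_ennreal)
  also have "\<dots> = (\<Prod>i<d. \<integral>\<^sup>+y. ennreal (2 powr real (fst (b i)) * indicator (dyadic (b i)) y) \<partial>lborel)"
    unfolding volume_def by (intro product_nn_integral_prod) auto
  also have "\<dots> = 1" by (simp add: nn_integral_normalized_dyadic)
  finally show ?thesis .
qed

text \<open>The power mean over all of \<open>B\<close>. The factor
  \<open>card B powr (r - 1)\<close> is too large for the final estimate, but the bound is applied
  only to the far rectangles, whose small measure compensates for it.\<close>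

lemma overlap_powr_le:
  assumes "finite B" "r \<ge> 1"
  shows "overlap (1 / r) d B t powr r
    \<le> real (card B) powr (r - 1) * (\<Sum>b\<in>B. \<Prod>i<d. 2 powr real (fst (b i)) * indicator (dyadic (b i)) (t i))"
proof -
  have "(\<Prod>i<d. 2 powr (1 / r * real (fst (b i))) * indicator (dyadic (b i)) (t i)) powr r
      = (\<Prod>i<d. 2 powr real (fst (b i)) * indicator (dyadic (b i)) (t i))" for b
  proof -
    have "(\<Prod>i<d. 2 powr (1 / r * real (fst (b i))) * indicator (dyadic (b i)) (t i)) powr r
      = (\<Prod>i<d. (2 powr (1 / r * real (fst (b i))) * indicator (dyadic (b i)) (t i)) powr r)"
      by (rule prod_powr_distrib)
    also have "\<dots> = (\<Prod>i<d. 2 powr real (fst (b i)) * indicator (dyadic (b i)) (t i))"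
      using assms by (intro prod.cong) (auto simp: powr_powr split: split_indicator)
    finally show ?thesis .
  qed
  then show ?thesis
    using power_mean[OF assms(1), of "\<lambda>b. \<Prod>i<d. 2 powr (1 / r * real (fst (b i))) * indicator (dyadic (b i)) (t i)" r] assms
    by (simp add: overlap_def prod_nonneg)
qed

text \<open>In dimension one the sum is geometric, hence comparable to its largest term.\<close>

lemma overlap_base:
  assumes "finite B" "inj_on (\<lambda>b. restrict b {..<Suc 0}) B" "r \<ge> 1"
  shows "overlap (1 / r) (Suc 0) B t powr r \<le> (1 / (1 - 2 powr (- (1 / r)))) powr r *
    (\<Sum>b\<in>B. \<Prod>i<Suc 0. 2 powr real (fst (b i)) * indicator (dyadic (b i)) (t i))"
proof -
  define a where "a = 1 / r"
  have a: "a > 0" "a * r = 1" using assms by (auto simp: a_def)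
  have ax: "a * (x * r) = x" for x using a(2) by (metis mult.left_commute mult.right_neutral)
  define Q where "Q = {b \<in> B. t 0 \<in> dyadic (b 0)}"
  have Q: "finite Q" "Q \<subseteq> B" using assms by (auto simp: Q_def)
  have ov: "overlap a (Suc 0) B t = (\<Sum>b\<in>Q. 2 powr (a * real (fst (b 0))))"
    unfolding overlap_def Q_def using assms by (intro sum.mono_neutral_cong_right) auto
  have rhs: "(\<Sum>b\<in>B. \<Prod>i<Suc 0. 2 powr real (fst (b i)) * indicator (dyadic (b i)) (t i))
      = (\<Sum>b\<in>Q. 2 powr real (fst (b 0)))"
    unfolding Q_def using assms by (intro sum.mono_neutral_cong_right) auto
  show ?thesis
  proof (cases "Q = {}")
    case False
    have inj: "inj_on (\<lambda>b. fst (b 0)) Q"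
    proof (rule inj_onI)
      fix b b' assume *: "b \<in> Q" "b' \<in> Q" "fst (b 0) = fst (b' 0)"
      then have "b 0 = b' 0"
        using inj_onD[OF inj_on_fst_dyadic[of UNIV "t 0"], of "b 0" "b' 0"] by (auto simp: Q_def)
      then have "restrict b {..<Suc 0} = restrict b' {..<Suc 0}" by (auto simp: restrict_def fun_eq_iff)
      then show "b = b'" using inj_onD[OF assms(2)] * Q by blast
    qed
    define m where "m = Max ((\<lambda>b. fst (b 0)) ` Q)"
    have m: "m \<in> (\<lambda>b. fst (b 0)) ` Q" using Q False by (auto simp: m_def)
    have le: "(\<lambda>b. fst (b 0)) ` Q \<subseteq> {..m}" using Q by (auto simp: m_def)
    \<comment> \<open>Counted down from the finest level \<open>m\<close>, the terms decrease by the
      ratio z < 1, so their sum is at most 1/(1 - z) times the largest one.\<close>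
    define z where "z = 2 powr (- a)"
    have z: "0 < z" "z < 1" using a by (auto simp: z_def powr_less_one)
    have "(\<Sum>b\<in>Q. 2 powr (a * real (fst (b 0)))) = (\<Sum>j\<in>(\<lambda>b. fst (b 0)) ` Q. 2 powr (a * real j))"
      using inj by (simp add: sum.reindex)
    also have "\<dots> \<le> (\<Sum>j\<le>m. 2 powr (a * real j))" using le by (intro sum_mono2) auto
    also have "\<dots> = (\<Sum>j\<le>m. 2 powr (a * real m) * z ^ (m - j))"
    proof (rule sum.cong)
      fix j assume "j \<in> {..m}"
      have "z ^ (m - j) = 2 powr ((- a) * real (m - j))"
        by (simp add: z_def powr_powr flip: powr_realpow)
      then have "2 powr (a * real m) * z ^ (m - j) = 2 powr (a * real m + (- a) * real (m - j))"
        by (simp only: powr_add)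
      also have "a * real m + (- a) * real (m - j) = a * real j"
        using \<open>j \<in> {..m}\<close> by (simp add: of_nat_diff algebra_simps)
      finally show "2 powr (a * real j) = 2 powr (a * real m) * z ^ (m - j)" by simp
    qed simp
    also have "\<dots> = 2 powr (a * real m) * (\<Sum>j\<le>m. z ^ j)"
      by (simp add: sum_distrib_left[symmetric] sum.nat_diff_reindex[of _ "Suc m", unfolded lessThan_Suc_atMost, simplified])
    also have "\<dots> \<le> 2 powr (a * real m) * (1 / (1 - z))"
      using z by (intro mult_left_mono) (auto simp: sum_gp0 divide_right_mono)
    finally have "overlap a (Suc 0) B t powr r \<le> (2 powr (a * real m) * (1 / (1 - z))) powr r"
      using assms by (intro powr_mono2) (auto simp: ov intro: sum_nonneg)
    also have "\<dots> = (1 / (1 - z)) powr r * 2 powr real m"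
    proof -
      have "(2 powr (a * real m)) powr r = 2 powr real m"
        by (simp add: powr_powr mult.assoc ax)
      moreover have "1 / (1 - z) \<ge> 0" using z by simp
      ultimately show ?thesis unfolding powr_mult by (simp only: mult.commute)
    qed
    also have "\<dots> \<le> (1 / (1 - z)) powr r * (\<Sum>b\<in>Q. 2 powr real (fst (b 0)))"
    proof (intro mult_left_mono)
      obtain b where "b \<in> Q" "m = fst (b 0)" using m by auto
      then show "2 powr real m \<le> (\<Sum>b\<in>Q. 2 powr real (fst (b 0)))"
        using member_le_sum[of b Q "\<lambda>b. 2 powr real (fst (b 0))"] Q by auto
    qed auto
    finally show ?thesis unfolding rhs by (simp add: a_def z_def)
  qed (simp only: rhs ov[folded a_def] a_def[symmetric], simp)
qed

text \<open>
  At a point \<open>t\<close>, the rectangles whose last side is more than \<open>L\<close> levels coarser than the finest last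
  side through \<open>t n\<close> are far: they are rarely met, since the finer sides have small total measure. The
  remaining last sides through \<open>t n\<close> are nested and number at most \<open>L + 1\<close>.
\<close>

lemma overlap_step_pointwise:
  fixes B :: "(nat \<Rightarrow> nat \<times> nat) set" and L n :: nat
  assumes B: "finite B" and r: "r \<ge> 1"
  defines "far \<equiv> \<lambda>c. {y \<in> dyadic c. \<exists>b\<in>B. y \<in> dyadic (b n) \<and> fst (b n) > fst c + L}"
  shows "overlap (1 / r) (Suc n) B t powr r \<le> 2 powr (r - 1) *
    (real (Suc L) powr (r - 1) * (\<Sum>c\<in>(\<lambda>b. b n) ` B. overlap (1 / r) n {b \<in> B. b n = c} t powr r *
        (2 powr real (fst c) * indicator (dyadic c) (t n)))
     + real (card B) powr (r - 1) * (\<Sum>b\<in>B. (\<Prod>i<n. 2 powr real (fst (b i)) * indicator (dyadic (b i)) (t i)) *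
        (2 powr real (fst (b n)) * indicator (far (b n)) (t n))))"
proof -
  define a where "a = 1 / r"
  have a: "a > 0" "a * r = 1" using r by (auto simp: a_def)
  have ax: "a * (x * r) = x" for x using a(2) by (metis mult.left_commute mult.right_neutral)
  define P where "P = (\<lambda>b. b n) ` B"
  have P: "finite P" using B by (simp add: P_def)
  \<comment> \<open>\<open>F\<close> collects the rectangles that are far at \<open>t\<close>,
    \<open>Q\<close> the last sides through \<open>t n\<close> that are not far there. Power means
    are used for both, but for the near part the number of terms is \<open>card Q\<close>, which is
    at most L + 1.\<close>
  define F where "F = {b \<in> B. t n \<in> far (b n)}"
  define Q where "Q = {c \<in> P. t n \<in> dyadic c \<and> t n \<notin> far c}"
  have FQ: "finite F" "F \<subseteq> B" "finite Q" "Q \<subseteq> P" using B P by (auto simp: F_def Q_def)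
  define T where "T = (\<lambda>b. \<Prod>i<Suc n. 2 powr (a * real (fst (b i))) * indicator (dyadic (b i)) (t i) :: real)"
  have Tnn: "T b \<ge> 0" for b by (auto simp: T_def intro!: mult_nonneg_nonneg prod_nonneg)
  have near: "sum T (B - F) = (\<Sum>c\<in>Q. 2 powr (a * real (fst c)) * overlap a n {b \<in> B. b n = c} t)"
  proof -
    have "sum T (B - F) = sum T {b \<in> B. b n \<in> Q}"
      using B by (intro sum.mono_neutral_right) (auto simp: T_def F_def Q_def P_def)
    also have "\<dots> = (\<Sum>c\<in>Q. sum T {b \<in> {b \<in> B. b n \<in> Q}. b n = c})"
      using B FQ by (intro sum.group[symmetric]) auto
    also have "\<dots> = (\<Sum>c\<in>Q. 2 powr (a * real (fst c)) * overlap a n {b \<in> B. b n = c} t)"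
    proof (rule sum.cong)
      fix c assume c: "c \<in> Q"
      then have "{b \<in> {b \<in> B. b n \<in> Q}. b n = c} = {b \<in> B. b n = c}" "t n \<in> dyadic c" by (auto simp: Q_def)
      then show "sum T {b \<in> {b \<in> B. b n \<in> Q}. b n = c}
          = 2 powr (a * real (fst c)) * overlap a n {b \<in> B. b n = c} t"
        by (auto simp: T_def overlap_def sum_distrib_left intro!: sum.cong)
    qed simp
    finally show ?thesis .
  qed
  have cardQ: "card Q \<le> Suc L"
  proof (cases "Q = {}")
    case False
    define m where "m = Max (fst ` Q)"
    have "m \<in> fst ` Q" using FQ False by (auto simp: m_def)
    then obtain c where c: "c \<in> Q" "m = fst c" by auto
    have "fst ` Q \<subseteq> {m - L..m}"
    proof
      fix j assume "j \<in> fst ` Q"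
      then obtain c' where c': "c' \<in> Q" "j = fst c'" by auto
      \<comment> \<open>The finest side \<open>c\<close> in \<open>Q\<close> is the last side of a
        rectangle in \<open>B\<close>; were it more than \<open>L\<close> levels finer than
        \<open>c'\<close>, then \<open>t n\<close> would be far for \<open>c'\<close>.\<close>
      have "\<not> fst c > fst c' + L"
        using c(1) c'(1) by (auto simp: Q_def far_def P_def)
      moreover have "j \<le> m" using c' FQ by (auto simp: m_def)
      ultimately show "j \<in> {m - L..m}" using c c' by auto
    qed
    then have "card (fst ` Q) \<le> card {m - L..m}" by (intro card_mono) auto
    moreover have "inj_on fst Q"
      by (rule inj_on_subset[OF inj_on_fst_dyadic[of P "t n"]]) (auto simp: Q_def)
    ultimately show ?thesis by (simp add: card_image)
  qed simp
  have near_le: "sum T (B - F) powr r \<le> real (Suc L) powr (r - 1) *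
      (\<Sum>c\<in>P. overlap a n {b \<in> B. b n = c} t powr r * (2 powr real (fst c) * indicator (dyadic c) (t n)))"
  proof -
    have "sum T (B - F) powr r \<le> real (card Q) powr (r - 1) *
        (\<Sum>c\<in>Q. (2 powr (a * real (fst c)) * overlap a n {b \<in> B. b n = c} t) powr r)"
      unfolding near using FQ r by (intro power_mean) (auto simp: overlap_nonneg)
    also have "(\<Sum>c\<in>Q. (2 powr (a * real (fst c)) * overlap a n {b \<in> B. b n = c} t) powr r)
       = (\<Sum>c\<in>Q. overlap a n {b \<in> B. b n = c} t powr r * (2 powr real (fst c) * indicator (dyadic c) (t n)))"
    proof (rule sum.cong)
      fix c assume "c \<in> Q"
      moreover have "(2 powr (a * real (fst c))) powr r = 2 powr real (fst c)"
        by (simp add: powr_powr mult.assoc ax)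
      ultimately show "(2 powr (a * real (fst c)) * overlap a n {b \<in> B. b n = c} t) powr r
          = overlap a n {b \<in> B. b n = c} t powr r * (2 powr real (fst c) * indicator (dyadic c) (t n))"
        by (simp add: Q_def powr_mult overlap_nonneg)
    qed simp
    also have "\<dots> \<le> (\<Sum>c\<in>P. overlap a n {b \<in> B. b n = c} t powr r * (2 powr real (fst c) * indicator (dyadic c) (t n)))"
      using FQ P by (intro sum_mono2) auto
    also have "real (card Q) powr (r - 1) * \<dots> \<le> real (Suc L) powr (r - 1) * \<dots>"
      using cardQ r by (intro mult_right_mono powr_mono2 sum_nonneg) auto
    finally show ?thesis by (simp add: mult_left_mono)
  qed
  have far_le: "sum T F powr r \<le> real (card B) powr (r - 1) *
      (\<Sum>b\<in>B. (\<Prod>i<n. 2 powr real (fst (b i)) * indicator (dyadic (b i)) (t i)) *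
        (2 powr real (fst (b n)) * indicator (far (b n)) (t n)))"
  proof -
    have "sum T F powr r = overlap (1 / r) (Suc n) F t powr r" by (simp add: overlap_def T_def a_def)
    also have "\<dots> \<le> real (card F) powr (r - 1) *
        (\<Sum>b\<in>F. \<Prod>i<Suc n. 2 powr real (fst (b i)) * indicator (dyadic (b i)) (t i))"
      using FQ r by (intro overlap_powr_le) auto
    also have "(\<Sum>b\<in>F. \<Prod>i<Suc n. 2 powr real (fst (b i)) * indicator (dyadic (b i)) (t i))
      = (\<Sum>b\<in>B. (\<Prod>i<n. 2 powr real (fst (b i)) * indicator (dyadic (b i)) (t i)) *
        (2 powr real (fst (b n)) * indicator (far (b n)) (t n)) :: real)"
      using B by (intro sum.mono_neutral_cong_left) (auto simp: F_def far_def)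
    also have "real (card F) powr (r - 1) * \<dots> \<le> real (card B) powr (r - 1) * \<dots>"
      using FQ B r by (intro mult_right_mono powr_mono2 sum_nonneg mult_nonneg_nonneg prod_nonneg) (auto simp: card_mono)
    finally show ?thesis by simp
  qed
  have "overlap a (Suc n) B t = sum T (B - F) + sum T F"
    using B FQ by (simp add: overlap_def T_def sum.subset_diff)
  also have "\<dots> powr r \<le> 2 powr (r - 1) * (sum T (B - F) powr r + sum T F powr r)"
  proof -
    \<comment> \<open>Convexity at the midpoint yields the factor 2^(r-1).\<close>
    have "((1 - 1/2) * sum T (B - F) + 1/2 * sum T F) powr r \<le> (1 - 1/2) * sum T (B - F) powr r + 1/2 * sum T F powr r"
      using r Tnn by (intro powr_convex_nonneg) (auto intro: sum_nonneg)
    moreover have "(1 - 1/2) * sum T (B - F) + 1/2 * sum T F = (sum T (B - F) + sum T F) / 2" by simp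
    ultimately have "((sum T (B - F) + sum T F) / 2) powr r \<le> (sum T (B - F) powr r + sum T F powr r) / 2"
      by (simp only: add_divide_distrib) simp
    then show ?thesis using Tnn by (simp add: powr_divide sum_nonneg powr_diff field_simps)
  qed
  also have "\<dots> \<le> 2 powr (r - 1) *
    (real (Suc L) powr (r - 1) * (\<Sum>c\<in>P. overlap a n {b \<in> B. b n = c} t powr r *
        (2 powr real (fst c) * indicator (dyadic c) (t n)))
     + real (card B) powr (r - 1) * (\<Sum>b\<in>B. (\<Prod>i<n. 2 powr real (fst (b i)) * indicator (dyadic (b i)) (t i)) *
        (2 powr real (fst (b n)) * indicator (far (b n)) (t n))))"
    using near_le far_le by (intro mult_left_mono add_mono) auto
  finally show ?thesis by (simp add: a_def P_def)
qed

lemma far_measurable: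
  assumes "finite B"
  shows "{y \<in> dyadic c. \<exists>b\<in>B. y \<in> dyadic (b n) \<and> fst (b n) > fst c + L} \<in> sets borel"
proof -
  have "{y \<in> dyadic c. \<exists>b\<in>B. y \<in> dyadic (b n) \<and> fst (b n) > fst c + L}
      = dyadic c \<inter> (\<Union>b\<in>{b \<in> B. fst (b n) > fst c + L}. dyadic (b n))" by auto
  also have "\<dots> \<in> sets borel" using assms by auto
  finally show ?thesis .
qed

text \<open>Union bound: the set is covered by at most \<open>card B\<close> intervals of length at
  most 2^-(fst c + L), so its measure is at most e times the length of
  \<open>dyadic c\<close>.\<close>

lemma nn_integral_far:
  assumes B: "finite B" "real (card B) \<le> 2 ^ L * e"
  shows "(\<integral>\<^sup>+y. ennreal (2 powr real (fst c) * indicator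
      {y \<in> dyadic c. \<exists>b\<in>B. y \<in> dyadic (b n) \<and> fst (b n) > fst c + L} y) \<partial>lborel) \<le> ennreal e"
proof -
  define D where "D = {y \<in> dyadic c. \<exists>b\<in>B. y \<in> dyadic (b n) \<and> fst (b n) > fst c + L}"
  define B' where "B' = {b \<in> B. fst (b n) > fst c + L}"
  have B': "finite B'" "B' \<subseteq> B" using B by (auto simp: B'_def)
  have Dm: "D \<in> sets borel" unfolding D_def by (rule far_measurable[OF B(1)])
  have "emeasure lborel D \<le> emeasure lborel (\<Union>b\<in>B'. dyadic (b n))"
    using B' by (intro emeasure_mono) (auto simp: D_def B'_def)
  also have "\<dots> \<le> (\<Sum>b\<in>B'. emeasure lborel (dyadic (b n)))"
    using B' by (intro emeasure_subadditive_finite) auto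
  also have "\<dots> \<le> (\<Sum>b\<in>B'. ennreal (1 / 2 ^ (fst c + L)))"
    unfolding emeasure_dyadic
    by (intro sum_mono ennreal_leI divide_left_mono power_increasing) (auto simp: B'_def)
  also have "\<dots> = ennreal (real (card B') * (1 / 2 ^ (fst c + L)))"
    by (simp only: sum_constant ennreal_of_nat_eq_real_of_nat ennreal_mult[symmetric] of_nat_0_le_iff
        zero_le_divide_1_iff zero_le_power zero_le_numeral)
  also have "\<dots> \<le> ennreal (e / 2 ^ fst c)"
  proof (rule ennreal_leI)
    have "real (card B') \<le> 2 ^ L * e"
      using B B' card_mono[of B B'] by simp
    then show "real (card B') * (1 / 2 ^ (fst c + L)) \<le> e / 2 ^ fst c"
      by (simp add: power_add field_simps)
  qed
  finally have D: "emeasure lborel D \<le> ennreal (e / 2 ^ fst c)" .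
  have "(\<integral>\<^sup>+y. ennreal (2 powr real (fst c) * indicator D y) \<partial>lborel)
      = (\<integral>\<^sup>+y. ennreal (2 powr real (fst c)) * indicator D y \<partial>lborel)"
    by (intro nn_integral_cong) (auto split: split_indicator)
  also have "\<dots> = ennreal (2 powr real (fst c)) * emeasure lborel D"
    using Dm by (simp add: nn_integral_cmult_indicator)
  also have "\<dots> \<le> ennreal (2 powr real (fst c)) * ennreal (e / 2 ^ fst c)"
    using D by (rule mult_left_mono) simp
  also have "\<dots> = ennreal e"
    by (simp add: ennreal_mult'[symmetric] powr_realpow)
  finally show ?thesis by (simp add: D_def)
qed

text \<open>The rectangles are grouped by their last side. For the near part the hypothesis in n
  dimensions applies to every group, and the normalised last side integrates to 1; this costs (L +
  1)^(r-1). For the far part the power mean costs (card B)^(r-1), and the far sets win back (card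
  B)^(1-r).\<close>

lemma overlap_step:
  fixes B :: "(nat \<Rightarrow> nat \<times> nat) set" and L :: nat
  assumes B: "finite B" and r: "r \<ge> 1" and K: "K \<ge> 0" and L: "real (card B) powr r \<le> 2 ^ L"
    and IH: "\<And>B'. B' \<subseteq> B \<Longrightarrow> (\<And>b b'. b \<in> B' \<Longrightarrow> b' \<in> B' \<Longrightarrow> b n = b' n) \<Longrightarrow>
      (\<integral>\<^sup>+t. ennreal (overlap (1 / r) n B' t powr r) \<partial>volume n) \<le> ennreal (K * real (card B'))"
  shows "(\<integral>\<^sup>+t. ennreal (overlap (1 / r) (Suc n) B t powr r) \<partial>volume (Suc n))
     \<le> ennreal (2 powr (r - 1) * (real (Suc L) powr (r - 1) * K + 1) * real (card B))"
proof -
  define far where "far = (\<lambda>c. {y \<in> dyadic c. \<exists>b\<in>B. y \<in> dyadic (b n) \<and> fst (b n) > fst c + L})"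
  have far_m: "far c \<in> sets borel" for c unfolding far_def by (rule far_measurable[OF B(1)])
  define P where "P = (\<lambda>b. b n) ` B"
  have P: "finite P" using B by (simp add: P_def)
  define U where "U = (\<lambda>c t. overlap (1 / r) n {b \<in> B. b n = c} t powr r * (2 powr real (fst c) * indicator (dyadic c) (t n)))"
  define V where "V = (\<lambda>b t. (\<Prod>i<n. 2 powr real (fst (b i)) * indicator (dyadic (b i)) (t i)) *
        (2 powr real (fst (b n)) * indicator (far (b n)) (t n)) :: real)"
  define \<nu> where "\<nu> = real (card B)"
  have intU: "(\<integral>\<^sup>+t. ennreal (U c t) \<partial>volume (Suc n)) \<le> ennreal (K * real (card {b \<in> B. b n = c}))" for c
  proof -
    have "(\<integral>\<^sup>+t. ennreal (U c t) \<partial>volume (Suc n)) =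
       (\<integral>\<^sup>+t. ennreal (overlap (1 / r) n {b \<in> B. b n = c} (restrict t {..<n}) powr r) *
             ennreal (2 powr real (fst c) * indicator (dyadic c) (t n)) \<partial>volume (Suc n))"
      by (simp add: U_def ennreal_mult)
    also have "\<dots> = (\<integral>\<^sup>+t. ennreal (overlap (1 / r) n {b \<in> B. b n = c} t powr r) \<partial>volume n)"
      by (subst nn_integral_volume_Suc) (auto simp: nn_integral_normalized_dyadic)
    also have "\<dots> \<le> ennreal (K * real (card {b \<in> B. b n = c}))"
      by (rule IH) auto
    finally show ?thesis .
  qed
  have intV: "(\<integral>\<^sup>+t. ennreal (V b t) \<partial>volume (Suc n)) \<le> ennreal (\<nu> powr (1 - r))" for b
  proof -
    let ?f = "\<lambda>t. (\<Prod>i<n. 2 powr real (fst (b i)) * indicator (dyadic (b i)) (t i)) :: real"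
    have m: "?f \<in> borel_measurable (volume n)"
      by (intro borel_measurable_prod borel_measurable_times borel_measurable_const
          borel_measurable_indicator' measurable_coordinate) auto
    have "(\<integral>\<^sup>+t. ennreal (V b t) \<partial>volume (Suc n)) =
       (\<integral>\<^sup>+t. ennreal (?f (restrict t {..<n})) * ennreal (2 powr real (fst (b n)) * indicator (far (b n)) (t n)) \<partial>volume (Suc n))"
      by (simp add: V_def ennreal_mult prod_nonneg)
    also have "\<dots> = (\<integral>\<^sup>+y. ennreal (2 powr real (fst (b n)) * indicator (far (b n)) y) \<partial>lborel)"
      using m far_m by (subst nn_integral_volume_Suc) (auto simp: nn_integral_normalized_rect)
    also have "\<dots> \<le> ennreal (\<nu> powr (1 - r))"
      unfolding far_def
    proof (rule nn_integral_far[OF B])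
      \<comment> \<open>This is the point of requiring (card B)^r \<le> 2^L: the far sets then have
        relative measure at most \<open>\<nu> powr (1 - r)\<close>.\<close>
      show "real (card B) \<le> 2 ^ L * \<nu> powr (1 - r)"
      proof (cases "card B = 0")
        case False
        then have "\<nu> = \<nu> powr r * \<nu> powr (1 - r)" by (simp add: \<nu>_def powr_diff)
        also have "\<dots> \<le> 2 ^ L * \<nu> powr (1 - r)"
          using L by (intro mult_right_mono) (auto simp: \<nu>_def)
        finally show ?thesis by (simp add: \<nu>_def)
      qed simp
    qed
    finally show ?thesis .
  qed
  have Um: "U c \<in> borel_measurable (volume (Suc n))" for c
  proof -
    have "(\<lambda>t. overlap (1 / r) n {b \<in> B. b n = c} t) \<in> borel_measurable (volume (Suc n))"
      unfolding overlap_def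
      by (intro borel_measurable_sum borel_measurable_prod borel_measurable_times borel_measurable_const
          borel_measurable_indicator' measurable_coordinate) auto
    then show ?thesis
      unfolding U_def
      by (intro borel_measurable_times powr_real_measurable borel_measurable_const
          borel_measurable_indicator' measurable_coordinate) auto
  qed
  have Vm: "V b \<in> borel_measurable (volume (Suc n))" for b
    unfolding V_def using far_m
    by (intro borel_measurable_prod borel_measurable_times borel_measurable_const
          borel_measurable_indicator' measurable_coordinate) auto
  have Unn: "U c t \<ge> 0" and Vnn: "V b t \<ge> 0" for b c t
    by (auto simp: U_def V_def intro!: mult_nonneg_nonneg prod_nonneg)
  have "(\<integral>\<^sup>+t. ennreal (overlap (1 / r) (Suc n) B t powr r) \<partial>volume (Suc n))
     \<le> (\<integral>\<^sup>+t. ennreal (2 powr (r - 1) * (real (Suc L) powr (r - 1) * (\<Sum>c\<in>P. U c t)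
           + \<nu> powr (r - 1) * (\<Sum>b\<in>B. V b t))) \<partial>volume (Suc n))"
    unfolding U_def V_def P_def far_def \<nu>_def
    by (intro nn_integral_mono ennreal_leI overlap_step_pointwise B r)
  also have "\<dots> = (\<integral>\<^sup>+t. ennreal (2 powr (r - 1)) * (ennreal (real (Suc L) powr (r - 1)) * (\<Sum>c\<in>P. ennreal (U c t))
           + ennreal (\<nu> powr (r - 1)) * (\<Sum>b\<in>B. ennreal (V b t))) \<partial>volume (Suc n))"
    by (intro nn_integral_cong)
       (simp add: ennreal_mult Unn Vnn sum_nonneg del: of_nat_Suc)
  also have "\<dots> = ennreal (2 powr (r - 1)) *
      (ennreal (real (Suc L) powr (r - 1)) * (\<Sum>c\<in>P. \<integral>\<^sup>+t. ennreal (U c t) \<partial>volume (Suc n))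
           + ennreal (\<nu> powr (r - 1)) * (\<Sum>b\<in>B. \<integral>\<^sup>+t. ennreal (V b t) \<partial>volume (Suc n)))"
    using Um Vm by (simp add: nn_integral_cmult nn_integral_add nn_integral_sum del: of_nat_Suc)
  also have "\<dots> \<le> ennreal (2 powr (r - 1)) *
      (ennreal (real (Suc L) powr (r - 1)) * (\<Sum>c\<in>P. ennreal (K * real (card {b \<in> B. b n = c})))
           + ennreal (\<nu> powr (r - 1)) * (\<Sum>b\<in>B. ennreal (\<nu> powr (1 - r))))"
    using intU intV by (intro mult_left_mono add_mono sum_mono) auto
  also have "(\<Sum>c\<in>P. ennreal (K * real (card {b \<in> B. b n = c}))) = ennreal (K * \<nu>)"
  proof -
    have "card B = (\<Sum>c\<in>P. card {b \<in> B. b n = c})"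
      using sum.group[OF B P, of "\<lambda>b. b n" "\<lambda>_. 1::nat"] by (auto simp: P_def)
    then show ?thesis using K by (simp add: \<nu>_def sum_distrib_left)
  qed
  also have "ennreal (\<nu> powr (r - 1)) * (\<Sum>b\<in>B. ennreal (\<nu> powr (1 - r))) = ennreal \<nu>"
  proof (cases "card B = 0")
    case False
    have "(\<Sum>b\<in>B. ennreal (\<nu> powr (1 - r))) = ennreal (\<nu> * \<nu> powr (1 - r))"
      by (simp add: \<nu>_def ennreal_of_nat_eq_real_of_nat ennreal_mult)
    moreover have "\<nu> powr (r - 1) * (\<nu> * \<nu> powr (1 - r)) = \<nu>"
      using False by (simp add: \<nu>_def powr_diff)
    ultimately show ?thesis by (simp add: ennreal_mult[symmetric] \<nu>_def)
  qed (use B in \<open>auto simp: \<nu>_def\<close>)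
  also have "ennreal (2 powr (r - 1)) * (ennreal (real (Suc L) powr (r - 1)) * ennreal (K * \<nu>) + ennreal \<nu>)
     = ennreal (2 powr (r - 1) * (real (Suc L) powr (r - 1) * K + 1) * real (card B))"
    using K by (simp add: \<nu>_def ennreal_mult[symmetric] ennreal_plus[symmetric] algebra_simps del: of_nat_Suc ennreal_plus)
  finally show ?thesis .
qed

text \<open>Each further dimension costs a factor (L + 1)^(r-1) with L about r log_2 N, hence the
  power n(r-1) of the logarithm. The logarithm contains N instead of the cardinality, so that all
  groups of one family share the same constant and their cardinalities add up. Injectivity says that
  distinct codes already differ in the relevant coordinates.\<close>

lemma overlap_bound:
  assumes r: "r \<ge> 1"
  shows "\<exists>C\<ge>0. \<forall>N\<ge>1. \<forall>B. finite B \<longrightarrow> card B \<le> N \<longrightarrow> inj_on (\<lambda>b. restrict b {..<Suc n}) B \<longrightarrow>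
    (\<integral>\<^sup>+t. ennreal (overlap (1 / r) (Suc n) B t powr r) \<partial>volume (Suc n))
      \<le> ennreal (C * (1 + ln (real N)) powr (real n * (r - 1)) * real (card B))"
proof (induction n)
  case 0
  define G where "G = (1 / (1 - 2 powr (- (1 / r)))) powr r"
  show ?case
  proof (rule exI[of _ G], intro conjI allI impI)
    fix N :: nat and B :: "(nat \<Rightarrow> nat \<times> nat) set"
    assume N: "N \<ge> 1" and B: "finite B" "inj_on (\<lambda>b. restrict b {..<Suc 0}) B"
    let ?T = "\<lambda>b t. (\<Prod>i<Suc 0. 2 powr real (fst (b i)) * indicator (dyadic (b i)) (t i)) :: real"
    have m: "?T b \<in> borel_measurable (volume (Suc 0))" for b
      by (intro borel_measurable_prod borel_measurable_times borel_measurable_const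
          borel_measurable_indicator' measurable_coordinate) auto
    have nn: "?T b t \<ge> 0" for b t by (intro prod_nonneg) auto
    have "(\<integral>\<^sup>+t. ennreal (overlap (1 / r) (Suc 0) B t powr r) \<partial>volume (Suc 0))
      \<le> (\<integral>\<^sup>+t. ennreal (G * (\<Sum>b\<in>B. ?T b t)) \<partial>volume (Suc 0))"
      unfolding G_def by (intro nn_integral_mono ennreal_leI overlap_base B r)
    also have "\<dots> = (\<integral>\<^sup>+t. ennreal G * (\<Sum>b\<in>B. ennreal (?T b t)) \<partial>volume (Suc 0))"
      using nn by (intro nn_integral_cong) (simp only: ennreal_mult G_def powr_ge_zero sum_nonneg sum_ennreal)
    also have "\<dots> = ennreal G * (\<Sum>b\<in>B. \<integral>\<^sup>+t. ennreal (?T b t) \<partial>volume (Suc 0))"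
      using m by (simp only: nn_integral_cmult nn_integral_sum borel_measurable_sum measurable_ennreal
          measurable_compose[OF _ measurable_ennreal])
    also have "\<dots> = ennreal G * ennreal (real (card B))"
      by (simp only: nn_integral_normalized_rect) (simp add: ennreal_of_nat_eq_real_of_nat)
    also have "\<dots> = ennreal (G * (1 + ln (real N)) powr (real 0 * (r - 1)) * real (card B))"
      using N by (simp add: ennreal_mult'' add_nonneg_eq_0_iff)
    finally show "(\<integral>\<^sup>+t. ennreal (overlap (1 / r) (Suc 0) B t powr r) \<partial>volume (Suc 0))
      \<le> ennreal (G * (1 + ln (real N)) powr (real 0 * (r - 1)) * real (card B))" .
  qed (simp add: G_def)
next
  case (Suc n)
  then obtain C where C: "C \<ge> 0" and IH: "\<And>N B. N \<ge> 1 \<Longrightarrow> finite B \<Longrightarrow> card B \<le> N \<Longrightarrow>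
      inj_on (\<lambda>b. restrict b {..<Suc n}) B \<Longrightarrow>
    (\<integral>\<^sup>+t. ennreal (overlap (1 / r) (Suc n) B t powr r) \<partial>volume (Suc n))
      \<le> ennreal (C * (1 + ln (real N)) powr (real n * (r - 1)) * real (card B))"
    by blast
  \<comment> \<open>Chosen so that L + 1 \<le> \<kappa> (1 + ln N) for the \<open>L\<close>
    below.\<close>
  define \<kappa> where "\<kappa> = r / ln 2 + 2"
  have \<kappa>: "\<kappa> \<ge> 2" using r by (auto simp: \<kappa>_def)
  define C' where "C' = 2 powr (r - 1) * (\<kappa> powr (r - 1) * C + 1)"
  show ?case
  proof (rule exI[of _ C'], intro conjI allI impI)
    show "C' \<ge> 0" using C by (simp add: C'_def)
    fix N :: nat and B :: "(nat \<Rightarrow> nat \<times> nat) set"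
    assume N: "N \<ge> 1" and B: "finite B" "card B \<le> N" "inj_on (\<lambda>b. restrict b {..<Suc (Suc n)}) B"
    define l where "l = 1 + ln (real N)"
    have l: "l \<ge> 1" using N by (simp add: l_def)
    \<comment> \<open>The least \<open>L\<close> with N^r \<le> 2^L.\<close>
    define L where "L = nat \<lceil>r * log 2 (real N)\<rceil>"
    have Lge: "r * log 2 (real N) \<le> real L" and Lle: "real L \<le> r * log 2 (real N) + 1"
      using N r by (auto simp: L_def)
    have 1: "real (card B) powr r \<le> 2 ^ L"
    proof -
      have "real (card B) powr r \<le> real N powr r" using B r by (intro powr_mono2) auto
      also have "\<dots> = 2 powr (r * log 2 (real N))"
        using N by (simp add: powr_powr[symmetric] mult.commute[of r])
      also have "\<dots> \<le> 2 powr real L" using Lge by (intro powr_mono) auto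
      finally show ?thesis by (simp add: powr_realpow)
    qed
    have "real (Suc L) \<le> r / ln 2 * ln (real N) + 2"
      using Lle by (simp add: log_def)
    also have "\<dots> \<le> \<kappa> * l"
    proof -
      have "\<kappa> * l = r / ln 2 * ln (real N) + 2 + (r / ln 2 + 2 * ln (real N))"
        by (simp add: \<kappa>_def l_def ring_distribs)
      moreover have "0 \<le> r / ln 2 + 2 * ln (real N)" using N r by simp
      ultimately show ?thesis by linarith
    qed
    finally have SL: "real (Suc L) \<le> \<kappa> * l" .
    have "(\<integral>\<^sup>+t. ennreal (overlap (1 / r) (Suc (Suc n)) B t powr r) \<partial>volume (Suc (Suc n)))
     \<le> ennreal (2 powr (r - 1) * (real (Suc L) powr (r - 1) * (C * l powr (real n * (r - 1))) + 1) * real (card B))"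
    proof (rule overlap_step[OF B(1) r _ 1])
      show "0 \<le> C * l powr (real n * (r - 1))" using C by simp
      fix B' assume B': "B' \<subseteq> B" "\<And>b b'. b \<in> B' \<Longrightarrow> b' \<in> B' \<Longrightarrow> b (Suc n) = b' (Suc n)"
      \<comment> \<open>The last side is constant on \<open>B'\<close>, so the remaining sides still
        tell its members apart.\<close>
      have inj: "inj_on (\<lambda>b. restrict b {..<Suc n}) B'"
      proof (rule inj_onI)
        fix b b' assume *: "b \<in> B'" "b' \<in> B'" "restrict b {..<Suc n} = restrict b' {..<Suc n}"
        have "b i = b' i" if "i < Suc (Suc n)" for i
          using fun_cong[OF *(3), of i] B'(2)[OF *(1,2)] that by (cases "i = Suc n") (auto split: if_splits)
        then have "restrict b {..<Suc (Suc n)} = restrict b' {..<Suc (Suc n)}"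
          by (auto simp: restrict_def fun_eq_iff)
        then show "b = b'" using inj_onD[OF B(3)] B'(1) * by blast
      qed
      have "card B' \<le> N" using card_mono[OF B(1) B'(1)] B(2) by simp
      then show "(\<integral>\<^sup>+t. ennreal (overlap (1 / r) (Suc n) B' t powr r) \<partial>volume (Suc n))
          \<le> ennreal (C * l powr (real n * (r - 1)) * real (card B'))"
        using IH[OF N _ _ inj] finite_subset[OF B'(1) B(1)] by (simp add: l_def)
    qed
    also have "\<dots> \<le> ennreal (C' * l powr (real (Suc n) * (r - 1)) * real (card B))"
    proof (intro ennreal_leI mult_right_mono)
      have "real (Suc L) powr (r - 1) \<le> (\<kappa> * l) powr (r - 1)"
        using SL r by (intro powr_mono2) auto
      then have "real (Suc L) powr (r - 1) * (C * l powr (real n * (r - 1)))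
          \<le> (\<kappa> * l) powr (r - 1) * (C * l powr (real n * (r - 1)))"
        using C by (intro mult_right_mono) auto
      also have "\<dots> = \<kappa> powr (r - 1) * C * (l powr (r - 1) * l powr (real n * (r - 1)))"
        using \<kappa> l by (simp add: powr_mult)
      also have "l powr (r - 1) * l powr (real n * (r - 1)) = l powr (real (Suc n) * (r - 1))"
        by (simp add: powr_add[symmetric] algebra_simps)
      finally have "real (Suc L) powr (r - 1) * (C * l powr (real n * (r - 1))) + 1
         \<le> \<kappa> powr (r - 1) * C * l powr (real (Suc n) * (r - 1)) + l powr (real (Suc n) * (r - 1))"
        using l r by (intro add_mono ge_one_powr_ge_zero) auto
      also have "\<dots> = (\<kappa> powr (r - 1) * C + 1) * l powr (real (Suc n) * (r - 1))" by (simp add: algebra_simps)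
      finally show "2 powr (r - 1) * (real (Suc L) powr (r - 1) * (C * l powr (real n * (r - 1))) + 1)
         \<le> C' * l powr (real (Suc n) * (r - 1))"
        unfolding C'_def mult.assoc by (intro mult_left_mono) auto
    qed auto
    finally show "(\<integral>\<^sup>+t. ennreal (overlap (1 / r) (Suc (Suc n)) B t powr r) \<partial>volume (Suc (Suc n)))
      \<le> ennreal (C' * (1 + ln (real N)) powr (real (Suc n) * (r - 1)) * real (card B))"
      by (simp add: l_def)
  qed
qed

section \<open>Weighted mixed-norm sequence spaces\<close>

lemma ennreal_pow_measurable [measurable]: "(\<lambda>a. ennreal_pow a r) \<in> borel_measurable borel"
  unfolding ennreal_pow_def by measurable

lemma ennreal_pow_mono: "a \<le> b \<Longrightarrow> r \<ge> 0 \<Longrightarrow> ennreal_pow a r \<le> ennreal_pow b r"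
  by (auto simp: ennreal_pow_def top_unique less_top intro!: ennreal_leI powr_mono2 enn2real_mono)

lemma ennreal_pow_mult:
  assumes "c > 0"
  shows "ennreal_pow (ennreal c * a) r = ennreal (c powr r) * ennreal_pow a r"
proof (cases "a = top")
  case True
  then show ?thesis using assms by (simp add: ennreal_pow_def ennreal_mult_top)
next
  case False
  then have "ennreal c * a \<noteq> top" by (simp add: ennreal_mult_eq_top_iff)
  then show ?thesis using False assms
    by (simp add: ennreal_pow_def enn2real_mult powr_mult ennreal_mult)
qed

section \<open>Deleting coordinates, and spans of basis vectors\<close>

definition zero_on :: "'i set \<Rightarrow> ('i \<Rightarrow> 'k::zero) \<Rightarrow> 'i \<Rightarrow> 'k" where
  "zero_on A x = (\<lambda>I. if I \<in> A then 0 else x I)"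

lemma zero_on_simps [simp]: "I \<in> A \<Longrightarrow> zero_on A x I = 0" "I \<notin> A \<Longrightarrow> zero_on A x I = x I"
  by (auto simp: zero_on_def)

lemma zero_on_empty [simp]: "zero_on {} x = x"
  by (simp add: zero_on_def)

lemma sum_fun_apply: "(\<Sum>a\<in>A. f a) I = (\<Sum>a\<in>A. f a I)"
  by (induction A rule: infinite_finite_induct) auto

lemma seq_span_unit_seq:
  fixes A :: "'i set"
  assumes "finite A"
  shows "seq_span (unit_seq ` A) = {y :: 'i \<Rightarrow> 'k::real_normed_field. \<forall>I. I \<notin> A \<longrightarrow> y I = 0}"
proof -
  interpret V: vector_space "seq_scale :: 'k \<Rightarrow> ('i \<Rightarrow> 'k) \<Rightarrow> ('i \<Rightarrow> 'k)"
    by (rule vector_space_seq_scale)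
  show ?thesis
  proof (intro set_eqI iffI)
    fix y :: "'i \<Rightarrow> 'k" assume "y \<in> seq_span (unit_seq ` A)"
    moreover have "V.span (unit_seq ` A) \<subseteq> {y. \<forall>I. I \<notin> A \<longrightarrow> y I = 0}"
      by (rule V.span_minimal) (auto simp: unit_seq_def V.subspace_def seq_scale_def)
    ultimately show "y \<in> {y. \<forall>I. I \<notin> A \<longrightarrow> y I = 0}" by auto
  next
    fix y :: "'i \<Rightarrow> 'k" assume y: "y \<in> {y. \<forall>I. I \<notin> A \<longrightarrow> y I = 0}"
    have "y = (\<Sum>I\<in>A. seq_scale (y I) (unit_seq I))"
    proof
      fix J
      have "(\<Sum>I\<in>A. seq_scale (y I) (unit_seq I) J) = (\<Sum>I\<in>A. if J = I then y I else 0)"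
        by (intro sum.cong) (auto simp: seq_scale_def unit_seq_def)
      then show "y J = (\<Sum>I\<in>A. seq_scale (y I) (unit_seq I)) J"
        using y assms by (auto simp: sum_fun_apply)
    qed
    also have "\<dots> \<in> V.span (unit_seq ` A)"
      by (intro V.span_sum V.span_scale V.span_base) auto
    finally show "y \<in> seq_span (unit_seq ` A)" .
  qed
qed

lemma inj_unit_seq: "inj (unit_seq :: 'i \<Rightarrow> 'i \<Rightarrow> 'k::real_normed_field)"
proof (rule injI)
  fix I J :: 'i assume "(unit_seq I :: 'i \<Rightarrow> 'k) = unit_seq J"
  then have "(unit_seq I :: 'i \<Rightarrow> 'k) I = unit_seq J I" by simp
  then show "I = J" by (auto simp: unit_seq_def split: if_splits)
qed

text \<open>
  The functions \<open>w I\<close> are the \<open>q\<close>-th powers of the functions normalised in \<open>L\<^sup>p\<close>, so that \<open>S x\<close>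
  is the \<open>q\<close>-th power of the square function.
\<close>

locale mixed_norm_space =
  fixes M :: "'a measure" and R :: "'i set" and w :: "'i \<Rightarrow> 'a \<Rightarrow> real" and p q :: real
  assumes p: "1 < p" and q: "1 < q"
    and countable_R: "countable R"
    and w_measurable [measurable]: "I \<in> R \<Longrightarrow> w I \<in> borel_measurable M"
    and w_nonneg: "w I t \<ge> 0"
    and w_normalized: "I \<in> R \<Longrightarrow> (\<integral>\<^sup>+t. ennreal (w I t powr (p / q)) \<partial>M) = 1"
begin

definition v :: "('i \<Rightarrow> 'k::real_normed_field) \<Rightarrow> 'i \<Rightarrow> 'a \<Rightarrow> real" where
  "v x I t = norm (x I) powr q * w I t"

definition S :: "('i \<Rightarrow> 'k::real_normed_field) \<Rightarrow> 'a \<Rightarrow> ennreal" where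
  "S x t = (\<Sum>\<^sub>\<infinity>I\<in>R. ennreal (v x I t))"

definition Z :: "('i \<Rightarrow> 'k::real_normed_field) \<Rightarrow> 'a \<Rightarrow> real" where
  "Z x t = enn2real (S x t)"

definition energy :: "('i \<Rightarrow> 'k::real_normed_field) \<Rightarrow> ennreal" where
  "energy x = (\<integral>\<^sup>+t. ennreal_pow (S x t) (p / q) \<partial>M)"

definition X :: "('i \<Rightarrow> 'k::real_normed_field) set" where
  "X = {x. (\<forall>I. I \<notin> R \<longrightarrow> x I = 0) \<and> energy x < top}"

definition nrm :: "('i \<Rightarrow> 'k::real_normed_field) \<Rightarrow> real" where
  "nrm x = enn2real (energy x) powr (1 / p)"

lemma r_pos: "p / q > 0"
  using p q by simp

lemma v_nonneg: "v x I t \<ge> 0"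
  using w_nonneg by (simp add: v_def)

lemma v_measurable [measurable]: "I \<in> R \<Longrightarrow> v x I \<in> borel_measurable M"
  unfolding v_def by measurable

lemma Z_nonneg: "Z x t \<ge> 0"
  by (simp add: Z_def)

lemma nrm_nonneg: "nrm x \<ge> 0"
  by (simp add: nrm_def)

text \<open>A sum of nonnegative extended reals is the supremum of its finite partial sums, and a
  countable index set has only countably many finite subsets.\<close>

lemma S_measurable [measurable]: "S x \<in> borel_measurable M"
proof -
  have "S x = (\<lambda>t. SUP F\<in>{F. finite F \<and> F \<subseteq> R}. \<Sum>I\<in>F. ennreal (v x I t))"
    by (rule ext) (auto simp: S_def nonneg_infsum_complete)
  moreover have "countable {F. finite F \<and> F \<subseteq> R}"
    using countable_Collect_finite_subset[OF countable_R] by (simp add: conj_commute)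
  ultimately show ?thesis
    by (auto intro!: borel_measurable_SUP borel_measurable_sum)
qed

lemma Z_measurable [measurable]: "Z x \<in> borel_measurable M"
  unfolding Z_def by measurable

section \<open>Monotonicity and splitting of the square function\<close>

lemma S_mono:
  assumes "\<And>I. I \<in> R \<Longrightarrow> norm (x I) \<le> norm (y I)"
  shows "S x t \<le> S y t"
  unfolding S_def using assms q w_nonneg
  by (intro infsum_mono nonneg_summable_on_complete)
     (auto simp: v_def intro!: ennreal_leI mult_right_mono powr_mono2)

lemma S_zero_on_finite: "S x t < top \<Longrightarrow> S (zero_on A x) t < top"
  by (rule le_less_trans[OF S_mono]) (auto simp: zero_on_def)

lemma energy_mono:
  assumes "\<And>I. I \<in> R \<Longrightarrow> norm (x I) \<le> norm (y I)"
  shows "energy x \<le> energy y"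
  unfolding energy_def using r_pos by (intro nn_integral_mono ennreal_pow_mono S_mono assms) auto

lemma X_dominated:
  assumes "x \<in> X" "\<And>I. norm (y I) \<le> norm (x I)"
  shows "y \<in> X"
proof -
  have "y I = 0" if "I \<notin> R" for I
    using assms(1) assms(2)[of I] that by (simp add: X_def)
  then show ?thesis using assms energy_mono[of y x] by (auto simp: X_def)
qed

lemma nrm_dominated:
  assumes "x \<in> X" "\<And>I. norm (y I) \<le> norm (x I)"
  shows "nrm y \<le> nrm x"
  unfolding nrm_def
proof (rule powr_mono2)
  show "enn2real (energy y) \<le> enn2real (energy x)"
    using assms energy_mono[of y x] by (intro enn2real_mono) (auto simp: X_def)
qed (use p in auto)

lemma zero_on_X: "x \<in> X \<Longrightarrow> zero_on A x \<in> X"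
  by (rule X_dominated) (auto simp: zero_on_def)

lemma S_split:
  assumes "finite A" "A \<subseteq> R"
  shows "S x t = (\<Sum>I\<in>A. ennreal (v x I t)) + S (zero_on A x) t"
proof -
  have "S x t = (\<Sum>\<^sub>\<infinity>I\<in>A \<union> (R - A). ennreal (v x I t))"
    using assms by (simp add: S_def Un_absorb1)
  also have "\<dots> = (\<Sum>I\<in>A. ennreal (v x I t)) + (\<Sum>\<^sub>\<infinity>I\<in>R - A. ennreal (v x I t))"
    using assms by (subst infsum_Un_disjoint) (auto intro!: nonneg_summable_on_complete)
  also have "(\<Sum>\<^sub>\<infinity>I\<in>R - A. ennreal (v x I t)) = S (zero_on A x) t"
    unfolding S_def by (rule infsum_cong_neutral) (auto simp: v_def)
  finally show ?thesis .
qed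

lemma Z_split:
  assumes "finite A" "A \<subseteq> R" "S x t < top"
  shows "Z x t = (\<Sum>I\<in>A. v x I t) + Z (zero_on A x) t"
proof -
  have "S (zero_on A x) t < top"
    by (rule S_zero_on_finite[OF assms(3)])
  then show ?thesis
    using S_split[OF assms(1,2), of x t]
    by (simp add: Z_def enn2real_plus v_nonneg sum_nonneg)
qed

lemma sum_v_le_Z:
  assumes "finite A" "A \<subseteq> R" "S x t < top"
  shows "(\<Sum>I\<in>A. v x I t) \<le> Z x t"
  using Z_split[OF assms] Z_nonneg by simp

lemma Z_mono:
  assumes "S y t < top" "\<And>I. norm (x I) \<le> norm (y I)"
  shows "Z x t \<le> Z y t"
  unfolding Z_def using assms S_mono[of x y t] by (intro enn2real_mono) auto

text \<open>An integrand of finite integral is finite almost everywhere. This justifies pointwise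
  computations with the real-valued \<open>Z\<close>.\<close>

lemma AE_S_finite:
  assumes "x \<in> X"
  shows "AE t in M. S x t < top"
proof -
  have "AE t in M. ennreal_pow (S x t) (p / q) \<noteq> \<infinity>"
    using assms by (intro nn_integral_PInf_AE) (auto simp: X_def energy_def)
  then show ?thesis
    by eventually_elim (auto simp: ennreal_pow_def less_top split: if_splits)
qed

lemma energy_Z:
  assumes "AE t in M. S x t < top"
  shows "energy x = (\<integral>\<^sup>+t. ennreal (Z x t powr (p / q)) \<partial>M)"
  unfolding energy_def using assms
  by (intro nn_integral_cong_AE) (auto simp: ennreal_pow_def Z_def)

lemma integrable_Z:
  assumes "x \<in> X"
  shows "integrable M (\<lambda>t. Z x t powr (p / q))"
  using assms energy_Z[OF AE_S_finite[OF assms]]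
  by (intro integrableI_nonneg) (auto simp: X_def)

lemma energy_eq:
  assumes "x \<in> X"
  shows "energy x = ennreal (\<integral>t. Z x t powr (p / q) \<partial>M)"
  unfolding energy_Z[OF AE_S_finite[OF assms]]
  by (intro nn_integral_eq_integral integrable_Z assms) auto

lemma nrm_powr:
  assumes "x \<in> X"
  shows "nrm x powr p = (\<integral>t. Z x t powr (p / q) \<partial>M)"
  using p by (simp add: nrm_def energy_eq[OF assms] powr_powr)

lemma integrable_w: "I \<in> R \<Longrightarrow> integrable M (\<lambda>t. w I t powr (p / q))"
  using w_normalized by (intro integrableI_nonneg) auto

lemma integral_w: "I \<in> R \<Longrightarrow> (\<integral>t. w I t powr (p / q) \<partial>M) = 1"
  using w_normalized nn_integral_eq_integral[OF integrable_w, of I] by simp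

lemma v_powr: "v x I t powr (p / q) = norm (x I) powr p * w I t powr (p / q)"
  using q by (simp add: v_def powr_mult w_nonneg powr_powr)

lemma integrable_v: "I \<in> R \<Longrightarrow> integrable M (\<lambda>t. v x I t powr (p / q))"
  unfolding v_powr by (intro integrable_mult_right integrable_w)

lemma integral_v: "I \<in> R \<Longrightarrow> (\<integral>t. v x I t powr (p / q) \<partial>M) = norm (x I) powr p"
  unfolding v_powr by (simp add: integral_w)

section \<open>Changing finitely many coordinates\<close>

lemma Z_update:
  assumes "I \<in> R" "S x t < top"
  shows "S (x(I := c)) t < top" and "Z (x(I := c)) t = Z x t - v x I t + norm c powr q * w I t"
proof -
  have z: "zero_on {I} (x(I := c)) = zero_on {I} x" by (auto simp: zero_on_def)
  have "S (zero_on {I} x) t < top"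
    by (rule S_zero_on_finite[OF assms(2)])
  then show *: "S (x(I := c)) t < top"
    using S_split[of "{I}" "x(I := c)" t] assms by (simp add: z)
  show "Z (x(I := c)) t = Z x t - v x I t + norm c powr q * w I t"
    using Z_split[OF _ _ *, of "{I}"] Z_split[OF _ _ assms(2), of "{I}"] assms(1) by (simp add: z v_def)
qed

text \<open>\<open>powr_add_le\<close> provides an integrable majorant made of the energy of
  \<open>x\<close> and that of the new coordinate.\<close>

lemma update_X:
  assumes "x \<in> X" "I \<in> R"
  shows "x(I := c) \<in> X"
proof -
  have fin: "AE t in M. S (x(I := c)) t < top"
    using AE_S_finite[OF assms(1)] by eventually_elim (rule Z_update(1)[OF assms(2)])
  let ?g = "\<lambda>t. 2 powr (p / q) * (Z x t powr (p / q) + norm c powr p * w I t powr (p / q))"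
  have "energy (x(I := c)) = (\<integral>\<^sup>+t. ennreal (Z (x(I := c)) t powr (p / q)) \<partial>M)"
    by (rule energy_Z[OF fin])
  also have "\<dots> \<le> (\<integral>\<^sup>+t. ennreal (?g t) \<partial>M)"
  proof (rule nn_integral_mono_AE)
    show "AE t in M. ennreal (Z (x(I := c)) t powr (p / q)) \<le> ennreal (?g t)"
      using AE_S_finite[OF assms(1)]
    proof eventually_elim
      case (elim t)
      have "Z (x(I := c)) t \<le> Z x t + norm c powr q * w I t"
        using Z_update(2)[OF assms(2) elim, of c] v_nonneg[of x I t] by simp
      then have "Z (x(I := c)) t powr (p / q) \<le> (Z x t + norm c powr q * w I t) powr (p / q)"
        using r_pos Z_nonneg by (intro powr_mono2) auto
      also have "\<dots> \<le> 2 powr (p / q) * (Z x t powr (p / q) + (norm c powr q * w I t) powr (p / q))"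
        using r_pos Z_nonneg w_nonneg by (intro powr_add_le) auto
      also have "(norm c powr q * w I t) powr (p / q) = norm c powr p * w I t powr (p / q)"
        using q by (simp add: powr_mult w_nonneg powr_powr)
      finally show ?case by (rule ennreal_leI)
    qed
  qed
  also have "\<dots> = ennreal (\<integral>t. ?g t \<partial>M)"
    using integrable_Z[OF assms(1)] integrable_w[OF assms(2)]
    by (intro nn_integral_eq_integral) auto
  also have "\<dots> < top" by simp
  finally show ?thesis using assms by (auto simp: X_def)
qed

lemma finite_change_X:
  assumes "finite A" "A \<subseteq> R" "x \<in> X" "\<And>I. I \<notin> A \<Longrightarrow> y I = x I"
  shows "y \<in> X"
  using assms
proof (induction A arbitrary: y rule: finite_induct)
  case empty
  then have "y = x" by auto
  then show ?case using empty by simp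
next
  case (insert I A)
  have "y(I := x I) \<in> X"
  proof (rule insert.IH)
    show "A \<subseteq> R" using insert.prems by auto
    show "x \<in> X" by (rule insert.prems)
    show "(y(I := x I)) J = x J" if "J \<notin> A" for J using insert.prems(3)[of J] that by auto
  qed
  then show ?case using update_X[of "y(I := x I)" I "y I"] insert.prems(1) by simp
qed

lemma S_zero: "S 0 t = 0"
  by (simp add: S_def v_def)

lemma zero_X: "(0 :: 'i \<Rightarrow> 'k::real_normed_field) \<in> X"
  and nrm_zero: "nrm (0 :: 'i \<Rightarrow> 'k) = 0"
proof -
  have "energy (0 :: 'i \<Rightarrow> 'k) = 0" by (simp add: energy_def ennreal_pow_def S_zero)
  then show "(0 :: 'i \<Rightarrow> 'k) \<in> X" "nrm (0 :: 'i \<Rightarrow> 'k) = 0" by (auto simp: X_def nrm_def)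
qed

lemma unit_seq_X: "I \<in> R \<Longrightarrow> unit_seq I \<in> X"
  using finite_change_X[OF _ _ zero_X, of "{I}" "unit_seq I"] by (auto simp: unit_seq_def)

lemma nrm_scale: "x \<in> X \<Longrightarrow> c \<noteq> 0 \<Longrightarrow> seq_scale c x \<in> X \<and> nrm (seq_scale c x) = norm c * nrm x"
proof -
  assume x: "x \<in> X" and c: "c \<noteq> 0"
  have "S (seq_scale c x) t = ennreal (norm c powr q) * S x t" for t
  proof -
    have "ennreal (v (seq_scale c x) I t) = ennreal (norm c powr q) * ennreal (v x I t)" for I
      using w_nonneg by (simp add: v_def seq_scale_def norm_mult powr_mult ennreal_mult mult.assoc)
    then show ?thesis
      by (simp add: S_def nonneg_infsum_complete SUP_mult_left_ennreal sum_distrib_left)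
  qed
  then have e: "energy (seq_scale c x) = ennreal (norm c powr p) * energy x"
    using c q by (simp add: energy_def ennreal_pow_mult powr_powr nn_integral_cmult)
  then have "energy (seq_scale c x) < top" using x by (auto simp: X_def ennreal_mult_less_top)
  then have "seq_scale c x \<in> X" using x by (auto simp: X_def seq_scale_def)
  moreover have "nrm (seq_scale c x) = norm c * nrm x"
    using p by (simp add: nrm_def e enn2real_mult powr_mult powr_powr)
  ultimately show ?thesis ..
qed

lemma nrm_unit_seq: "I \<in> R \<Longrightarrow> nrm (unit_seq I :: 'i \<Rightarrow> 'k::real_normed_field) = 1"
proof -
  assume I: "I \<in> R"
  have z: "zero_on {I} (unit_seq I) = (0 :: 'i \<Rightarrow> 'k)" by (auto simp: zero_on_def unit_seq_def)
  have "S (unit_seq I :: 'i \<Rightarrow> 'k) t = ennreal (w I t)" for t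
    using S_split[of "{I}" "unit_seq I :: 'i \<Rightarrow> 'k" t] I
    by (simp add: z S_zero) (simp add: v_def unit_seq_def)
  then have "Z (unit_seq I :: 'i \<Rightarrow> 'k) t = w I t" for t
    using w_nonneg by (simp add: Z_def)
  then have "nrm (unit_seq I :: 'i \<Rightarrow> 'k) powr p = 1"
    using I by (simp add: nrm_powr unit_seq_X integral_w)
  then have "(nrm (unit_seq I :: 'i \<Rightarrow> 'k) powr p) powr (1 / p) = 1" by simp
  then show ?thesis using p nrm_nonneg[of "unit_seq I :: 'i \<Rightarrow> 'k"] by (simp add: powr_powr)
qed

text \<open>If the norms agreed, the integrals of \<open>Z powr (p / q)\<close> would agree; as
  deletion decreases \<open>Z\<close>, it would leave \<open>Z\<close> unchanged almost everywhere.
  Then \<open>w I\<close> would vanish almost everywhere, against its normalisation.\<close>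

lemma nrm_zero_on_less:
  assumes "x \<in> X" "finite A" "A \<subseteq> R" "I \<in> A" "x I \<noteq> 0"
  shows "nrm (zero_on A x) < nrm x"
proof -
  have le: "nrm (zero_on A x) \<le> nrm x"
    using assms(1) by (rule nrm_dominated) (auto simp: zero_on_def)
  moreover have "nrm (zero_on A x) \<noteq> nrm x"
  proof
    assume "nrm (zero_on A x) = nrm x"
    then have eq: "(\<integral>t. Z x t powr (p / q) - Z (zero_on A x) t powr (p / q) \<partial>M) = 0"
      using nrm_powr[OF assms(1)] nrm_powr[OF zero_on_X[OF assms(1)], of A]
        integrable_Z[OF assms(1)] integrable_Z[OF zero_on_X[OF assms(1)], of A] by simp
    have ae: "AE t in M. v x I t + Z (zero_on A x) t \<le> Z x t"
      using AE_S_finite[OF assms(1)]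
    proof eventually_elim
      case (elim t)
      have "v x I t \<le> (\<Sum>I\<in>A. v x I t)"
        using assms by (intro member_le_sum) (auto simp: v_nonneg)
      then show ?case using Z_split[OF assms(2,3) elim] by simp
    qed
    have "AE t in M. Z x t powr (p / q) - Z (zero_on A x) t powr (p / q) = 0"
    proof (subst integral_nonneg_eq_0_iff_AE[symmetric])
      show "AE t in M. 0 \<le> Z x t powr (p / q) - Z (zero_on A x) t powr (p / q)"
        using ae
      proof eventually_elim
        case (elim t)
        then have "Z (zero_on A x) t \<le> Z x t" using v_nonneg[of x I t] by simp
        then show ?case using r_pos Z_nonneg by (auto intro!: powr_mono2)
      qed
    qed (use eq integrable_Z assms zero_on_X in \<open>auto intro!: Bochner_Integration.integrable_diff\<close>)
    then have "AE t in M. w I t powr (p / q) = 0"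
      using ae
    proof eventually_elim
      case (elim t)
      have "Z x t \<le> Z (zero_on A x) t"
        using elim(1) r_pos Z_nonneg by (metis diff_self eq_iff_diff_eq_0 linorder_not_le powr_less_mono2 order_less_irrefl)
      then have "v x I t = 0" using elim(2) v_nonneg[of x I t] by simp
      then show ?case using assms by (simp add: v_def)
    qed
    then have "(\<integral>t. w I t powr (p / q) \<partial>M) = (\<integral>t. 0 \<partial>M)"
      using assms by (intro integral_cong_AE) auto
    then show False using integral_w[of I] assms by auto
  qed
  ultimately show ?thesis by simp
qed

subsection \<open>Norming functionals\<close>

text \<open>For \<open>nrm y > 0\<close> the normalised vector is tested in the supremum defining
  \<open>dual_norm\<close>, which runs over a bounded set because \<open>F\<close> is bounded; if
  \<open>nrm y = 0\<close>, boundedness gives the claim directly.\<close>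

lemma norming_functional_le:
  fixes y :: "'i \<Rightarrow> 'k::real_normed_field"
  assumes "norming_functional X nrm f F" "y \<in> X"
  shows "norm (F y) \<le> nrm y"
proof -
  obtain b where scale: "\<And>c x. x \<in> X \<Longrightarrow> F (seq_scale c x) = c * F x"
    and b: "\<And>x. x \<in> X \<Longrightarrow> norm (F x) \<le> b * nrm x"
    and one: "dual_norm X nrm F = 1"
    using assms(1) unfolding norming_functional_def bounded_functional_def by blast
  show ?thesis
  proof (cases "nrm y = 0")
    case True
    then show ?thesis using b[OF assms(2)] by simp
  next
    case False
    then have pos: "nrm y > 0" using nrm_nonneg[of y] by simp
    define z where "z = seq_scale (of_real (1 / nrm y)) y"
    have z: "z \<in> X" "nrm z = 1"
      using nrm_scale[OF assms(2), of "of_real (1 / nrm y)"] pos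
      by (auto simp: z_def norm_divide)
    have bdd: "bdd_above ((\<lambda>x. norm (F x)) ` {x \<in> X. nrm x \<le> 1})"
    proof (rule bdd_aboveI2)
      fix x :: "'i \<Rightarrow> 'k" assume x: "x \<in> {x \<in> X. nrm x \<le> 1}"
      then have "norm (F x) \<le> b * nrm x" using b by simp
      also have "\<dots> \<le> \<bar>b\<bar> * 1" using x nrm_nonneg[of x] by (intro mult_mono) auto
      finally show "norm (F x) \<le> \<bar>b\<bar>" by simp
    qed
    have "norm (F z) \<le> 1"
      using cSUP_upper[OF _ bdd, of z] z one by (simp add: dual_norm_def)
    moreover have "norm (F z) = norm (F y) / nrm y"
      using scale[OF assms(2)] pos by (simp add: z_def norm_mult norm_divide)
    ultimately show ?thesis using pos by (simp add: divide_simps)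
  qed
qed

text \<open>The phase of c is chosen so that \<open>F\<close> takes the value nrm f + h |F(e_I)| at
  f + c e_I, where e_I is the basis vector. This is at most the norm of the perturbed vector, and
  \<open>powr_tangent_le\<close> passes to p-th powers.\<close>

lemma norming_functional_increment:
  fixes f :: "'i \<Rightarrow> 'k::real_normed_field"
  assumes F: "norming_functional X nrm f F" and f: "f \<in> X" and I: "I \<in> R" and h: "h \<ge> 0"
  shows "\<exists>c. norm c = h \<and> nrm f powr (p - 1) * (h * norm (F (unit_seq I)))
    \<le> (\<integral>t. Z (f(I := f I + c)) t powr (p / q) - Z f t powr (p / q) \<partial>M)"
proof -
  have add: "\<And>x y. x \<in> X \<Longrightarrow> y \<in> X \<Longrightarrow> F (x + y) = F x + F y"
    and scale: "\<And>c x. x \<in> X \<Longrightarrow> F (seq_scale c x) = c * F x"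
    and Ff: "F f = of_real (nrm f)"
    using F unfolding norming_functional_def bounded_functional_def by blast+
  define e where "e = F (unit_seq I)"
  define c where "c = (if e = 0 then of_real h else of_real (h * norm e) / e)"
  have c: "norm c = h" "c * e = of_real (h * norm e)"
    using h by (auto simp: c_def norm_divide norm_mult)
  define f' where "f' = f(I := f I + c)"
  have f': "f' \<in> X" unfolding f'_def by (rule update_X[OF f I])
  have "f' = f + seq_scale c (unit_seq I)"
    by (auto simp: f'_def seq_scale_def unit_seq_def fun_eq_iff)
  moreover have "seq_scale c (unit_seq I) \<in> X"
    using nrm_scale[OF unit_seq_X[OF I], of c] zero_X
    by (cases "c = 0") (auto simp: seq_scale_def zero_fun_def)
  ultimately have "F f' = of_real (nrm f + h * norm e)"
    using add[OF f] scale[OF unit_seq_X[OF I]] Ff c(2) by (simp add: e_def)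
  then have "norm (F f') = nrm f + h * norm e"
    using h nrm_nonneg[of f] by (simp del: of_real_add)
  then have le: "nrm f + h * norm e \<le> nrm f'"
    using norming_functional_le[OF F f'] by simp
  have "nrm f powr (p - 1) * (h * norm e) \<le> nrm f powr (p - 1) * (nrm f' - nrm f)"
    using le by (intro mult_left_mono) auto
  also have "\<dots> \<le> nrm f' powr p - nrm f powr p"
    using le h p nrm_nonneg by (intro powr_tangent_le) (auto intro: order_trans[rotated])
  also have "\<dots> = (\<integral>t. Z f' t powr (p / q) - Z f t powr (p / q) \<partial>M)"
    using integrable_Z[OF f] integrable_Z[OF f'] by (simp add: nrm_powr f f')
  finally show ?thesis using c by (auto simp: f'_def e_def)
qed

text \<open>
  Up to a constant, \<open>J x I\<close> is the decrease of the \<open>p\<close>-th power of the norm when the coordinate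
  \<open>x I\<close> is removed; it controls the value of a norming functional at the \<open>I\<close>-th basis vector.
\<close>

definition J :: "('i \<Rightarrow> 'k::real_normed_field) \<Rightarrow> 'i \<Rightarrow> real" where
  "J x I = (\<integral>t. Z x t powr (p / q - 1) * v x I t \<partial>M)"

text \<open>As V \<le> Z, the integrand is dominated by \<open>Z x t powr (p / q)\<close>. This
  includes a negative exponent p/q - 1, since at zeros of \<open>Z\<close> the product is 0.\<close>

lemma integrable_Z_times:
  assumes "x \<in> X" "\<And>t. V t \<ge> 0" "V \<in> borel_measurable M" "AE t in M. V t \<le> Z x t"
  shows "integrable M (\<lambda>t. Z x t powr (p / q - 1) * V t)"
proof (rule Bochner_Integration.integrable_bound[OF integrable_Z[OF assms(1)]])
  show "AE t in M. norm (Z x t powr (p / q - 1) * V t) \<le> norm (Z x t powr (p / q))"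
    using assms(4)
  proof eventually_elim
    case (elim t)
    then have "Z x t powr (p / q - 1) * V t \<le> Z x t powr (p / q - 1) * Z x t"
      by (intro mult_left_mono) auto
    also have "\<dots> = Z x t powr (p / q)"
      using Z_nonneg[of x t] by (cases "Z x t = 0") (auto simp: powr_diff)
    finally show ?case using assms(2) by (simp add: abs_mult)
  qed
qed (use assms(3) in measurable)

lemma v_le_Z: "I \<in> R \<Longrightarrow> S x t < top \<Longrightarrow> v x I t \<le> Z x t"
  using sum_v_le_Z[of "{I}" x t] by simp

lemma AE_v_le_Z: "I \<in> R \<Longrightarrow> x \<in> X \<Longrightarrow> AE t in M. v x I t \<le> Z x t"
  using AE_S_finite[of x] by (auto elim!: eventually_mono intro: v_le_Z)

lemma integrable_Z_v:
  "x \<in> X \<Longrightarrow> I \<in> R \<Longrightarrow> integrable M (\<lambda>t. Z x t powr (p / q - 1) * v x I t)"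
  by (intro integrable_Z_times AE_v_le_Z) (auto simp: v_nonneg)

text \<open>The constant of \<open>powr_add_scaled_le\<close> for k = 2^q - 1, the relative increase
  of the q-th power of a coordinate that is doubled.\<close>

definition K :: real where
  "K = (1 + (2 powr q - 1)) powr (p / q) + (2 powr q - 1)"

lemma K_pos: "K > 0"
proof -
  have "2 powr 0 \<le> (2::real) powr q" using q by (intro powr_mono) auto
  then show ?thesis by (auto simp: K_def intro!: add_pos_nonneg)
qed

text \<open>Testing the norming functional against the vector whose \<open>I\<close>-th coordinate is doubled.\<close>

lemma norming_functional_le_J:
  fixes f :: "'i \<Rightarrow> 'k::real_normed_field"
  assumes F: "norming_functional X nrm f F" and f: "f \<in> X" and I: "I \<in> R"
  shows "nrm f powr (p - 1) * (norm (f I) * norm (F (unit_seq I))) \<le> K * J f I"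
proof -
  define k where "k = 2 powr q - 1"
  have k: "k \<ge> 0" using q ge_one_powr_ge_zero[of 2 q] by (simp add: k_def)
  obtain c where c: "norm c = norm (f I)" and
    le: "nrm f powr (p - 1) * (norm (f I) * norm (F (unit_seq I)))
    \<le> (\<integral>t. Z (f(I := f I + c)) t powr (p / q) - Z f t powr (p / q) \<partial>M)"
    using norming_functional_increment[OF F f I, of "norm (f I)"] by auto
  have "(\<integral>t. Z (f(I := f I + c)) t powr (p / q) - Z f t powr (p / q) \<partial>M)
      \<le> (\<integral>t. K * (Z f t powr (p / q - 1) * v f I t) \<partial>M)"
  proof (intro integral_mono_AE Bochner_Integration.integrable_diff integrable_Z update_X f I
      integrable_mult_right integrable_Z_v)
    show "AE t in M. Z (f(I := f I + c)) t powr (p / q) - Z f t powr (p / q)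
        \<le> K * (Z f t powr (p / q - 1) * v f I t)"
      using AE_S_finite[OF f]
    proof eventually_elim
      case (elim t)
      have "norm (f I + c) powr q \<le> (2 * norm (f I)) powr q"
        using q c norm_triangle_ineq[of "f I" c] by (intro powr_mono2) auto
      also have "\<dots> = (1 + k) * norm (f I) powr q" by (simp add: powr_mult k_def)
      finally have "norm (f I + c) powr q * w I t \<le> (1 + k) * norm (f I) powr q * w I t"
        using w_nonneg by (intro mult_right_mono) auto
      then have "Z (f(I := f I + c)) t \<le> Z f t + k * v f I t"
        using Z_update(2)[OF I elim, of "f I + c"] by (simp add: v_def algebra_simps)
      then have "Z (f(I := f I + c)) t powr (p / q) - Z f t powr (p / q)
          \<le> (Z f t + k * v f I t) powr (p / q) - Z f t powr (p / q)"
        using r_pos Z_nonneg[of "f(I := f I + c)" t] by (intro diff_right_mono powr_mono2) auto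
      also have "\<dots> \<le> ((1 + k) powr (p / q) + k) * (Z f t powr (p / q - 1) * v f I t)"
        using v_nonneg v_le_Z[OF I elim] k r_pos by (intro powr_add_scaled_le) auto
      finally show ?case by (simp add: K_def k_def)
    qed
  qed
  also have "\<dots> = K * J f I" by (simp add: J_def)
  finally show ?thesis using le by simp
qed

text \<open>A new coordinate of modulus h adds h^q * w I to \<open>Z\<close>, so the p-th power of
  the norm grows by O(h^min(p,q)): by subadditivity of the power if p \<le> q, by convexity if q <
  p.\<close>

lemma norming_functional_increment_zero:
  fixes f :: "'i \<Rightarrow> 'k::real_normed_field"
  assumes F: "norming_functional X nrm f F" and f: "f \<in> X" and I: "I \<in> R" and fI: "f I = 0"
  shows "\<exists>D\<ge>0. \<forall>h. 0 < h \<and> h \<le> 1 \<longrightarrow>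
    nrm f powr (p - 1) * (h * norm (F (unit_seq I))) \<le> h powr (min p q) * D"
proof (cases "p \<le> q")
  case True
  have "nrm f powr (p - 1) * (h * norm (F (unit_seq I))) \<le> h powr (min p q) * 1" if h: "0 < h" for h
  proof -
    obtain c where c: "norm c = h" and
      le: "nrm f powr (p - 1) * (h * norm (F (unit_seq I)))
      \<le> (\<integral>t. Z (f(I := f I + c)) t powr (p / q) - Z f t powr (p / q) \<partial>M)"
      using norming_functional_increment[OF F f I, of h] h by force
    note le
    also have "(\<integral>t. Z (f(I := f I + c)) t powr (p / q) - Z f t powr (p / q) \<partial>M) \<le> (\<integral>t. h powr p * w I t powr (p / q) \<partial>M)"
    proof (intro integral_mono_AE Bochner_Integration.integrable_diff integrable_Z update_X f I
      integrable_mult_right integrable_w)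
      show "AE t in M. Z (f(I := f I + c)) t powr (p / q) - Z f t powr (p / q) \<le> h powr p * w I t powr (p / q)"
        using AE_S_finite[OF f]
      proof eventually_elim
        case (elim t)
        have eq: "Z (f(I := f I + c)) t = Z f t + h powr q * w I t"
          using Z_update(2)[OF I elim, of "f I + c"] c by (simp add: v_def fI)
        have "Z (f(I := f I + c)) t powr (p / q) \<le> Z f t powr (p / q) + (h powr q * w I t) powr (p / q)"
          unfolding eq using Z_nonneg w_nonneg r_pos True q by (intro powr_subadditive) auto
        also have "(h powr q * w I t) powr (p / q) = h powr p * w I t powr (p / q)"
          using q w_nonneg by (simp add: powr_mult powr_powr)
        finally show ?case by linarith
      qed
    qed
    also have "\<dots> = h powr min p q * 1" using True by (simp add: integral_w[OF I])
    finally show ?thesis .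
  qed
  then show ?thesis by (intro exI[of _ 1]) auto
next
  case False
  then have pq: "p / q \<ge> 1" "q \<le> p" using q by auto
  \<comment> \<open>For modulus h the value of \<open>Z\<close> is the convex combination, with
    parameter h^q, of its values at \<open>f\<close> and at \<open>?f1\<close>; \<open>D\<close> is
    the increment for h = 1.\<close>
  let ?f1 = "f(I := 1)"
  have f1: "?f1 \<in> X" by (rule update_X[OF f I])
  define D where "D = (\<integral>t. Z ?f1 t powr (p / q) - Z f t powr (p / q) \<partial>M)"
  have Zf1: "AE t in M. Z ?f1 t = Z f t + w I t"
    using AE_S_finite[OF f] by eventually_elim (simp add: Z_update(2)[OF I] v_def fI)
  have "nrm f powr (p - 1) * (h * norm (F (unit_seq I))) \<le> h powr (min p q) * D" if h: "0 < h" "h \<le> 1" for h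
  proof -
    obtain c where c: "norm c = h" and
      le: "nrm f powr (p - 1) * (h * norm (F (unit_seq I)))
      \<le> (\<integral>t. Z (f(I := f I + c)) t powr (p / q) - Z f t powr (p / q) \<partial>M)"
      using norming_functional_increment[OF F f I, of h] h(1) by force
    note le
    also have "(\<integral>t. Z (f(I := f I + c)) t powr (p / q) - Z f t powr (p / q) \<partial>M) \<le> (\<integral>t. h powr q * (Z ?f1 t powr (p / q) - Z f t powr (p / q)) \<partial>M)"
    proof (intro integral_mono_AE Bochner_Integration.integrable_diff integrable_Z update_X f I
      integrable_mult_right integrable_w)
      show "AE t in M. Z (f(I := f I + c)) t powr (p / q) - Z f t powr (p / q)
          \<le> h powr q * (Z ?f1 t powr (p / q) - Z f t powr (p / q))"
        using AE_S_finite[OF f] Zf1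
      proof eventually_elim
        case (elim t)
        have "h powr q \<le> 1 powr q" using h q by (intro powr_mono2) auto
        then have "((1 - h powr q) * Z f t + h powr q * (Z f t + w I t)) powr (p / q)
          \<le> (1 - h powr q) * Z f t powr (p / q) + h powr q * (Z f t + w I t) powr (p / q)"
          using pq Z_nonneg w_nonneg by (intro powr_convex_nonneg) (auto intro: add_nonneg_nonneg)
        moreover have "Z (f(I := f I + c)) t = (1 - h powr q) * Z f t + h powr q * (Z f t + w I t)"
          using Z_update(2)[OF I elim(1), of "f I + c"] c by (simp add: v_def fI algebra_simps)
        ultimately show ?case using elim(2) by (simp add: algebra_simps)
      qed
    qed
    also have "\<dots> = h powr (min p q) * D" using pq by (simp add: D_def)
    finally show ?thesis .
  qed
  moreover have "D \<ge> 0"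
    unfolding D_def
  proof (rule integral_nonneg_AE)
    show "AE t in M. 0 \<le> Z ?f1 t powr (p / q) - Z f t powr (p / q)"
      using Zf1 by eventually_elim (use pq Z_nonneg w_nonneg in \<open>auto intro!: powr_mono2\<close>)
  qed
  ultimately show ?thesis by (intro exI[of _ D]) auto
qed

text \<open>The preceding bound has an exponent min p q > 1, whereas the left side is linear in h,
  so small h force the value 0. Hence a coordinate at which the functional is nonzero has not been
  removed yet.\<close>

lemma norming_functional_zero:
  fixes f :: "'i \<Rightarrow> 'k::real_normed_field"
  assumes F: "norming_functional X nrm f F" and f: "f \<in> X" and pos: "nrm f > 0"
    and I: "I \<in> R" and fI: "f I = 0"
  shows "F (unit_seq I) = 0"
proof (rule ccontr)
  assume "F (unit_seq I) \<noteq> 0"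
  define g where "g = nrm f powr (p - 1) * norm (F (unit_seq I))"
  have g: "g > 0" using pos \<open>F (unit_seq I) \<noteq> 0\<close> by (simp add: g_def)
  define s where "s = min p q"
  have s: "s > 1" using p q by (simp add: s_def)
  obtain D where D: "D \<ge> 0" "\<And>h. 0 < h \<Longrightarrow> h \<le> 1 \<Longrightarrow>
      nrm f powr (p - 1) * (h * norm (F (unit_seq I))) \<le> h powr s * D"
    using norming_functional_increment_zero[OF F f I fI] unfolding s_def by blast
  \<comment> \<open>\<open>h\<close> will satisfy h^(s-1) = z, with z small enough for z * D <
    g.\<close>
  define z where "z = min 1 (g / (2 * (D + 1)))"
  have z: "0 < z" "z \<le> 1" using g D by (auto simp: z_def)
  define h where "h = z powr (1 / (s - 1))"
  have h: "0 < h" "h \<le> 1" using z s by (auto simp: h_def powr_le1)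
  have "h * g \<le> h powr s * D"
    using D(2)[OF h] by (simp add: g_def mult.left_commute)
  also have "h powr s = h * h powr (s - 1)" using h by (simp add: powr_diff)
  also have "h powr (s - 1) = z" using z s by (simp add: h_def powr_powr)
  finally have "g \<le> z * D" using h by simp
  also have "\<dots> \<le> g / (2 * (D + 1)) * D" using D by (intro mult_right_mono) (auto simp: z_def)
  also have "\<dots> < g" using g D by (simp add: field_simps add_nonneg_pos)
  finally show False by simp
qed

text \<open>Hoelder's inequality with exponents r/(r - 1) and r for r = p/q; the first one turns the
  power r - 1 of \<open>Z\<close> into the power r.\<close>

lemma Holder_Z:
  assumes x: "x \<in> X" and pq: "q < p" and V: "\<And>t. V t \<ge> 0" "V \<in> borel_measurable M"
    "integrable M (\<lambda>t. V t powr (p / q))"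
  shows "(\<integral>t. Z x t powr (p / q - 1) * V t \<partial>M) \<le> nrm x powr (p - q) * (\<integral>t. V t powr (p / q) \<partial>M) powr (q / p)"
proof -
  have r: "p / q > 1" using pq q by simp
  define a where "a = (p / q) / (p / q - 1)"
  have a: "a > 1" "1 / a + 1 / (p / q) = 1" "(p / q - 1) * a = p / q"
    using r pq q p by (auto simp: a_def field_simps)
  have "(\<integral>t. Z x t powr (p / q - 1) * V t \<partial>M) \<le>
    (\<integral>t. (Z x t powr (p / q - 1)) powr a \<partial>M) powr (1 / a) * (\<integral>t. V t powr (p / q) \<partial>M) powr (1 / (p / q))"
    using a V r integrable_Z[OF x] by (intro Holder_integral(2)) (auto simp: powr_powr)
  also have "(\<integral>t. (Z x t powr (p / q - 1)) powr a \<partial>M) = nrm x powr p"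
    using a by (simp add: powr_powr nrm_powr[OF x])
  also have "(nrm x powr p) powr (1 / a) = nrm x powr (p - q)"
  proof -
    have "p * (1 / a) = p - q" using pq q p by (simp add: a_def field_simps)
    then show ?thesis by (simp add: powr_powr)
  qed
  finally show ?thesis by simp
qed

text \<open>\<open>norming_functional_le_J\<close> bounds \<open>J\<close> from below by a multiple
  of |f I|. The unknown |f I| is eliminated by an upper bound of \<open>J\<close>, namely |f I|^p if
  p \<le> q and nrm f^(p-q) |f I|^q if q < p, and the result is solved for \<open>J\<close>.\<close>

lemma J_ge:
  fixes f :: "'i \<Rightarrow> 'k::real_normed_field"
  assumes F: "norming_functional X nrm f F" and f: "f \<in> X" and pos: "nrm f > 0"
    and I: "I \<in> R" and \<mu>: "0 < \<mu>" "\<mu> \<le> norm (F (unit_seq I))"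
  shows "(\<mu> / K) powr (if p \<le> q then conj_exp p else conj_exp q) * nrm f powr p \<le> J f I"
proof -
  have fI: "f I \<noteq> 0" using norming_functional_zero[OF F f pos I] \<mu> by auto
  define m where "m = \<mu> / K"
  have m: "m > 0" using \<mu> K_pos by (simp add: m_def)
  have "nrm f powr (p - 1) * (norm (f I) * \<mu>) \<le> nrm f powr (p - 1) * (norm (f I) * norm (F (unit_seq I)))"
    using \<mu> by (intro mult_left_mono) auto
  also have "\<dots> \<le> K * J f I" by (rule norming_functional_le_J[OF F f I])
  finally have *: "nrm f powr (p - 1) * norm (f I) * m \<le> J f I"
    using K_pos by (simp add: m_def field_simps)
  have "nrm f powr (p - 1) * norm (f I) * m > 0" using pos fI m by simp
  then have Jpos: "J f I > 0" using * by linarith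
  show ?thesis
  proof (cases "p \<le> q")
    case True
    \<comment> \<open>As p/q - 1 \<le> 0, replacing \<open>Z\<close> by the smaller
      \<open>v f I\<close> increases the integrand wherever \<open>v f I\<close> is
      positive.\<close>
    have "J f I \<le> (\<integral>t. v f I t powr (p / q) \<partial>M)"
      unfolding J_def
    proof (intro integral_mono_AE integrable_Z_v f I integrable_v)
      show "AE t in M. Z f t powr (p / q - 1) * v f I t \<le> v f I t powr (p / q)"
        using AE_v_le_Z[OF I f]
      proof eventually_elim
        case (elim t)
        show ?case
        proof (cases "v f I t = 0")
          case False
          then have vp: "v f I t > 0" using v_nonneg[of f I t] by simp
          have "Z f t powr (p / q - 1) * v f I t \<le> v f I t powr (p / q - 1) * v f I t"
            using vp elim True q by (intro mult_right_mono powr_mono2') auto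
          also have "\<dots> = v f I t powr (p / q)" using vp by (simp add: powr_diff)
          finally show ?thesis .
        qed simp
      qed
    qed
    then have J_le: "J f I \<le> norm (f I) powr p" by (simp add: integral_v[OF I])
    have "J f I powr (1 / p) \<le> (norm (f I) powr p) powr (1 / p)"
      using J_le Jpos p by (intro powr_mono2) auto
    then have "J f I powr (1 / p) \<le> norm (f I)" using p by (simp add: powr_powr)
    then have "nrm f powr (p - 1) * J f I powr (1 / p) * m \<le> nrm f powr (p - 1) * norm (f I) * m"
      using m by (intro mult_left_mono mult_right_mono) auto
    also note *
    finally have "nrm f powr (p - 1) * m \<le> J f I powr (1 - 1 / p)"
      using Jpos by (simp add: powr_diff field_simps)
    then have "(nrm f powr (p - 1) * m) powr conj_exp p \<le> (J f I powr (1 - 1 / p)) powr conj_exp p"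
      using p m by (intro powr_mono2) (auto simp: conj_exp_def)
    also have "\<dots> = J f I powr ((1 - 1 / p) * conj_exp p)" by (simp add: powr_powr)
    also have "(1 - 1 / p) * conj_exp p = 1" using p by (simp add: conj_exp_def field_simps)
    also have "(nrm f powr (p - 1) * m) powr conj_exp p = m powr conj_exp p * nrm f powr ((p - 1) * conj_exp p)"
      using m by (simp add: powr_mult powr_powr mult.commute)
    also have "(p - 1) * conj_exp p = p" using p by (simp add: conj_exp_def)
    finally show ?thesis using True Jpos by (simp add: m_def)
  next
    case False
    have "J f I \<le> nrm f powr (p - q) * (\<integral>t. v f I t powr (p / q) \<partial>M) powr (q / p)"
      unfolding J_def using False by (intro Holder_Z f) (auto simp: v_nonneg integrable_v I)
    also have "(\<integral>t. v f I t powr (p / q) \<partial>M) powr (q / p) = norm (f I) powr q"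
      using p by (simp add: integral_v[OF I] powr_powr)
    finally have "J f I powr (1 / q) \<le> (nrm f powr (p - q) * norm (f I) powr q) powr (1 / q)"
      using Jpos q by (intro powr_mono2) auto
    also have "\<dots> = nrm f powr ((p - q) / q) * norm (f I)"
      using q by (simp add: powr_mult powr_powr)
    finally have "nrm f powr (p / q') * (J f I powr (1 / q) * m)
        \<le> nrm f powr (p / q') * (nrm f powr ((p - q) / q) * norm (f I) * m)" for q'
      using m by (intro mult_left_mono mult_right_mono) auto
    \<comment> \<open>The exponent \<open>p / conj_exp q\<close> completes (p - q)/q to p - 1, the
      exponent occurring in \<open>*\<close>.\<close>
    from this[of "conj_exp q"]
    have "nrm f powr (p / conj_exp q) * (J f I powr (1 / q) * m)
        \<le> nrm f powr (p / conj_exp q + (p - q) / q) * norm (f I) * m"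
      by (simp add: powr_add mult.assoc)
    also have "p / conj_exp q + (p - q) / q = p - 1"
      using q by (simp add: conj_exp_def field_simps)
    also note *
    finally have "nrm f powr (p / conj_exp q) * m \<le> J f I powr (1 - 1 / q)"
      using Jpos by (simp add: powr_diff field_simps)
    then have "(nrm f powr (p / conj_exp q) * m) powr conj_exp q \<le> (J f I powr (1 - 1 / q)) powr conj_exp q"
      using q m by (intro powr_mono2) (auto simp: conj_exp_def)
    also have "\<dots> = J f I powr ((1 - 1 / q) * conj_exp q)" by (simp add: powr_powr)
    also have "(1 - 1 / q) * conj_exp q = 1" using q by (simp add: conj_exp_def field_simps)
    also have "(nrm f powr (p / conj_exp q) * m) powr conj_exp q = m powr conj_exp q * nrm f powr p"
      using m q by (simp add: powr_mult powr_powr mult.commute conj_exp_def)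
    finally show ?thesis using False Jpos by (simp add: m_def)
  qed
qed

subsection \<open>Runs of the greedy algorithm\<close>

lemma dist_to_le:
  assumes "a \<in> A"
  shows "dist_to nrm f A \<le> nrm (f - a)"
  unfolding dist_to_def by (rule cINF_lower[OF _ assms]) (auto intro!: bdd_belowI2[of _ 0] nrm_nonneg)

text \<open>
  The norm is strictly monotone in every coordinate, so the best approximation of \<open>x\<close> from the
  span of some basis vectors is the coordinate projection.
\<close>

lemma wcga_run_zero_on:
  fixes x :: "'i \<Rightarrow> 'k::real_normed_field"
  assumes x: "x \<in> X" and run: "wcga_run X nrm (unit_seq ` R) \<tau> x G" and pos: "nrm (x - G n) > 0"
  obtains i where "\<And>k. k \<le> n \<Longrightarrow> x - G k = zero_on (i ` {..<k}) x"
    and "\<And>k. k < n \<Longrightarrow> i k \<in> R"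
    and "\<And>k. k < n \<Longrightarrow> \<exists>F. norming_functional X nrm (zero_on (i ` {..<k}) x) F \<and>
      \<tau> * (SUP g\<in>unit_seq ` R. norm (F g)) \<le> norm (F (unit_seq (i k)))"
proof -
  obtain \<phi> where G0: "G 0 = 0" and \<phi>: "\<And>n.
        if x - G n = 0 then G (Suc n) = G n
        else \<phi> n \<in> unit_seq ` R \<and>
             (\<exists>F. norming_functional X nrm (x - G n) F \<and>
                  norm (F (\<phi> n)) \<ge> \<tau> * (SUP g\<in>unit_seq ` R. norm (F g))) \<and>
             G (Suc n) \<in> seq_span (\<phi> ` {..n}) \<and>
             nrm (x - G (Suc n)) = dist_to nrm x (seq_span (\<phi> ` {..n}))"
    using run unfolding wcga_run_def by metis
  \<comment> \<open>A remainder that is once zero stays zero; so a nonzero remainder after n steps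
    means that each of these steps really selected an element.\<close>
  have nz: "x - G k \<noteq> 0" if "k \<le> n" for k
  proof
    assume "x - G k = 0"
    with that have "x - G n = 0"
      by (induction rule: dec_induct) (use \<phi> in \<open>metis+\<close>)
    then show False using pos by (simp add: nrm_zero)
  qed
  have step: "\<phi> k \<in> unit_seq ` R"
      "\<exists>F. norming_functional X nrm (x - G k) F \<and> norm (F (\<phi> k)) \<ge> \<tau> * (SUP g\<in>unit_seq ` R. norm (F g))"
      "G (Suc k) \<in> seq_span (\<phi> ` {..k})"
      "nrm (x - G (Suc k)) = dist_to nrm x (seq_span (\<phi> ` {..k}))" if "k < n" for k
    using \<phi>[of k] nz[of k] that by (simp_all only: if_False less_imp_le_nat)
  define i where "i = (\<lambda>k. SOME I. I \<in> R \<and> \<phi> k = unit_seq I)"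
  have i: "i k \<in> R" "\<phi> k = unit_seq (i k)" if "k < n" for k
  proof -
    have "\<exists>I. I \<in> R \<and> \<phi> k = unit_seq I" using step(1)[OF that] by auto
    then have "i k \<in> R \<and> \<phi> k = unit_seq (i k)" unfolding i_def by (rule someI_ex)
    then show "i k \<in> R" "\<phi> k = unit_seq (i k)" by auto
  qed
  have res: "x - G k = zero_on (i ` {..<k}) x" if "k \<le> n" for k
  proof (cases k)
    case 0
    then show ?thesis by (simp add: G0)
  next
    case (Suc m)
    then have m: "m < n" using that by simp
    define A where "A = i ` {..m}"
    have A: "finite A" "A \<subseteq> R" using i(1) m by (auto simp: A_def)
    have "\<phi> ` {..m} = unit_seq ` A"
      unfolding A_def image_image using i(2) m by (intro image_cong) auto
    then have span: "seq_span (\<phi> ` {..m}) = {y. \<forall>I. I \<notin> A \<longrightarrow> y I = 0}"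
      using seq_span_unit_seq[OF A(1)] by simp
    define g where "g = x - G (Suc m)"
    have gA: "g I = x I" if "I \<notin> A" for I
      using step(3)[OF m] that by (simp add: span g_def)
    have gX: "g \<in> X" by (rule finite_change_X[OF A x gA])
    have zg: "zero_on A g = zero_on A x" using gA by (auto simp: zero_on_def)
    \<comment> \<open>The projection is an admissible competitor, and its remainder arises from the
      minimal remainder \<open>g\<close> by deleting \<open>A\<close>. By strict monotonicity
      \<open>g\<close> already vanishes on \<open>A\<close>.\<close>
    have "x - zero_on A x \<in> seq_span (\<phi> ` {..m})" by (simp add: span)
    then have "dist_to nrm x (seq_span (\<phi> ` {..m})) \<le> nrm (x - (x - zero_on A x))"
      by (rule dist_to_le)
    then have "nrm g \<le> nrm (zero_on A g)" using step(4)[OF m] by (simp only: zg) (simp add: g_def)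
    then have "g I = 0" if "I \<in> A" for I
      using nrm_zero_on_less[OF gX A that] by linarith
    then have "g = zero_on A x" using gA by (auto simp: zero_on_def)
    then show ?thesis using Suc by (simp add: g_def A_def lessThan_Suc_atMost)
  qed
  show thesis
  proof (rule that[of i])
    fix k assume k: "k < n"
    then show "\<exists>F. norming_functional X nrm (zero_on (i ` {..<k}) x) F \<and>
      \<tau> * (SUP g\<in>unit_seq ` R. norm (F g)) \<le> norm (F (unit_seq (i k)))"
      using step(2)[OF k] res[of k] i(2)[OF k] by simp
  qed (use res i in auto)
qed

lemma norming_functional_expand:
  fixes f :: "'i \<Rightarrow> 'k::real_normed_field"
  assumes F: "norming_functional X nrm f' F" and f: "f \<in> X" and B: "finite B" "B \<subseteq> R"
  shows "F f = F (zero_on B f) + (\<Sum>I\<in>B. f I * F (unit_seq I))"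
  using B
proof (induction B rule: finite_induct)
  case (insert I B)
  have add: "\<And>x y. x \<in> X \<Longrightarrow> y \<in> X \<Longrightarrow> F (x + y) = F x + F y"
    and scale: "\<And>c x. x \<in> X \<Longrightarrow> F (seq_scale c x) = c * F x"
    using F unfolding norming_functional_def bounded_functional_def by blast+
  have I: "I \<in> R" using insert by simp
  have "seq_scale (f I) (unit_seq I) \<in> X"
    using nrm_scale[OF unit_seq_X[OF I], of "f I"] zero_X
    by (cases "f I = 0") (auto simp: seq_scale_def zero_fun_def)
  moreover have "zero_on B f = zero_on (insert I B) f + seq_scale (f I) (unit_seq I)"
    using insert by (auto simp: zero_on_def seq_scale_def unit_seq_def fun_eq_iff)
  ultimately have "F (zero_on B f) = F (zero_on (insert I B) f) + f I * F (unit_seq I)"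
    using add[OF zero_on_X[OF f]] scale[OF unit_seq_X[OF I]] by simp
  then show ?case using insert by (simp add: add.assoc)
qed simp

text \<open>Splitting \<open>f\<close> along \<open>B\<close> gives nrm f = |F f| \<le> nrm f / 2 +
  \<Lambda> nrm f m, where m is the supremum in question.\<close>

lemma SUP_norming_functional_ge:
  fixes f :: "'i \<Rightarrow> 'k::real_normed_field"
  assumes F: "norming_functional X nrm f F" and f: "f \<in> X" "nrm f > 0" and B: "finite B" "B \<subseteq> R"
    and le: "nrm (zero_on B f) \<le> nrm f / 2"
    and \<Lambda>: "(\<Sum>I\<in>B. norm (f I)) \<le> \<Lambda> * nrm f" "\<Lambda> > 0"
  shows "1 / (2 * \<Lambda>) \<le> (SUP g\<in>unit_seq ` R. norm (F g))"
proof -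
  define m where "m = (SUP g\<in>unit_seq ` R. norm (F g))"
  have upper: "norm (F (unit_seq I)) \<le> m" if "I \<in> R" for I
    unfolding m_def
  proof (rule cSUP_upper)
    show "bdd_above ((\<lambda>g. norm (F g)) ` unit_seq ` R)"
      using norming_functional_le[OF F unit_seq_X]
      by (auto intro!: bdd_aboveI2[of _ _ 1] simp: nrm_unit_seq)
  qed (use that in auto)
  have "nrm f = norm (F f)"
    using F nrm_nonneg[of f] by (simp add: norming_functional_def)
  also have "\<dots> \<le> norm (F (zero_on B f)) + (\<Sum>I\<in>B. norm (f I) * norm (F (unit_seq I)))"
    unfolding norming_functional_expand[OF F f(1) B]
    by (intro norm_triangle_le add_left_mono sum_norm_le) (auto simp: norm_mult)
  also have "\<dots> \<le> nrm f / 2 + (\<Sum>I\<in>B. norm (f I) * m)"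
    using norming_functional_le[OF F zero_on_X[OF f(1), of B]] le upper B
    by (intro add_mono sum_mono mult_left_mono) auto
  finally have "nrm f \<le> nrm f / 2 + (\<Sum>I\<in>B. norm (f I)) * m"
    by (simp only: sum_distrib_right)
  then have *: "nrm f / 2 \<le> (\<Sum>I\<in>B. norm (f I)) * m" by simp
  have "m > 0"
  proof (rule ccontr)
    assume "\<not> m > 0"
    then have "(\<Sum>I\<in>B. norm (f I)) * m \<le> 0" by (intro mult_nonneg_nonpos sum_nonneg) auto
    then show False using * f by simp
  qed
  then have "(\<Sum>I\<in>B. norm (f I)) * m \<le> \<Lambda> * nrm f * m" using \<Lambda> by (intro mult_right_mono) auto
  with * have "nrm f * (1 / 2) \<le> nrm f * (\<Lambda> * m)" by (simp add: mult_ac)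
  then have "1 / 2 \<le> \<Lambda> * m" using f(2) mult_le_cancel_left_pos by blast
  then show ?thesis using \<Lambda> by (simp add: m_def[symmetric] field_simps)
qed

section \<open>Summing \<open>J\<close> over the steps that select outside a given set\<close>

lemma sum_v_le_Z_zero_on:
  fixes x :: "'i \<Rightarrow> 'k::real_normed_field"
  assumes "finite W" "inj_on i W" "i ` W \<subseteq> R - A" "S x t < top"
  shows "(\<Sum>k\<in>W. v x (i k) t) \<le> Z (zero_on A x) t"
proof -
  have "(\<Sum>k\<in>W. v x (i k) t) = (\<Sum>I\<in>i ` W. v (zero_on A x) I t)"
    using assms by (auto simp: sum.reindex v_def intro!: sum.cong)
  also have "\<dots> \<le> Z (zero_on A x) t"
    using assms by (intro sum_v_le_Z S_zero_on_finite) auto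
  finally show ?thesis .
qed

text \<open>Let \<open>V k\<close> be the sum of the selected terms outside \<open>B\<close> from
  step k on. It is at most \<open>Z\<close> of the k-th remainder, and the exponent r - 1 is not
  positive, so \<open>V k\<close> may replace \<open>Z\<close>. Concavity turns each summand into a
  difference of consecutive r-th powers, the sum telescopes, and \<open>V 0\<close> is at most
  \<open>Z (zero_on B x)\<close>.\<close>

lemma sum_J_le_concave:
  fixes x :: "'i \<Rightarrow> 'k::real_normed_field" and n :: nat
  assumes x: "x \<in> X" and i: "\<And>k. k < n \<Longrightarrow> i k \<in> R" "inj_on i {..<n}" and pq: "p \<le> q"
    and W: "W \<subseteq> {..<n}" "i ` W \<subseteq> - B"
  shows "(\<Sum>k\<in>W. J (zero_on (i ` {..<k}) x) (i k)) \<le> q / p * nrm (zero_on B x) powr p"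
proof -
  define r where "r = p / q"
  have r: "0 < r" "r \<le> 1" using r_pos pq q by (auto simp: r_def)
  have fW: "finite W" by (rule finite_subset[OF W(1)]) simp
  define f where "f = (\<lambda>k. zero_on (i ` {..<k}) x)"
  have fX: "f k \<in> X" for k unfolding f_def by (rule zero_on_X[OF x])
  define V where "V = (\<lambda>k t. \<Sum>j\<in>{j \<in> W. k \<le> j}. v x (i j) t)"
  have notin: "i j \<notin> i ` {..<k}" if "j \<in> W" "k \<le> j" for j k
    using inj_onD[OF i(2), of j] that W(1) by force
  have vf: "v (f k) (i k) t = v x (i k) t" if "k \<in> W" for k t
    using notin[OF that] by (simp add: v_def f_def)
  have "(\<Sum>k\<in>W. J (f k) (i k)) = (\<integral>t. (\<Sum>k\<in>W. Z (f k) t powr (r - 1) * v (f k) (i k) t) \<partial>M)"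
    unfolding J_def r_def using W i fX
    by (intro Bochner_Integration.integral_sum[symmetric] integrable_Z_v) auto
  also have "\<dots> \<le> (\<integral>t. (1 / r) * Z (zero_on B x) t powr r \<partial>M)"
  proof (rule integral_mono_AE)
    show "integrable M (\<lambda>t. \<Sum>k\<in>W. Z (f k) t powr (r - 1) * v (f k) (i k) t)"
      unfolding r_def using W i fX by (intro Bochner_Integration.integrable_sum integrable_Z_v) auto
    show "integrable M (\<lambda>t. (1 / r) * Z (zero_on B x) t powr r)"
      unfolding r_def by (intro integrable_mult_right integrable_Z zero_on_X x)
    show "AE t in M. (\<Sum>k\<in>W. Z (f k) t powr (r - 1) * v (f k) (i k) t) \<le> (1 / r) * Z (zero_on B x) t powr r"
      using AE_S_finite[OF x]
    proof eventually_elim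
      case (elim t)
      have Vnn: "V k t \<ge> 0" for k by (auto simp: V_def intro!: sum_nonneg v_nonneg)
      have VS: "V (Suc k) t \<le> V k t" for k
        unfolding V_def using fW by (intro sum_mono2) (auto simp: v_nonneg)
      have V_Suc: "V k t = v x (i k) t + V (Suc k) t" if "k \<in> W" for k
      proof -
        have "{j \<in> W. k \<le> j} = insert k {j \<in> W. Suc k \<le> j}" using that by auto
        then show ?thesis using fW by (simp add: V_def)
      qed
      have VZ: "V k t \<le> Z (f k) t" for k
      proof -
        have "inj_on i {j \<in> W. k \<le> j}" using W(1) by (intro inj_on_subset[OF i(2)]) auto
        then show ?thesis
          unfolding V_def f_def using fW notin W i(1) elim by (intro sum_v_le_Z_zero_on) auto
      qed
      have summand_le: "Z (f k) t powr (r - 1) * v (f k) (i k) t \<le> (1 / r) * (V k t powr r - V (Suc k) t powr r)"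
        if k: "k \<in> W" for k
      proof -
        have "Z (f k) t powr (r - 1) * v x (i k) t \<le> V k t powr (r - 1) * v x (i k) t"
        proof (cases "v x (i k) t = 0")
          case False
          then have "V k t > 0" using V_Suc[OF k] Vnn[of "Suc k"] v_nonneg[of x "i k" t] by linarith
          then show ?thesis using r VZ[of k] v_nonneg by (intro mult_right_mono powr_mono2') auto
        qed simp
        also have "\<dots> = V k t powr (r - 1) * (V k t - V (Suc k) t)" by (simp add: V_Suc[OF k])
        also have "\<dots> \<le> (1 / r) * (V k t powr r - V (Suc k) t powr r)"
          using powr_concave_tangent[OF Vnn VS r, of k] r by (simp add: field_simps)
        finally show ?thesis by (simp add: vf[OF k])
      qed
      have "(\<Sum>k\<in>W. Z (f k) t powr (r - 1) * v (f k) (i k) t)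
          \<le> (\<Sum>k\<in>W. (1 / r) * (V k t powr r - V (Suc k) t powr r))"
        by (rule sum_mono) (rule summand_le)
      \<comment> \<open>\<open>V\<close> is decreasing in k, so the steps outside \<open>W\<close>
        add nonnegative terms and the full sum can telescope.\<close>
      also have "\<dots> \<le> (\<Sum>k<n. (1 / r) * (V k t powr r - V (Suc k) t powr r))"
        using W(1) r VS Vnn by (intro sum_mono2) (auto intro!: divide_nonneg_nonneg powr_mono2)
      also have "\<dots> = (1 / r) * (V 0 t powr r - V n t powr r)"
        by (simp only: sum_distrib_left[symmetric] sum_lessThan_telescope'[of "\<lambda>k. V k t powr r"])
      also have "\<dots> \<le> (1 / r) * Z (zero_on B x) t powr r"
      proof -
        have "V 0 t \<le> Z (zero_on B x) t"
          unfolding V_def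
          using fW W i(1) elim inj_on_subset[OF i(2)] by (intro sum_v_le_Z_zero_on) auto
        then have "V 0 t powr r \<le> Z (zero_on B x) t powr r" using r Vnn by (intro powr_mono2) auto
        moreover have "V n t powr r \<ge> 0" by simp
        ultimately have "V 0 t powr r - V n t powr r \<le> Z (zero_on B x) t powr r" by linarith
        then show ?thesis using r by (intro mult_left_mono) auto
      qed
      finally show ?case .
    qed
  qed
  also have "\<dots> = q / p * nrm (zero_on B x) powr p"
    by (simp add: nrm_powr[OF zero_on_X[OF x]] r_def)
  finally show ?thesis by (simp add: f_def)
qed

text \<open>Now p/q - 1 > 0, so each remainder in the weight may be replaced by the larger one at
  \<open>m\<close>, no later than any step in \<open>W\<close>. Hoelder's inequality separates its
  norm from the sum of the selected terms, which \<open>Z (zero_on B x)\<close> dominates.\<close>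

lemma sum_J_le_convex:
  fixes x :: "'i \<Rightarrow> 'k::real_normed_field" and n :: nat
  assumes x: "x \<in> X" and i: "\<And>k. k < n \<Longrightarrow> i k \<in> R" "inj_on i {..<n}" and pq: "q < p"
    and W: "W \<subseteq> {..<n}" "i ` W \<subseteq> - B" "\<And>k. k \<in> W \<Longrightarrow> m \<le> k"
  shows "(\<Sum>k\<in>W. J (zero_on (i ` {..<k}) x) (i k))
    \<le> nrm (zero_on (i ` {..<m}) x) powr (p - q) * nrm (zero_on B x) powr q"
proof -
  have r: "1 < p / q" using pq q by simp
  have fW: "finite W" by (rule finite_subset[OF W(1)]) simp
  define f where "f = (\<lambda>k. zero_on (i ` {..<k}) x)"
  have fX: "f k \<in> X" for k unfolding f_def by (rule zero_on_X[OF x])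
  define V where "V = (\<lambda>t. \<Sum>j\<in>W. v x (i j) t)"
  have Vnn: "V t \<ge> 0" for t by (auto simp: V_def intro!: sum_nonneg v_nonneg)
  have Vm: "V \<in> borel_measurable M"
    unfolding V_def using W i by (intro borel_measurable_sum v_measurable) auto
  have notin: "i j \<notin> i ` {..<k}" if "j \<in> W" "k \<le> j" for j k
    using inj_onD[OF i(2), of j] that W(1) by force
  have vf: "v (f k) (i k) t = v x (i k) t" if "k \<in> W" for k t
    using notin[OF that] by (simp add: v_def f_def)
  have dis: "i ` W \<subseteq> R - i ` {..<m}"
  proof (rule image_subsetI)
    fix k assume "k \<in> W"
    then show "i k \<in> R - i ` {..<m}" using notin[of k m] W i(1)[of k] by blast
  qed
  have VZ: "AE t in M. V t \<le> Z (f m) t"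
    using AE_S_finite[OF x]
  proof eventually_elim
    case (elim t)
    show ?case
      unfolding V_def f_def
      using fW dis W elim inj_on_subset[OF i(2)] by (intro sum_v_le_Z_zero_on) auto
  qed
  have VB: "AE t in M. V t \<le> Z (zero_on B x) t"
    using AE_S_finite[OF x]
  proof eventually_elim
    case (elim t)
    show ?case
      unfolding V_def
      using fW W i(1) elim inj_on_subset[OF i(2)] by (intro sum_v_le_Z_zero_on) auto
  qed
  have intV: "integrable M (\<lambda>t. V t powr (p / q))"
  proof (rule Bochner_Integration.integrable_bound[OF integrable_Z[OF fX[of m]]])
    show "AE t in M. norm (V t powr (p / q)) \<le> norm (Z (f m) t powr (p / q))"
      using VZ by eventually_elim (use Vnn r in \<open>auto intro!: powr_mono2\<close>)
  qed (use Vm in measurable)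
  have "(\<Sum>k\<in>W. J (f k) (i k)) = (\<integral>t. (\<Sum>k\<in>W. Z (f k) t powr (p / q - 1) * v (f k) (i k) t) \<partial>M)"
    unfolding J_def using W i fX
    by (intro Bochner_Integration.integral_sum[symmetric] integrable_Z_v) auto
  also have "\<dots> \<le> (\<integral>t. Z (f m) t powr (p / q - 1) * V t \<partial>M)"
  proof (rule integral_mono_AE)
    show "integrable M (\<lambda>t. \<Sum>k\<in>W. Z (f k) t powr (p / q - 1) * v (f k) (i k) t)"
      using W i fX by (intro Bochner_Integration.integrable_sum integrable_Z_v) auto
    show "integrable M (\<lambda>t. Z (f m) t powr (p / q - 1) * V t)"
      using VZ Vm Vnn by (intro integrable_Z_times fX) auto
    show "AE t in M. (\<Sum>k\<in>W. Z (f k) t powr (p / q - 1) * v (f k) (i k) t) \<le> Z (f m) t powr (p / q - 1) * V t"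
      using AE_S_finite[OF fX[of m]]
    proof eventually_elim
      case (elim t)
      have "Z (f k) t powr (p / q - 1) * v (f k) (i k) t \<le> Z (f m) t powr (p / q - 1) * v x (i k) t"
        if k: "k \<in> W" for k
        unfolding vf[OF k]
      proof (intro mult_right_mono powr_mono2 Z_mono[OF elim])
        fix I show "norm (f k I) \<le> norm (f m I)"
          using W(3)[OF k] by (auto simp: f_def zero_on_def)
      qed (use r Z_nonneg v_nonneg in auto)
      then show ?case unfolding V_def sum_distrib_left by (rule sum_mono)
    qed
  qed
  also have "\<dots> \<le> nrm (f m) powr (p - q) * (\<integral>t. V t powr (p / q) \<partial>M) powr (q / p)"
    by (rule Holder_Z[OF fX pq Vnn Vm intV])
  also have "\<dots> \<le> nrm (f m) powr (p - q) * (nrm (zero_on B x) powr p) powr (q / p)"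
  proof (intro mult_left_mono powr_mono2)
    show "(\<integral>t. V t powr (p / q) \<partial>M) \<le> nrm (zero_on B x) powr p"
      unfolding nrm_powr[OF zero_on_X[OF x]]
    proof (intro integral_mono_AE intV integrable_Z zero_on_X x)
      show "AE t in M. V t powr (p / q) \<le> Z (zero_on B x) t powr (p / q)"
        using VB by eventually_elim (use Vnn r in \<open>auto intro!: powr_mono2\<close>)
    qed
  qed (use p q in auto)
  also have "(nrm (zero_on B x) powr p) powr (q / p) = nrm (zero_on B x) powr q"
    using p by (simp add: powr_powr)
  finally show ?thesis by (simp add: f_def)
qed

text \<open>
  For \<open>q < p\<close> the steps are grouped according to the size of the remainder up to a factor 2; the
  groups contribute a geometric series.
\<close>

lemma card_outside_le:
  fixes x :: "'i \<Rightarrow> 'k::real_normed_field" and n :: nat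
  assumes x: "x \<in> X" and i: "\<And>k. k < n \<Longrightarrow> i k \<in> R" "inj_on i {..<n}"
    and W: "W \<subseteq> {..<n}" "i ` W \<subseteq> - B"
    and s: "nrm (zero_on B x) \<le> s" "s \<le> D" and D: "0 < D" "D \<le> nrm (zero_on (i ` {..<n}) x)"
    and \<delta>: "0 < \<delta>" "\<And>k. k < n \<Longrightarrow> \<delta> * nrm (zero_on (i ` {..<k}) x) powr p \<le> J (zero_on (i ` {..<k}) x) (i k)"
  shows "real (card W) \<le> (q / p + 2 * 2 powr p) * (s / D) / \<delta>"
proof -
  have fW: "finite W" by (rule finite_subset[OF W(1)]) simp
  define f where "f = (\<lambda>k. zero_on (i ` {..<k}) x)"
  have fX: "f k \<in> X" for k unfolding f_def by (rule zero_on_X[OF x])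
  have mono: "nrm (f k) \<le> nrm (f m)" if "m \<le> k" for m k
    by (rule nrm_dominated[OF fX]) (use that in \<open>auto simp: f_def zero_on_def\<close>)
  have fD: "D \<le> nrm (f k)" if "k \<le> n" for k using mono[OF that] D by (simp add: f_def)
  have s0: "0 \<le> s" using s(1) nrm_nonneg order_trans by blast
  have sD: "0 \<le> s / D" "s / D \<le> 1" using s s0 D by auto
  \<comment> \<open>The two cases produce the powers p and q of s/D \<le> 1; both are replaced by
    the first power.\<close>
  have sD_powr: "(s / D) powr a \<le> s / D" if "a \<ge> 1" for a
    using powr_mono'[of 1 a "s / D"] that sD by simp
  show ?thesis
  proof (cases "p \<le> q")
    case True
    have "real (card W) * (\<delta> * D powr p) = (\<Sum>k\<in>W. \<delta> * D powr p)" by simp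
    also have "\<dots> \<le> (\<Sum>k\<in>W. J (f k) (i k))"
    proof (rule sum_mono)
      fix k assume "k \<in> W"
      then have k: "k < n" using W by auto
      have "\<delta> * D powr p \<le> \<delta> * nrm (f k) powr p"
        using D fD[of k] k \<delta> p by (intro mult_left_mono powr_mono2) auto
      then show "\<delta> * D powr p \<le> J (f k) (i k)" using \<delta>(2)[OF k] by (simp add: f_def)
    qed
    also have "\<dots> \<le> q / p * nrm (zero_on B x) powr p"
      unfolding f_def by (rule sum_J_le_concave[OF x i True W])
    also have "\<dots> \<le> q / p * s powr p"
      using s p q nrm_nonneg by (intro mult_left_mono powr_mono2) auto
    finally have "real (card W) \<le> q / p * s powr p / (\<delta> * D powr p)"
      using D \<delta> by (subst pos_le_divide_eq) auto
    also have "\<dots> = q / p * (s / D) powr p / \<delta>"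
      using D s0 by (simp add: powr_divide)
    finally have "real (card W) \<le> q / p * (s / D) powr p / \<delta>" .
    also have "\<dots> \<le> (q / p + 2 * 2 powr p) * (s / D) / \<delta>"
      using sD_powr[of p] p q \<delta> sD by (intro divide_right_mono mult_mono) auto
    finally show ?thesis .
  next
    case False
    then have pq: "q < p" by simp
    define E where "E = 2 powr p * (s / D) powr q / \<delta>"
    \<comment> \<open>The size class of a remainder: its norm lies between D 2^l and D
      2^(l+1).\<close>
    define l where "l = (\<lambda>k. nat \<lfloor>log 2 (nrm (f k) / D)\<rfloor>)"
    have l: "D * 2 ^ l k \<le> nrm (f k)" "nrm (f k) \<le> D * 2 ^ Suc (l k)" if "k < n" for k
    proof -
      have ge: "1 \<le> nrm (f k) / D" using fD[of k] that D by simp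
      then have fl: "0 \<le> \<lfloor>log 2 (nrm (f k) / D)\<rfloor>" by simp
      have "2 ^ l k = 2 powr real_of_int \<lfloor>log 2 (nrm (f k) / D)\<rfloor>"
        using fl by (simp add: l_def powr_realpow[symmetric])
      also have "\<dots> \<le> 2 powr log 2 (nrm (f k) / D)" by (intro powr_mono) auto
      also have "\<dots> = nrm (f k) / D" using ge by simp
      finally show "D * 2 ^ l k \<le> nrm (f k)" using D by (simp add: field_simps)
      have "nrm (f k) / D = 2 powr log 2 (nrm (f k) / D)" using ge by simp
      also have "\<dots> \<le> 2 powr real (Suc (l k))" using fl by (intro powr_mono) (auto simp: l_def, linarith)
      also have "\<dots> = 2 ^ Suc (l k)" by (rule powr_realpow) simp
      finally show "nrm (f k) \<le> D * 2 ^ Suc (l k)" using D by (simp add: field_simps)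
    qed
    have block: "real (card {k \<in> W. l k = j}) \<le> E * (1 / 2) ^ j" for j
    proof (cases "{k \<in> W. l k = j} = {}")
      case True
      then show ?thesis using \<delta> by (simp only: card.empty) (simp add: E_def)
    next
      case False
      define U where "U = {k \<in> W. l k = j}"
      have U: "finite U" "U \<subseteq> W" "U \<noteq> {}" using fW False by (auto simp: U_def)
      \<comment> \<open>The first step of the group has its largest remainder, of norm at most 2d,
        while all remainders of the group have norm at least d.\<close>
      define m where "m = Min U"
      have m: "m \<in> U" "\<And>k. k \<in> U \<Longrightarrow> m \<le> k" using U by (auto simp: m_def)
      have mn: "m < n" "l m = j" using m(1) U(2) W(1) by (auto simp: U_def)
      define d where "d = D * 2 ^ j"
      have d: "d > 0" using D by (simp add: d_def)
      have "real (card U) * (\<delta> * d powr p) = (\<Sum>k\<in>U. \<delta> * d powr p)" by simp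
      also have "\<dots> \<le> (\<Sum>k\<in>U. J (f k) (i k))"
      proof (rule sum_mono)
        fix k assume kU: "k \<in> U"
        then have k: "k < n" using U W by auto
        have "\<delta> * d powr p \<le> \<delta> * nrm (f k) powr p"
          using d l(1)[OF k] kU \<delta> p by (intro mult_left_mono powr_mono2) (auto simp: d_def U_def)
        then show "\<delta> * d powr p \<le> J (f k) (i k)" using \<delta>(2)[OF k] by (simp add: f_def)
      qed
      also have "\<dots> \<le> nrm (f m) powr (p - q) * nrm (zero_on B x) powr q"
        unfolding f_def using U W m(2) by (intro sum_J_le_convex[OF x i pq]) auto
      also have "\<dots> \<le> (2 * d) powr (p - q) * s powr q"
        using l(2)[OF mn(1)] mn(2) s pq q nrm_nonneg
        by (intro mult_mono powr_mono2) (auto simp: d_def mult_ac)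
      finally have *: "real (card U) * (\<delta> * d powr p) \<le> (2 * d) powr (p - q) * s powr q" .
      have "(2 * d) powr (p - q) * s powr q = 2 powr (p - q) * (s / d) powr q * d powr p"
        using d s0 by (simp add: powr_mult powr_diff powr_divide)
      then have "real (card U) * \<delta> \<le> 2 powr (p - q) * (s / d) powr q"
        using * d by (simp add: mult.assoc[symmetric])
      \<comment> \<open>Replacing D by d = D 2^j gains 2^(-jq), at most 2^(-j) since q > 1; this
        makes the sum over the groups geometric.\<close>
      also have "\<dots> \<le> 2 powr p * ((s / D) powr q * (1 / 2) ^ j)"
      proof (intro mult_mono)
        have "(s / d) powr q = (s / D * (1 / 2) ^ j) powr q" by (simp add: d_def power_one_over)
        also have "\<dots> = (s / D) powr q * ((1 / 2) ^ j) powr q" by (rule powr_mult)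
        also have "((1 / 2) ^ j) powr q \<le> ((1 / 2) ^ j) powr (1::real)"
          using q by (intro powr_mono') (auto simp: power_le_one)
        finally show "(s / d) powr q \<le> (s / D) powr q * (1 / 2) ^ j"
          by (simp add: mult_left_mono)
      qed (use q in auto)
      finally show ?thesis using \<delta> by (simp add: E_def U_def[symmetric] field_simps)
    qed
    have "card W = (\<Sum>j\<in>l ` W. card {k \<in> W. l k = j})"
      using sum.group[OF fW, of "l ` W" l "\<lambda>_. 1::nat"] fW by auto
    then have "real (card W) = (\<Sum>j\<in>l ` W. real (card {k \<in> W. l k = j}))" by simp
    also have "\<dots> \<le> (\<Sum>j\<in>l ` W. E * (1 / 2) ^ j)" by (rule sum_mono) (rule block)
    also have "\<dots> = E * (\<Sum>j\<in>l ` W. (1 / 2) ^ j)" by (simp add: sum_distrib_left)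
    also have "\<dots> \<le> E * 2"
    proof (rule mult_left_mono)
      have "(\<Sum>j\<in>l ` W. (1 / 2 :: real) ^ j) \<le> (\<Sum>j. (1 / 2) ^ j)"
        using fW by (intro sum_le_suminf summable_geometric) auto
      also have "\<dots> = 2" by (subst suminf_geometric) auto
      finally show "(\<Sum>j\<in>l ` W. (1 / 2 :: real) ^ j) \<le> 2" .
    qed (use \<delta> in \<open>simp add: E_def\<close>)
    also have "\<dots> = 2 * 2 powr p * (s / D) powr q / \<delta>" by (simp add: E_def)
    also have "\<dots> \<le> (q / p + 2 * 2 powr p) * (s / D) / \<delta>"
      using sD_powr[of q] p q \<delta> sD by (intro divide_right_mono mult_mono) auto
    finally show ?thesis .
  qed
qed

text \<open>If \<open>a\<close> is supported on \<open>B\<close>, deleting \<open>B\<close> from x -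
  a leaves \<open>zero_on B x\<close>, and deletion does not increase the norm. The strict bound
  \<open>s\<close> takes the place of a minimiser of the infimum.\<close>

lemma sigma_N_less:
  fixes x :: "'i \<Rightarrow> 'k::real_normed_field"
  assumes x: "x \<in> X" and less: "sigma_N nrm (unit_seq ` R) N x < s"
  obtains B where "finite B" "B \<subseteq> R" "card B \<le> N" "nrm (zero_on B x) < s"
proof -
  have "0 \<in> seq_span ({} :: ('i \<Rightarrow> 'k) set)"
    using seq_span_unit_seq[of "{} :: 'i set", where 'k = 'k] by simp
  then have ne: "Sigma_N (unit_seq ` R) N \<noteq> ({} :: ('i \<Rightarrow> 'k) set)"
    unfolding Sigma_N_def by (auto intro!: exI[of _ "{}"])
  have bdd: "bdd_below ((\<lambda>a. nrm (x - a)) ` Sigma_N (unit_seq ` R) N)"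
    by (rule bdd_belowI2[of _ 0]) (rule nrm_nonneg)
  have "\<exists>a\<in>Sigma_N (unit_seq ` R) N. nrm (x - a) < s"
    using less unfolding sigma_N_def dist_to_def cINF_less_iff[OF ne bdd] .
  then obtain a where a: "a \<in> Sigma_N (unit_seq ` R) N" "nrm (x - a) < s" by blast
  obtain T where T: "T \<subseteq> unit_seq ` R" "finite T" "card T \<le> N" "a \<in> seq_span T"
    using a(1) unfolding Sigma_N_def by auto
  obtain B where B: "B \<subseteq> R" "T = unit_seq ` B" using T(1) subset_imageE by metis
  have "finite (unit_seq ` B :: ('i \<Rightarrow> 'k) set)" using T(2) B(2) by simp
  then have fB: "finite B" by (rule finite_imageD) (rule inj_on_subset[OF inj_unit_seq], simp)
  have "card B = card T" unfolding B(2) by (rule card_image[symmetric]) (rule inj_on_subset[OF inj_unit_seq], simp)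
  have a0: "a I = 0" if "I \<notin> B" for I using T(4) that by (simp add: B(2) seq_span_unit_seq[OF fB])
  have "x - a \<in> X" by (rule finite_change_X[OF fB B(1) x]) (simp add: a0)
  then have "nrm (zero_on B x) \<le> nrm (x - a)"
    by (rule nrm_dominated) (auto simp: zero_on_def a0)
  then show thesis using that[OF fB B(1)] a(2) T(3) \<open>card B = card T\<close> by simp
qed

lemma sigma_N_nonneg:
  fixes x :: "'i \<Rightarrow> 'k::real_normed_field"
  shows "sigma_N nrm (unit_seq ` R) N x \<ge> 0"
proof -
  have "0 \<in> seq_span ({} :: ('i \<Rightarrow> 'k) set)"
    using seq_span_unit_seq[of "{} :: 'i set", where 'k = 'k] by simp
  then have "Sigma_N (unit_seq ` R) N \<noteq> ({} :: ('i \<Rightarrow> 'k) set)"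
    unfolding Sigma_N_def by (auto intro!: exI[of _ "{}"])
  then show ?thesis
    unfolding sigma_N_def dist_to_def by (intro cINF_greatest) (auto simp: nrm_nonneg)
qed

text \<open>If the error after n steps exceeded C times the best error, these steps would select n
  distinct coordinates: at most N \<le> \<psi> from an almost optimal set \<open>B\<close>, and
  fewer than \<psi> others, against n \<ge> 2\<psi>. As \<Lambda> is tied to \<psi> through
  \<open>H\<close> only, C does not depend on N.\<close>

lemma wcga_bound:
  assumes \<tau>: "0 < \<tau>" and H: "0 \<le> H"
  defines "s' \<equiv> if p \<le> q then conj_exp p else conj_exp q"
  obtains C where "C > 0" and "\<And>N \<Lambda> \<psi> n (x :: 'i \<Rightarrow> 'k::real_normed_field) G.
     0 < \<Lambda> \<Longrightarrow> \<Lambda> powr s' \<le> H * \<psi> \<Longrightarrow> 0 < \<psi> \<Longrightarrow> real N \<le> \<psi> \<Longrightarrow> 2 * \<psi> \<le> real n \<Longrightarrow>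
     (\<And>B (y :: 'i \<Rightarrow> 'k). finite B \<Longrightarrow> B \<subseteq> R \<Longrightarrow> card B \<le> N \<Longrightarrow> y \<in> X \<Longrightarrow>
        (\<Sum>I\<in>B. norm (y I)) \<le> \<Lambda> * nrm y) \<Longrightarrow>
     x \<in> X \<Longrightarrow> wcga_run X nrm (unit_seq ` R) \<tau> x G \<Longrightarrow>
        nrm (x - G n) \<le> C * sigma_N nrm (unit_seq ` R) N x"
proof -
  \<comment> \<open>The number of selections outside \<open>B\<close> will be at most (T/C) \<psi>,
    so C > T keeps it below \<psi>.\<close>
  define T where "T = (q / p + 2 * 2 powr p) * ((2 * K / \<tau>) powr s' * H)"
  have T: "T \<ge> 0" using p q H by (auto simp: T_def)
  define C where "C = 2 + T"
  have C: "C \<ge> 2" "C > T" "C > 0" using T by (auto simp: C_def)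
  show thesis
  proof (rule that[of C])
    fix N n :: nat and \<Lambda> \<psi> :: real and x :: "'i \<Rightarrow> 'k" and G
    assume \<Lambda>: "0 < \<Lambda>" "\<Lambda> powr s' \<le> H * \<psi>" and \<psi>: "0 < \<psi>" "real N \<le> \<psi>" "2 * \<psi> \<le> real n"
      and \<Lambda>_bound: "\<And>B (y :: 'i \<Rightarrow> 'k). finite B \<Longrightarrow> B \<subseteq> R \<Longrightarrow> card B \<le> N \<Longrightarrow> y \<in> X \<Longrightarrow>
        (\<Sum>I\<in>B. norm (y I)) \<le> \<Lambda> * nrm y"
      and x: "x \<in> X" and run: "wcga_run X nrm (unit_seq ` R) \<tau> x G"
    show "nrm (x - G n) \<le> C * sigma_N nrm (unit_seq ` R) N x"
    proof (rule ccontr)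
      assume "\<not> ?thesis"
      then have less: "C * sigma_N nrm (unit_seq ` R) N x < nrm (x - G n)" by simp
      define D where "D = nrm (x - G n)"
      define s where "s = D / C"
      have "0 \<le> C * sigma_N nrm (unit_seq ` R) N x"
        using C by (intro mult_nonneg_nonneg sigma_N_nonneg) auto
      then have D: "D > 0" using less by (simp add: D_def)
      have "sigma_N nrm (unit_seq ` R) N x < s"
        using less C by (simp add: s_def D_def field_simps)
      then obtain B where B: "finite B" "B \<subseteq> R" "card B \<le> N" "nrm (zero_on B x) < s"
        using sigma_N_less[OF x] by blast
      obtain i where i: "\<And>k. k \<le> n \<Longrightarrow> x - G k = zero_on (i ` {..<k}) x"
        "\<And>k. k < n \<Longrightarrow> i k \<in> R"
        "\<And>k. k < n \<Longrightarrow> \<exists>F. norming_functional X nrm (zero_on (i ` {..<k}) x) F \<and>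
           \<tau> * (SUP g\<in>unit_seq ` R. norm (F g)) \<le> norm (F (unit_seq (i k)))"
        using wcga_run_zero_on[OF x run] D by (auto simp: D_def)
      define f where "f = (\<lambda>k. zero_on (i ` {..<k}) x)"
      have fX: "f k \<in> X" for k unfolding f_def by (rule zero_on_X[OF x])
      have fD: "D \<le> nrm (f k)" if "k \<le> n" for k
      proof -
        have "nrm (f n) \<le> nrm (f k)"
          by (rule nrm_dominated[OF fX]) (use that in \<open>auto simp: f_def zero_on_def\<close>)
        then show ?thesis using i(1)[of n] by (simp add: D_def f_def)
      qed
      define \<mu> where "\<mu> = \<tau> / (2 * \<Lambda>)"
      have \<mu>: "\<mu> > 0" using \<tau> \<Lambda> by (simp add: \<mu>_def)
      have F: "\<exists>F. norming_functional X nrm (f k) F \<and> \<mu> \<le> norm (F (unit_seq (i k)))" if k: "k < n" for k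
      proof -
        obtain F where F: "norming_functional X nrm (f k) F"
          "\<tau> * (SUP g\<in>unit_seq ` R. norm (F g)) \<le> norm (F (unit_seq (i k)))"
          using i(3)[OF k] by (auto simp: f_def)
        have "1 / (2 * \<Lambda>) \<le> (SUP g\<in>unit_seq ` R. norm (F g))"
        proof (rule SUP_norming_functional_ge[OF F(1) fX _ B(1,2) _ _ \<Lambda>(1)])
          show "nrm (f k) > 0" using fD[of k] D k by simp
          show "(\<Sum>I\<in>B. norm (f k I)) \<le> \<Lambda> * nrm (f k)" using \<Lambda>_bound B fX by blast
          have "nrm (zero_on B (f k)) \<le> nrm (zero_on B x)"
            by (rule nrm_dominated[OF zero_on_X[OF x]]) (auto simp: f_def zero_on_def)
          also have "\<dots> \<le> D / C" using B by (simp add: s_def)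
          \<comment> \<open>C \<ge> 2 ensures that the part of each remainder off \<open>B\<close>
            has at most half its norm.\<close>
          also have "\<dots> \<le> D / 2" using C D by (intro divide_left_mono) auto
          also have "\<dots> \<le> nrm (f k) / 2" using fD[of k] k by simp
          finally show "nrm (zero_on B (f k)) \<le> nrm (f k) / 2" .
        qed
        then have "\<tau> * (1 / (2 * \<Lambda>)) \<le> \<tau> * (SUP g\<in>unit_seq ` R. norm (F g))"
          using \<tau> by (intro mult_left_mono) auto
        then show ?thesis using F by (intro exI[of _ F]) (simp add: \<mu>_def)
      qed
      \<comment> \<open>The functional vanishes at deleted coordinates, but has size at least \<mu>
        > 0 at the selected one.\<close>
      have notin: "i k \<notin> i ` {..<k}" if k: "k < n" for k
      proof
        assume "i k \<in> i ` {..<k}"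
        then have "f k (i k) = 0" by (simp add: f_def)
        moreover obtain F where "norming_functional X nrm (f k) F" "\<mu> \<le> norm (F (unit_seq (i k)))"
          using F[OF k] by blast
        ultimately show False
          using norming_functional_zero[OF _ fX _ i(2)[OF k], of k F] fD[of k] D k \<mu> by simp
      qed
      have inj: "inj_on i {..<n}"
      proof (rule linorder_inj_onI)
        fix a b assume "a < b" "b \<in> {..<n}"
        then have "i a \<in> i ` {..<b}" "b < n" by auto
        then show "i a \<noteq> i b" using notin[of b] by metis
      qed auto
      define \<delta> where "\<delta> = (\<mu> / K) powr s'"
      have \<delta>: "\<delta> > 0" using \<mu> K_pos by (simp add: \<delta>_def)
      have J: "\<delta> * nrm (f k) powr p \<le> J (f k) (i k)" if k: "k < n" for k
        using F[OF k] J_ge[OF _ fX _ i(2)[OF k] \<mu>, of k] fD[of k] D k by (auto simp: \<delta>_def s'_def)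
      define W where "W = {k. k < n \<and> i k \<notin> B}"
      have cardW: "real (card W) \<le> (q / p + 2 * 2 powr p) * (s / D) / \<delta>"
      proof (rule card_outside_le[OF x i(2) inj _ _ _ _ D _ \<delta>])
        show "nrm (zero_on B x) \<le> s" using B by simp
        have "D / C \<le> D / 1" using C D by (intro divide_left_mono) auto
        then show "s \<le> D" by (simp add: s_def)
        show "D \<le> nrm (zero_on (i ` {..<n}) x)" using fD[of n] by (simp add: f_def)
      qed (use J in \<open>auto simp: W_def f_def\<close>)
      have "1 / \<delta> = (2 * K / \<tau>) powr s' * \<Lambda> powr s'"
      proof -
        have "1 / \<delta> = (K / \<mu>) powr s'" using \<mu> K_pos by (simp add: \<delta>_def powr_divide)
        also have "K / \<mu> = 2 * K / \<tau> * \<Lambda>" using \<Lambda> \<tau> by (simp add: \<mu>_def field_simps)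
        also have "(2 * K / \<tau> * \<Lambda>) powr s' = (2 * K / \<tau>) powr s' * \<Lambda> powr s'" by (rule powr_mult)
        finally show ?thesis .
      qed
      also have "\<dots> \<le> (2 * K / \<tau>) powr s' * (H * \<psi>)" using \<Lambda> by (intro mult_left_mono) auto
      finally have inv\<delta>: "1 / \<delta> \<le> (2 * K / \<tau>) powr s' * (H * \<psi>)" .
      have "real (card W) \<le> (q / p + 2 * 2 powr p) / C * (1 / \<delta>)"
        using cardW D by (simp add: s_def)
      also have "\<dots> \<le> (q / p + 2 * 2 powr p) / C * ((2 * K / \<tau>) powr s' * (H * \<psi>))"
        using inv\<delta> p q C by (intro mult_left_mono) auto
      also have "\<dots> = T / C * \<psi>" by (simp add: T_def)
      also have "\<dots> < 1 * \<psi>" using C \<psi> by (intro mult_strict_right_mono) auto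
      finally have W: "real (card W) < \<psi>" by simp
      have "card {k. k < n \<and> i k \<in> B} \<le> card B"
        by (rule card_inj_on_le[of i]) (auto intro: inj_on_subset[OF inj] B(1))
      then have "real (card {k. k < n \<and> i k \<in> B}) \<le> \<psi>" using B \<psi> by linarith
      moreover have "{..<n} = W \<union> {k. k < n \<and> i k \<in> B}" by (auto simp: W_def)
      then have "n = card (W \<union> {k. k < n \<and> i k \<in> B})" by (metis card_lessThan)
      then have "n = card W + card {k. k < n \<and> i k \<in> B}"
        by (subst (asm) card_Un_disjoint) (auto simp: W_def)
      ultimately show False using W \<psi> by linarith
    qed
  qed (use C in auto)
qed

subsection \<open>Comparison with the sum of the coefficients\<close>

text \<open>Since p/q \<ge> 1, superadditivity of the power gives the pointwise bound by
  \<open>Z\<close>, and each normalised weight integrates to 1.\<close>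

lemma sum_norm_powr_le:
  fixes y :: "'i \<Rightarrow> 'k::real_normed_field"
  assumes y: "y \<in> X" and B: "finite B" "B \<subseteq> R" and pq: "q \<le> p"
  shows "(\<Sum>I\<in>B. norm (y I) powr p) \<le> nrm y powr p"
proof -
  have r: "1 \<le> p / q" using pq q by simp
  have "(\<Sum>I\<in>B. norm (y I) powr p) = (\<Sum>I\<in>B. \<integral>t. v y I t powr (p / q) \<partial>M)"
    using B by (intro sum.cong) (auto simp: integral_v)
  also have "\<dots> = (\<integral>t. (\<Sum>I\<in>B. v y I t powr (p / q)) \<partial>M)"
    using B by (intro Bochner_Integration.integral_sum[symmetric] integrable_v) auto
  also have "\<dots> \<le> (\<integral>t. Z y t powr (p / q) \<partial>M)"
  proof (rule integral_mono_AE)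
    show "integrable M (\<lambda>t. \<Sum>I\<in>B. v y I t powr (p / q))"
      using B by (intro Bochner_Integration.integrable_sum integrable_v) auto
    show "AE t in M. (\<Sum>I\<in>B. v y I t powr (p / q)) \<le> Z y t powr (p / q)"
      using AE_S_finite[OF y]
    proof eventually_elim
      case (elim t)
      have "(\<Sum>I\<in>B. v y I t powr (p / q)) \<le> (\<Sum>I\<in>B. v y I t) powr (p / q)"
        using B r v_nonneg by (intro sum_powr_le_powr_sum) auto
      also have "\<dots> \<le> Z y t powr (p / q)"
        using sum_v_le_Z[OF B elim] r by (intro powr_mono2) (auto intro: sum_nonneg v_nonneg)
      finally show ?case .
    qed
  qed (rule integrable_Z[OF y])
  finally show ?thesis by (simp add: nrm_powr[OF y])
qed

lemma sum_norm_le: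
  fixes y :: "'i \<Rightarrow> 'k::real_normed_field"
  assumes y: "y \<in> X" and B: "finite B" "B \<subseteq> R" and pq: "q \<le> p"
  shows "(\<Sum>I\<in>B. norm (y I)) \<le> real (card B) powr (1 / conj_exp p) * nrm y"
proof -
  have "(\<Sum>I\<in>B. norm (y I) * 1) \<le> (\<Sum>I\<in>B. norm (y I) powr p) powr (1 / p) * (\<Sum>I\<in>B. 1 powr conj_exp p) powr (1 / conj_exp p)"
    using B p by (intro Holder_sum) (auto simp: conj_exp_def field_simps)
  also have "\<dots> \<le> (nrm y powr p) powr (1 / p) * real (card B) powr (1 / conj_exp p)"
    using sum_norm_powr_le[OF assms] p by (intro mult_mono powr_mono2) (auto intro: sum_nonneg simp: conj_exp_def)
  also have "(nrm y powr p) powr (1 / p) = nrm y"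
    using p nrm_nonneg[of y] by (simp add: powr_powr)
  finally show ?thesis by (simp add: mult.commute)
qed

text \<open>
  Duality: with \<open>\<omega> I = w I powr (p/q)\<close>, whose integral is 1, \<open>y I\<close> equals the integral of
  \<open>y I * \<omega> I powr (1/p)\<close> times \<open>\<omega> I powr (1/p')\<close>.
\<close>

lemma sum_norm_le_dual:
  fixes y :: "'i \<Rightarrow> 'k::real_normed_field"
  assumes y: "y \<in> X" and B: "finite B" "B \<subseteq> R" and \<Theta>: "\<Theta> \<ge> 0"
    and le: "(\<integral>\<^sup>+t. ennreal ((\<Sum>I\<in>B. (w I t powr (p / q)) powr (conj_exp q / conj_exp p)) powr (conj_exp p / conj_exp q)) \<partial>M)
      \<le> ennreal \<Theta>"
  shows "(\<Sum>I\<in>B. norm (y I)) \<le> \<Theta> powr (1 / conj_exp p) * nrm y"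
proof -
  define p' where "p' = conj_exp p"
  define q' where "q' = conj_exp q"
  have p': "p' > 1" "1 / p + 1 / p' = 1" and q': "q' > 1" "1 / q + 1 / q' = 1"
    using p q by (auto simp: p'_def q'_def conj_exp_def field_simps)
  define \<omega> where "\<omega> = (\<lambda>I t. w I t powr (p / q))"
  have \<omega>_m [measurable]: "I \<in> B \<Longrightarrow> \<omega> I \<in> borel_measurable M" for I
    using B unfolding \<omega>_def by (intro powr_real_measurable w_measurable borel_measurable_const) auto
  \<comment> \<open>\<open>f\<close> is the square function of the part of \<open>y\<close> in
    \<open>B\<close>, and \<open>g\<close> its dual counterpart. Hoelder's inequality is applied to
    the sums over \<open>B\<close> at each point, then to the integrals.\<close>
  define f where "f = (\<lambda>t. (\<Sum>I\<in>B. v y I t) powr (1 / q))"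
  define g where "g = (\<lambda>t. (\<Sum>I\<in>B. \<omega> I t powr (q' / p')) powr (1 / q'))"
  have fm [measurable]: "f \<in> borel_measurable M" and gm [measurable]: "g \<in> borel_measurable M"
    unfolding f_def g_def using B by (auto intro!: powr_real_measurable borel_measurable_sum v_measurable \<omega>_m)
  have f_powr: "f t powr p = (\<Sum>I\<in>B. v y I t) powr (p / q)" for t
    by (simp add: f_def powr_powr)
  have g_powr: "g t powr p' = (\<Sum>I\<in>B. \<omega> I t powr (q' / p')) powr (p' / q')" for t
    by (simp add: g_def powr_powr)
  have f_le: "AE t in M. f t powr p \<le> Z y t powr (p / q)"
    using AE_S_finite[OF y]
  proof eventually_elim
    case (elim t)
    show ?case
      unfolding f_powr using sum_v_le_Z[OF B elim] r_pos
      by (intro powr_mono2) (auto intro: sum_nonneg v_nonneg)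
  qed
  have f_int: "integrable M (\<lambda>t. f t powr p)"
  proof (rule Bochner_Integration.integrable_bound[OF integrable_Z[OF y]])
    show "AE t in M. norm (f t powr p) \<le> norm (Z y t powr (p / q))"
      using f_le by eventually_elim simp
  qed measurable
  have g_le: "(\<integral>\<^sup>+t. ennreal (g t powr p') \<partial>M) \<le> ennreal \<Theta>"
    using le unfolding g_powr unfolding \<omega>_def p'_def q'_def .
  then have g_int: "integrable M (\<lambda>t. g t powr p')"
    by (intro integrableI_nonneg) (auto intro: le_less_trans)
  have "ennreal (\<integral>t. g t powr p' \<partial>M) \<le> ennreal \<Theta>"
    using g_le nn_integral_eq_integral[OF g_int] by simp
  then have g_bound: "(\<integral>t. g t powr p' \<partial>M) \<le> \<Theta>" using \<Theta> by (simp add: ennreal_le_iff)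
  have "(\<Sum>I\<in>B. norm (y I)) = (\<Sum>I\<in>B. \<integral>t. norm (y I) * \<omega> I t \<partial>M)"
    using B by (intro sum.cong) (auto simp: \<omega>_def integral_w)
  also have "\<dots> = (\<integral>t. (\<Sum>I\<in>B. norm (y I) * \<omega> I t) \<partial>M)"
    unfolding \<omega>_def using B
    by (intro Bochner_Integration.integral_sum[symmetric] integrable_mult_right integrable_w) auto
  also have "\<dots> \<le> (\<integral>t. f t * g t \<partial>M)"
  proof (rule integral_mono)
    show "integrable M (\<lambda>t. \<Sum>I\<in>B. norm (y I) * \<omega> I t)"
      unfolding \<omega>_def using B
      by (intro Bochner_Integration.integrable_sum integrable_mult_right integrable_w) auto
    show "integrable M (\<lambda>t. f t * g t)"
      by (rule Holder_integral(1)[OF p p' fm gm _ _ f_int g_int]) (auto simp: f_def g_def)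
    fix t
    have "(\<Sum>I\<in>B. norm (y I) * \<omega> I t) = (\<Sum>I\<in>B. (norm (y I) * w I t powr (1 / q)) * \<omega> I t powr (1 / p'))"
    proof (rule sum.cong)
      fix I
      have "\<omega> I t = \<omega> I t powr (1 / p + 1 / p')" unfolding p' using w_nonneg by (simp add: \<omega>_def)
      also have "\<dots> = w I t powr (1 / q) * \<omega> I t powr (1 / p')"
        using p by (simp only: powr_add) (simp add: \<omega>_def powr_powr)
      finally show "norm (y I) * \<omega> I t = (norm (y I) * w I t powr (1 / q)) * \<omega> I t powr (1 / p')" by simp
    qed simp
    also have "\<dots> \<le> (\<Sum>I\<in>B. (norm (y I) * w I t powr (1 / q)) powr q) powr (1 / q)
        * (\<Sum>I\<in>B. (\<omega> I t powr (1 / p')) powr q') powr (1 / q')"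
      using B q q' by (intro Holder_sum) auto
    also have "\<dots> = f t * g t"
      using q w_nonneg by (simp add: f_def g_def v_def powr_mult powr_powr)
    finally show "(\<Sum>I\<in>B. norm (y I) * \<omega> I t) \<le> f t * g t" .
  qed
  also have "\<dots> \<le> (\<integral>t. f t powr p \<partial>M) powr (1 / p) * (\<integral>t. g t powr p' \<partial>M) powr (1 / p')"
    by (rule Holder_integral(2)[OF p p' fm gm _ _ f_int g_int]) (auto simp: f_def g_def)
  also have "\<dots> \<le> (nrm y powr p) powr (1 / p) * \<Theta> powr (1 / p')"
  proof (intro mult_mono powr_mono2)
    show "(\<integral>t. f t powr p \<partial>M) \<le> nrm y powr p"
      unfolding nrm_powr[OF y] by (rule integral_mono_AE[OF f_int integrable_Z[OF y] f_le])
  qed (use p p' g_bound in auto)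
  also have "(nrm y powr p) powr (1 / p) = nrm y"
    using p nrm_nonneg[of y] by (simp add: powr_powr)
  finally show ?thesis by (simp add: mult.commute p'_def)
qed

end

section \<open>Dyadic rectangles\<close>

definition rect :: "nat \<Rightarrow> (nat \<Rightarrow> nat \<times> nat) \<Rightarrow> point set" where
  "rect d b = PiE {..<d} (\<lambda>i. dyadic (b i))"

lemma dyadic_rectsE:
  assumes "I \<in> dyadic_rects d"
  obtains b where "I = rect d b" "\<And>i. i < d \<Longrightarrow> snd (b i) < 2 ^ fst (b i)"
proof -
  obtain j k where "I = PiE {..<d} (\<lambda>i. dyadic_interval (j i) (k i))" "\<forall>i<d. k i < 2 ^ j i"
    using assms by (auto simp: dyadic_rects_def)
  then show thesis using that[of "\<lambda>i. (j i, k i)"] by (auto simp: rect_def dyadic_def)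
qed

lemma rect_restrict: "rect d (restrict b {..<d}) = rect d b"
  by (auto simp: rect_def intro!: PiE_cong)

lemma countable_dyadic_rects: "countable (dyadic_rects d)"
proof (rule countable_subset)
  show "dyadic_rects d \<subseteq> rect d ` (PiE {..<d} (\<lambda>_. UNIV))"
  proof
    fix I assume "I \<in> dyadic_rects d"
    then obtain b where "I = rect d b" by (rule dyadic_rectsE)
    then have "I = rect d (restrict b {..<d})" by (simp add: rect_restrict)
    moreover have "restrict b {..<d} \<in> PiE {..<d} (\<lambda>_. UNIV)" by simp
    ultimately show "I \<in> rect d ` (PiE {..<d} (\<lambda>_. UNIV))" by (rule image_eqI)
  qed
  show "countable (rect d ` (PiE {..<d} (\<lambda>_. UNIV)))"
    by (intro countable_image countable_PiE) auto
qed

lemma rect_subset_unit_cube: "I \<in> dyadic_rects d \<Longrightarrow> I \<subseteq> unit_cube d"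
proof -
  assume "I \<in> dyadic_rects d"
  then obtain b where b: "I = rect d b" "\<And>i. i < d \<Longrightarrow> snd (b i) < 2 ^ fst (b i)"
    by (rule dyadic_rectsE) (rule that)
  have "dyadic (b i) \<subseteq> {0..1}" if "i < d" for i
  proof
    fix y assume "y \<in> dyadic (b i)"
    then have y: "real (snd (b i)) / 2 ^ fst (b i) \<le> y" "y < (real (snd (b i)) + 1) / 2 ^ fst (b i)"
      by (auto simp: dyadic_def dyadic_interval_def)
    have "Suc (snd (b i)) \<le> 2 ^ fst (b i)" using b(2)[OF that] by simp
    then have "real (Suc (snd (b i))) \<le> real (2 ^ fst (b i))" by (simp only: of_nat_le_iff)
    then have le1: "(real (snd (b i)) + 1) / 2 ^ fst (b i) \<le> 1" by simp
    have "0 \<le> real (snd (b i)) / 2 ^ fst (b i)" by simp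
    then have "0 \<le> y" using y(1) by (rule order_trans)
    moreover have "y \<le> 1" using less_imp_le[OF y(2)] le1 by (rule order_trans)
    ultimately show "y \<in> {0..1}" by simp
  qed
  then show ?thesis unfolding b(1) rect_def unit_cube_def by (intro PiE_mono) auto
qed

lemma rect_measurable: "rect d b \<in> sets (volume d)"
  unfolding rect_def volume_def by (intro sets_PiM_I_finite) auto

lemma measure_rect: "measure (volume d) (rect d b) = (\<Prod>i<d. 1 / 2 ^ fst (b i))"
proof -
  interpret product_sigma_finite "\<lambda>_. lborel :: real measure" by standard
  have "emeasure (volume d) (rect d b) = (\<Prod>i<d. ennreal (1 / 2 ^ fst (b i)))"
    unfolding volume_def rect_def by (subst emeasure_PiM) (auto simp: emeasure_dyadic)
  also have "\<dots> = ennreal (\<Prod>i<d. 1 / 2 ^ fst (b i))" by (intro prod_ennreal) auto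
  finally show ?thesis by (simp add: measure_def prod_nonneg)
qed

text \<open>The bridge from weights of rectangles to the product form in which
  \<open>overlap\<close> is written.\<close>

lemma rect_weight:
  assumes "t \<in> space (volume d)"
  shows "measure (volume d) (rect d b) powr (- a) * indicator (rect d b) t =
    (\<Prod>i<d. 2 powr (a * real (fst (b i))) * indicator (dyadic (b i)) (t i))"
proof -
  have "measure (volume d) (rect d b) powr (- a) = (\<Prod>i<d. (1 / 2 ^ fst (b i)) powr (- a))"
    unfolding measure_rect by (rule prod_powr_distrib)
  also have "\<dots> = (\<Prod>i<d. 2 powr (a * real (fst (b i))))"
  proof (rule prod.cong)
    fix i
    have "(1 / 2 ^ fst (b i) :: real) = 2 powr (- real (fst (b i)))"
      by (simp add: powr_minus powr_realpow divide_inverse)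
    then show "(1 / 2 ^ fst (b i)) powr (- a) = 2 powr (a * real (fst (b i)))"
      by (simp add: powr_powr mult.commute)
  qed simp
  moreover have "indicator (rect d b) t = (\<Prod>i<d. indicator (dyadic (b i)) (t i) :: real)"
  proof (cases "t \<in> rect d b")
    case False
    then obtain i where "i < d" "t i \<notin> dyadic (b i)"
      using assms by (auto simp: rect_def volume_def space_PiM PiE_iff)
    then have "(\<Prod>i<d. indicator (dyadic (b i)) (t i) :: real) = 0"
      by (intro prod_zero bexI[of _ i]) auto
    then show ?thesis using False by simp
  qed (auto simp: rect_def PiE_iff intro!: prod.neutral[symmetric])
  ultimately show ?thesis by (simp add: prod.distrib)
qed

text \<open>The q-th power of the indicator normalised in L^p, as \<open>mixed_norm_space\<close>
  expects it.\<close>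

definition weight :: "real \<Rightarrow> real \<Rightarrow> nat \<Rightarrow> point set \<Rightarrow> point \<Rightarrow> real" where
  "weight p q d I t = measure (volume d) I powr (- (q / p)) * indicator I t"

lemma weight_powr:
  assumes "p > 0" "q > 0"
  shows "weight p q d I t powr s = measure (volume d) I powr (- (q / p * s)) * indicator I t"
  by (auto simp: weight_def powr_powr split: split_indicator)

lemma mixed_norm_space_dyadic:
  assumes "1 < p" "1 < q"
  shows "mixed_norm_space (volume d) (dyadic_rects d) (weight p q d) p q"
proof
  show "countable (dyadic_rects d)" by (rule countable_dyadic_rects)
  fix I assume I: "I \<in> dyadic_rects d"
  then obtain b where b: "I = rect d b" by (rule dyadic_rectsE)
  show "weight p q d I \<in> borel_measurable (volume d)"
    unfolding weight_def b using rect_measurable by measurable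
  have "(\<integral>\<^sup>+t. ennreal (weight p q d I t powr (p / q)) \<partial>volume d)
      = (\<integral>\<^sup>+t. ennreal (\<Prod>i<d. 2 powr real (fst (b i)) * indicator (dyadic (b i)) (t i)) \<partial>volume d)"
  proof (rule nn_integral_cong)
    fix t assume "t \<in> space (volume d)"
    then show "ennreal (weight p q d I t powr (p / q))
        = ennreal (\<Prod>i<d. 2 powr real (fst (b i)) * indicator (dyadic (b i)) (t i))"
      using assms rect_weight[of t d b 1] by (simp add: weight_powr b)
  qed
  then show "(\<integral>\<^sup>+t. ennreal (weight p q d I t powr (p / q)) \<partial>volume d) = 1"
    by (simp add: nn_integral_normalized_rect)
qed (use assms in \<open>auto simp: weight_def\<close>)

section \<open>Identifying the concrete sequence space with the abstract one\<close>

lemma ennreal_pow_pow: "ennreal_pow (ennreal_pow a r) s = ennreal_pow a (r * s)"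
  by (auto simp: ennreal_pow_def powr_powr)

context
  fixes p q :: real and d :: nat
  assumes p: "1 < p" and q: "1 < q"
begin

interpretation mixed_norm_space "volume d" "dyadic_rects d" "weight p q d" p q
  by (rule mixed_norm_space_dyadic[OF p q])

text \<open>All rectangles lie in the unit cube, so \<open>S\<close> vanishes outside it and the
  integral over the cube is the integral over the whole space.\<close>

lemma f_ennnorm_eq: "f_ennnorm p q d x = ennreal_pow (energy x) (1 / p)"
proof -
  have v: "(norm (x I) * normalized_indicator d p I t) powr q = v x I t" for I t
    using p q by (auto simp: v_def weight_def normalized_indicator_def powr_mult powr_powr split: split_indicator)
  have "ennreal_pow (square_function p q d x t) p * indicator (unit_cube d) t = ennreal_pow (S x t) (p / q)" for t
  proof (cases "t \<in> unit_cube d")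
    case True
    then show ?thesis by (simp add: square_function_def v S_def ennreal_pow_pow)
  next
    case False
    then have "v x I t = 0" if "I \<in> dyadic_rects d" for I
      using rect_subset_unit_cube[OF that] by (auto simp: v_def weight_def split: split_indicator)
    then have "S x t = (\<Sum>\<^sub>\<infinity>I\<in>dyadic_rects d. 0)"
      unfolding S_def by (intro infsum_cong) simp
    then show ?thesis using False by (simp add: ennreal_pow_def)
  qed
  then show ?thesis by (simp add: f_ennnorm_def energy_def)
qed

lemma f_space_eq: "f_space p q d = X"
  using p by (auto simp: f_space_def X_def f_ennnorm_eq ennreal_pow_def less_top split: if_splits)

lemma f_norm_eq: "f_norm p q d = nrm"
  using p by (auto simp: f_norm_def nrm_def f_ennnorm_eq ennreal_pow_def fun_eq_iff)

text \<open>The p/q-th powers of the weights are |I|^-1 times indicators. With \<open>\<rho>\<close>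
  = p'/q' \<ge> 1 the integral in \<open>sum_norm_le_dual\<close> is therefore that of
  \<open>overlap (1 / \<rho>)\<close> to the power \<open>\<rho>\<close>.\<close>

lemma dyadic_sum_norm_le:
  assumes d: "d \<ge> 1" and pq: "p \<le> q"
  obtains C where "C > 0" and "\<And>N B (y :: point set \<Rightarrow> 'k::real_normed_field).
    N \<ge> 1 \<Longrightarrow> finite B \<Longrightarrow> B \<subseteq> dyadic_rects d \<Longrightarrow> card B \<le> N \<Longrightarrow> y \<in> X \<Longrightarrow> (\<Sum>I\<in>B. norm (y I)) \<le>
      (C * (1 + ln (real N)) powr (conj_exp p * h_exp p q d) * real N) powr (1 / conj_exp p) * nrm y"
proof -
  define \<rho> where "\<rho> = conj_exp p / conj_exp q"
  have \<rho>: "\<rho> \<ge> 1" "conj_exp q / conj_exp p = 1 / \<rho>"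
    using p q pq by (auto simp: \<rho>_def conj_exp_def field_simps)
  define n where "n = d - 1"
  have n: "d = Suc n" using d by (simp add: n_def)
  \<comment> \<open>The power of the logarithm comes out right because p'/q' - 1 = p'(1/p -
    1/q).\<close>
  have h: "real n * (\<rho> - 1) = conj_exp p * h_exp p q d"
  proof -
    have "1 / q \<le> 1 / p" using p pq by (simp add: divide_left_mono)
    then have "h_exp p q d = real n * (1 / p - 1 / q)" by (simp add: h_exp_def n)
    moreover have "\<rho> - 1 = conj_exp p * (1 / p - 1 / q)"
      using p q by (simp add: \<rho>_def conj_exp_def field_simps)
    ultimately show ?thesis by simp
  qed
  obtain C where C: "C \<ge> 0" and bound: "\<And>N B. N \<ge> 1 \<Longrightarrow> finite B \<Longrightarrow> card B \<le> N \<Longrightarrow>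
      inj_on (\<lambda>b. restrict b {..<Suc n}) B \<Longrightarrow>
    (\<integral>\<^sup>+t. ennreal (overlap (1 / \<rho>) (Suc n) B t powr \<rho>) \<partial>volume (Suc n))
      \<le> ennreal (C * (1 + ln (real N)) powr (real n * (\<rho> - 1)) * real (card B))"
    using overlap_bound[OF \<rho>(1), of n] by blast
  show thesis
  proof (rule that[of "C + 1"])
    fix N :: nat and B and y :: "point set \<Rightarrow> 'k"
    assume N: "N \<ge> 1" and B: "finite B" "B \<subseteq> dyadic_rects d" "card B \<le> N" and y: "y \<in> X"
    have "\<exists>b. I = rect d b" if "I \<in> B" for I using that B(2) dyadic_rectsE by blast
    then obtain code where code: "\<And>I. I \<in> B \<Longrightarrow> I = rect d (code I)" by metis
    \<comment> \<open>Codes agreeing in the first d coordinates describe the same rectangle, and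
      each rectangle in \<open>B\<close> has one chosen code.\<close>
    have inj: "inj_on (\<lambda>b. restrict b {..<Suc n}) (code ` B)"
    proof (rule inj_onI)
      fix b b' assume "b \<in> code ` B" "b' \<in> code ` B" "restrict b {..<Suc n} = restrict b' {..<Suc n}"
      then show "b = b'" using code rect_restrict[of d b] rect_restrict[of d b'] n by (metis imageE)
    qed
    have inj': "inj_on code B" using code by (metis inj_onI)
    define \<Theta> where "\<Theta> = (C + 1) * (1 + ln (real N)) powr (conj_exp p * h_exp p q d) * real N"
    have "(\<integral>\<^sup>+t. ennreal ((\<Sum>I\<in>B. (weight p q d I t powr (p / q)) powr (conj_exp q / conj_exp p)) powr (conj_exp p / conj_exp q)) \<partial>volume d)
       = (\<integral>\<^sup>+t. ennreal (overlap (1 / \<rho>) (Suc n) (code ` B) t powr \<rho>) \<partial>volume (Suc n))"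
      unfolding n[symmetric] \<rho>(2) \<rho>_def[symmetric]
    proof (rule nn_integral_cong)
      fix t assume t: "t \<in> space (volume d)"
      have "(\<Sum>I\<in>B. (weight p q d I t powr (p / q)) powr (1 / \<rho>)) = overlap (1 / \<rho>) d (code ` B) t"
        unfolding overlap_def sum.reindex[OF inj'] o_def
      proof (rule sum.cong)
        fix I assume "I \<in> B"
        have "(weight p q d I t powr (p / q)) powr (1 / \<rho>) = measure (volume d) I powr (- (1 / \<rho>)) * indicator I t"
          using p q by (simp only: powr_powr) (subst weight_powr, auto)
        also have "\<dots> = measure (volume d) (rect d (code I)) powr (- (1 / \<rho>)) * indicator (rect d (code I)) t"
          using code[OF \<open>I \<in> B\<close>] by simp
        also have "\<dots> = (\<Prod>i<d. 2 powr (1 / \<rho> * real (fst (code I i))) * indicator (dyadic (code I i)) (t i))"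
          by (rule rect_weight[OF t])
        finally show "(weight p q d I t powr (p / q)) powr (1 / \<rho>)
          = (\<Prod>i<d. 2 powr (1 / \<rho> * real (fst (code I i))) * indicator (dyadic (code I i)) (t i))" .
      qed simp
      then show "ennreal ((\<Sum>I\<in>B. (weight p q d I t powr (p / q)) powr (1 / \<rho>)) powr \<rho>)
          = ennreal (overlap (1 / \<rho>) d (code ` B) t powr \<rho>)" by simp
    qed
    also have "\<dots> \<le> ennreal (C * (1 + ln (real N)) powr (real n * (\<rho> - 1)) * real (card (code ` B)))"
      using N B inj by (intro bound) (auto simp: card_image[OF inj'])
    also have "\<dots> \<le> ennreal \<Theta>"
      unfolding \<Theta>_def h using C B card_image[OF inj'] by (intro ennreal_leI mult_mono) auto
    finally show "(\<Sum>I\<in>B. norm (y I)) \<le>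
        ((C + 1) * (1 + ln (real N)) powr (conj_exp p * h_exp p q d) * real N) powr (1 / conj_exp p) * nrm y"
      unfolding \<Theta>_def[symmetric] using C by (intro sum_norm_le_dual y B) (auto simp: \<Theta>_def)
  qed (use C in auto)
qed

text \<open>The scalar type is left general, so that the real and the complex case are
  instances.\<close>

lemma wcga_dyadic_bound:
  assumes d: "d \<ge> 1" and \<tau>: "0 < \<tau>"
  shows "\<exists>c>0. \<exists>C>0. \<forall>N\<ge>1. \<forall>x \<in> f_space p q d. \<forall>G :: nat \<Rightarrow> point set \<Rightarrow> 'k::real_normed_field.
            wcga_run (f_space p q d) (f_norm p q d) (canonical_basis d) \<tau> x G \<longrightarrow>
            f_norm p q d (x - G (phi_steps p q d c N))
              \<le> C * sigma_N (f_norm p q d) (canonical_basis d) N x"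
proof -
  define s' where "s' = (if p \<le> q then conj_exp p else conj_exp q)"
  define \<psi> where "\<psi> = (\<lambda>N::nat. (1 + ln (real N)) powr (conj_exp p * h_exp p q d) * real N powr alpha_exp p q)"
  have p': "conj_exp p > 1" and q': "conj_exp q > 1" using p q by (auto simp: conj_exp_def)
  have \<psi>: "real N \<le> \<psi> N" "1 \<le> \<psi> N" if "N \<ge> 1" for N
  proof -
    have "h_exp p q d \<ge> 0" using d by (simp add: h_exp_def)
    then have "1 \<le> (1 + ln (real N)) powr (conj_exp p * h_exp p q d)"
      using that p' by (intro ge_one_powr_ge_zero) auto
    moreover have "alpha_exp p q \<ge> 1"
      using p q by (auto simp: alpha_exp_def conj_exp_def field_simps)
    then have "real N powr 1 \<le> real N powr alpha_exp p q"
      using that by (intro powr_mono) auto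
    ultimately have "1 * real N \<le> \<psi> N"
      unfolding \<psi>_def using that by (intro mult_mono) auto
    then show "real N \<le> \<psi> N" "1 \<le> \<psi> N" using that by auto
  qed
  \<comment> \<open>For p \<le> q, \<Lambda>^p' is a constant times \<psi>(N), with \<alpha> = 1.
    For q < p the exponent of the logarithm is 0, and \<Lambda> = N^(1/p') gives \<Lambda>^q' =
    N^(q'/p') = \<psi>(N).\<close>
  obtain H \<Lambda> where H: "H \<ge> 0" and \<Lambda>: "\<And>N. N \<ge> 1 \<Longrightarrow> \<Lambda> N > 0" "\<And>N. N \<ge> 1 \<Longrightarrow> \<Lambda> N powr s' \<le> H * \<psi> N"
    and \<Lambda>_bound: "\<And>N B y. N \<ge> 1 \<Longrightarrow> finite B \<Longrightarrow> B \<subseteq> dyadic_rects d \<Longrightarrow> card B \<le> N \<Longrightarrow> (y :: point set \<Rightarrow> 'k) \<in> X \<Longrightarrow>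
        (\<Sum>I\<in>B. norm (y I)) \<le> \<Lambda> N * nrm y"
  proof (cases "p \<le> q")
    case True
    obtain C where C: "C > 0" and *: "\<And>N B y. N \<ge> 1 \<Longrightarrow> finite B \<Longrightarrow> B \<subseteq> dyadic_rects d \<Longrightarrow> card B \<le> N \<Longrightarrow>
        (y :: point set \<Rightarrow> 'k) \<in> X \<Longrightarrow> (\<Sum>I\<in>B. norm (y I)) \<le>
          (C * (1 + ln (real N)) powr (conj_exp p * h_exp p q d) * real N) powr (1 / conj_exp p) * nrm y"
      by (rule dyadic_sum_norm_le[OF d True]) blast
    define \<Lambda> where "\<Lambda> = (\<lambda>N::nat. (C * (1 + ln (real N)) powr (conj_exp p * h_exp p q d) * real N) powr (1 / conj_exp p))"
    show thesis
    proof (rule that[of C \<Lambda>])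
      fix N :: nat assume N: "N \<ge> 1"
      have "1 + ln (real N) > 0" using N by (simp add: add_pos_nonneg)
      then have pos: "C * (1 + ln (real N)) powr (conj_exp p * h_exp p q d) * real N > 0" using C N by simp
      show "\<Lambda> N > 0"
        unfolding \<Lambda>_def powr_gt_zero by (rule less_imp_neq[OF pos, symmetric])
      show "\<Lambda> N powr s' \<le> C * \<psi> N"
        using pos p' N True by (simp add: \<Lambda>_def s'_def \<psi>_def powr_powr alpha_exp_def)
    qed (use C * in \<open>auto simp: \<Lambda>_def\<close>)
  next
    case False
    define \<Lambda> where "\<Lambda> = (\<lambda>N::nat. real N powr (1 / conj_exp p))"
    show thesis
    proof (rule that[of 1 \<Lambda>])
      fix N :: nat assume N: "N \<ge> 1"
      then show "\<Lambda> N > 0" by (simp add: \<Lambda>_def)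
      have "1 / p \<le> 1 / q" using q False by (simp add: divide_left_mono)
      then have "h_exp p q d = 0" by (simp add: h_exp_def)
      moreover have "1 + ln (real N) > 0" using N by (simp add: add_pos_nonneg)
      ultimately show "\<Lambda> N powr s' \<le> 1 * \<psi> N"
        using False by (simp add: \<Lambda>_def s'_def \<psi>_def powr_powr alpha_exp_def)
    next
      fix N :: nat and B and y :: "point set \<Rightarrow> 'k"
      assume *: "finite B" "B \<subseteq> dyadic_rects d" "card B \<le> N" "y \<in> X"
      have "(\<Sum>I\<in>B. norm (y I)) \<le> real (card B) powr (1 / conj_exp p) * nrm y"
        using False * by (intro sum_norm_le) auto
      also have "\<dots> \<le> \<Lambda> N * nrm y"
        unfolding \<Lambda>_def using * p' nrm_nonneg by (intro mult_right_mono powr_mono2) auto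
      finally show "(\<Sum>I\<in>B. norm (y I)) \<le> \<Lambda> N * nrm y" .
    qed auto
  qed
  obtain C where C: "C > 0" and main: "\<And>N \<Lambda> \<psi> n (x :: point set \<Rightarrow> 'k) G. 0 < \<Lambda> \<Longrightarrow> \<Lambda> powr s' \<le> H * \<psi> \<Longrightarrow> 0 < \<psi> \<Longrightarrow> real N \<le> \<psi> \<Longrightarrow>
      2 * \<psi> \<le> real n \<Longrightarrow>
     (\<And>B (y :: point set \<Rightarrow> 'k). finite B \<Longrightarrow> B \<subseteq> dyadic_rects d \<Longrightarrow> card B \<le> N \<Longrightarrow> y \<in> X \<Longrightarrow>
        (\<Sum>I\<in>B. norm (y I)) \<le> \<Lambda> * nrm y) \<Longrightarrow>
     x \<in> X \<Longrightarrow> wcga_run X nrm (unit_seq ` dyadic_rects d) \<tau> x G \<Longrightarrow>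
        nrm (x - G n) \<le> C * sigma_N nrm (unit_seq ` dyadic_rects d) N x"
    by (rule wcga_bound[OF \<tau> H, folded s'_def]) blast
  show ?thesis
    unfolding f_space_eq f_norm_eq canonical_basis_def
  proof (rule exI[of _ 3], intro conjI exI[of _ C] allI ballI impI)
    fix N :: nat and x :: "point set \<Rightarrow> 'k" and G
    assume N: "N \<ge> 1" and x: "x \<in> X" and run: "wcga_run X nrm (unit_seq ` dyadic_rects d) \<tau> x G"
    \<comment> \<open>With c = 3, rounding down loses at most 1 \<le> \<psi>(N), which leaves the
      required 2\<psi>(N) steps.\<close>
    have "2 * \<psi> N \<le> real (phi_steps p q d 3 N)"
    proof -
      have "phi_steps p q d 3 N = nat \<lfloor>3 * \<psi> N\<rfloor>" by (simp add: phi_steps_def \<psi>_def mult.assoc)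
      then show ?thesis using \<psi>(2)[OF N] by linarith
    qed
    then show "nrm (x - G (phi_steps p q d 3 N)) \<le> C * sigma_N nrm (unit_seq ` dyadic_rects d) N x"
      using \<Lambda>(1,2)[OF N] \<psi>[OF N] by (intro main[of "\<Lambda> N" "\<psi> N"] \<Lambda>_bound[OF N] x run) auto
  qed (use C in auto)
qed

end

theorem theorem5p16:
  fixes d :: nat and p q \<tau> :: real
  assumes "d \<ge> 1" and "1 < p" and "1 < q" and "0 < \<tau>" and "\<tau> \<le> 1"
  shows "(\<exists>c>0. \<exists>C>0. \<forall>N\<ge>1. \<forall>x \<in> f_space p q d. \<forall>G :: nat \<Rightarrow> point set \<Rightarrow> real.
            wcga_run (f_space p q d) (f_norm p q d) (canonical_basis d) \<tau> x G \<longrightarrow>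
            f_norm p q d (x - G (phi_steps p q d c N))
              \<le> C * sigma_N (f_norm p q d) (canonical_basis d) N x) \<and>
         (\<exists>c>0. \<exists>C>0. \<forall>N\<ge>1. \<forall>x \<in> f_space p q d. \<forall>G :: nat \<Rightarrow> point set \<Rightarrow> complex.
            wcga_run (f_space p q d) (f_norm p q d) (canonical_basis d) \<tau> x G \<longrightarrow>
            f_norm p q d (x - G (phi_steps p q d c N))
              \<le> C * sigma_N (f_norm p q d) (canonical_basis d) N x)"
  using wcga_dyadic_bound[OF assms(2,3,1,4), where 'k = real]
    wcga_dyadic_bound[OF assms(2,3,1,4), where 'k = complex] by (rule conjI)

end
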